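(* Let $\wp(x)$ be the Weierstrass elliptic function satisfying $(\wp'(x))^2=4\wp^3(x)+g_2\wp(x)+g_3$, and let $n\in\mathbb{N}$. The operator $$L_4=\partial_x^4+n(4n+1)(4n+3)(4n+4)\,\wp^2(x)$$ commutes with a differential operator of order $4n+2$ if and only if $\wp(x)$ is a solution of the equation $(\wp'(x))^2=4(\wp(x))^3+g_2\wp(x)$ (that is, $g_3=0$). If, in this situation, $g_2=0$, then one obtains $L_4=\partial_x^4+\dfrac{n(4n+1)(4n+3)(4n+4)}{x^4}$. Moreover, calculations show that for $n$ less than $8$ the spectral curve (of $L_4$, with $g_3=0$, and the commuting operator of order $4n+2$) is non-singular for almost all $g_2$.
   Context: Differential operators are ordinary scalar linear differential operators in $x$; $\partial_x=d/dx$; $\mathbb{N}=\{1,2,3,\dots\}$; $g_2,g_3$ are complex constants. Note the sign convention $(\wp')^2=4\wp^3+g_2\wp+g_3$. Here $\wp$ is the solution with a double pole at $x=0$, $\wp(x)=x^{-2}+O(x^2)$; in the degenerate case $g_2=g_3=0$ it is $\wp(x)=1/x^2$. If two differential operators $L,M$ commute, there is a nonzero polynomial $R(z,w)$ with $R(L,M)=0$, and the curve $R(z,w)=0$ is called the spectral curve of the pair. *)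

theory Defs
  imports "HOL-Complex_Analysis.Complex_Analysis" "HOL-Library.Landau_Symbols"
begin

text \<open>
  A meromorphic function is represented by a function on all of the complex plane whose values
  are irrelevant on a closed discrete set; hence identities between meromorphic functions are
  stated with the quantifier \<open>\<forall>\<^sub>\<approx>\<close> (all points outside such a set).
\<close>

definition weierstrass_ode :: "complex \<Rightarrow> complex \<Rightarrow> (complex \<Rightarrow> complex) \<Rightarrow> bool" where
  "weierstrass_ode g2 g3 p \<longleftrightarrow> (\<forall>\<^sub>\<approx>x. (deriv p x)\<^sup>2 = 4 * p x ^ 3 + g2 * p x + g3)"

text \<open>
  Note the signs of \<open>g2\<close> and \<open>g3\<close>, opposite to the usual ones. No condition on the discriminant
  is imposed, so the degenerate (trigonometric and rational) solutions are included.
  The differential equation and the expansion at 0 determine \<open>p\<close> up to its values on a closed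
  discrete set.
\<close>

definition weierstrass_p :: "complex \<Rightarrow> complex \<Rightarrow> (complex \<Rightarrow> complex) \<Rightarrow> bool" where
  "weierstrass_p g2 g3 p \<longleftrightarrow>
     p meromorphic_on UNIV \<and> weierstrass_ode g2 g3 p \<and>
     (\<lambda>x. p x - 1 / x\<^sup>2) \<in> O[at 0](\<lambda>x. x\<^sup>2)"

text \<open>
  Linear differential operators have meromorphic coefficients and are identified with their
  action on functions. Two of them are equal if they agree on all meromorphic functions;
  the product is composition.
\<close>

type_synonym oper = "(complex \<Rightarrow> complex) \<Rightarrow> complex \<Rightarrow> complex"

definition diff_op :: "nat \<Rightarrow> (nat \<Rightarrow> complex \<Rightarrow> complex) \<Rightarrow> oper" where
  "diff_op N a = (\<lambda>f x. \<Sum>i\<le>N. a i x * (deriv ^^ i) f x)"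

definition diff_op_of_order :: "nat \<Rightarrow> oper \<Rightarrow> bool" where
  "diff_op_of_order N T \<longleftrightarrow>
     (\<exists>a. (\<forall>i\<le>N. a i meromorphic_on UNIV) \<and> \<not> (\<forall>\<^sub>\<approx>x. a N x = 0) \<and> T = diff_op N a)"

definition oper_eq :: "oper \<Rightarrow> oper \<Rightarrow> bool" where
  "oper_eq S T \<longleftrightarrow> (\<forall>f. f meromorphic_on UNIV \<longrightarrow> (\<forall>\<^sub>\<approx>x. S f x = T f x))"

definition opers_commute :: "oper \<Rightarrow> oper \<Rightarrow> bool" where
  "opers_commute S T \<longleftrightarrow> oper_eq (S \<circ> T) (T \<circ> S)"

definition L4 :: "nat \<Rightarrow> (complex \<Rightarrow> complex) \<Rightarrow> oper" where
  "L4 n p = (\<lambda>f x. (deriv ^^ 4) f x +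
     of_nat (n * (4 * n + 1) * (4 * n + 3) * (4 * n + 4)) * (p x)\<^sup>2 * f x)"

text \<open>
  A polynomial \<open>R(z, w)\<close> is an element of \<open>complex poly poly\<close>: the outer variable is \<open>w\<close>
  and the inner one is \<open>z\<close>. Thus \<open>\<partial>R/\<partial>z\<close> is \<open>map_poly pderiv R\<close> and \<open>\<partial>R/\<partial>w\<close> is \<open>pderiv R\<close>.
\<close>

definition eval2 :: "complex poly poly \<Rightarrow> complex \<Rightarrow> complex \<Rightarrow> complex" where
  "eval2 R z w = poly (poly R [:w:]) z"

definition oper_poly :: "complex poly poly \<Rightarrow> oper \<Rightarrow> oper \<Rightarrow> oper" where
  "oper_poly R L M = (\<lambda>f x. \<Sum>j\<le>degree R. \<Sum>i\<le>degree (coeff R j).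
     coeff (coeff R j) i * (L ^^ i) ((M ^^ j) f) x)"

definition annihilates :: "complex poly poly \<Rightarrow> oper \<Rightarrow> oper \<Rightarrow> bool" where
  "annihilates R L M \<longleftrightarrow> oper_eq (oper_poly R L M) (\<lambda>f x. 0)"

text \<open>
  Any multiple of an annihilating polynomial is again annihilating. The spectral curve is given by
  the generator of the ideal of all annihilating polynomials, which is unique up to a nonzero
  constant factor.
\<close>

definition spectral_polynomial :: "oper \<Rightarrow> oper \<Rightarrow> complex poly poly \<Rightarrow> bool" where
  "spectral_polynomial L M R \<longleftrightarrow>
     R \<noteq> 0 \<and> annihilates R L M \<and> (\<forall>S. annihilates S L M \<longrightarrow> R dvd S)"

definition nonsingular_curve :: "complex poly poly \<Rightarrow> bool" where
  "nonsingular_curve R \<longleftrightarrow>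
     (\<forall>z w. eval2 R z w = 0 \<longrightarrow>
        eval2 (map_poly pderiv R) z w \<noteq> 0 \<or> eval2 (pderiv R) z w \<noteq> 0)"

definition nonsingular_spectral_curve :: "oper \<Rightarrow> oper \<Rightarrow> bool" where
  "nonsingular_spectral_curve L M \<longleftrightarrow> (\<exists>R. spectral_polynomial L M R \<and> nonsingular_curve R)"

end

theory Submission
  imports Defs
begin

text \<open>
Write \<open>c\<^sub>n = n(4n+1)(4n+3)(4n+4)\<close>, \<open>W = c\<^sub>n p\<^sup>2\<close> and \<open>L = D\<^sup>4 + W\<close>. Meromorphic functions are replaced
by their Laurent expansions at 0. These form a field with a derivation, and two functions agree
almost everywhere as soon as their expansions agree (\<open>germ_eq_iff\<close>), so that all identities between
operators are proved for Laurent series.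

\<^bold>\<open>Existence.\<close> For a polynomial \<open>Q\<close> in the spectral parameter \<open>z\<close> with coefficients \<open>Q\<^sub>i\<close> depending on \<open>x\<close>,
consider \<open>M = \<Sum>\<^sub>i (2 Q\<^sub>i D\<^sup>2 - 2 Q\<^sub>i' D + Q\<^sub>i'') L\<^sup>i\<close>. On solutions of \<open>L \<psi> = z \<psi>\<close> it acts as the second order
operator \<open>2 Q D\<^sup>2 - 2 Q' D + Q''\<close>. It commutes with \<open>L\<close> if \<open>Q''''' + 4 (z - W) Q' - 2 W' Q = 0\<close>, and then
\<open>M\<^sup>2 = F(L)\<close> with \<open>F = 4 (z - W) Q\<^sup>2 + 2 Q Q'''' - 2 Q' Q''' + Q''\<^sup>2\<close> (\<open>rank2_op_commute\<close>, \<open>rank2_op_square\<close>).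
For \<open>g3 = 0\<close> there is a solution \<open>Q = \<Sum>\<^sub>j q\<^sub>j(z) p\<^sup>2\<^sup>j\<close> with \<open>j \<le> n\<close>. Indeed the equation links only powers of \<open>p\<close>
of equal parity, the coefficient of \<open>q\<^sub>j\<close> in it is a multiple of \<open>c\<^sub>j - c\<^sub>n\<close>, and so \<open>q\<^sub>n = 1\<close> can be continued downwards
by a recursion with two terms (\<open>lame_poly_wp_ode\<close>). As \<open>F\<close> does not depend on \<open>x\<close>, putting \<open>p = 0\<close> gives
\<open>F = q\<^sub>0 (4 z q\<^sub>0 + 3 g2\<^sup>2 q\<^sub>1)\<close>.

\<^bold>\<open>Necessity.\<close> A differential operator sends \<open>x\<^sup>s\<close> to \<open>\<Sum>\<^sub>d R\<^sub>d(s) x\<^sup>s\<^sup>+\<^sup>d\<close> with polynomials \<open>R\<^sub>d\<close>. If it commutes with \<open>L\<close>,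
its lowest polynomial \<open>q = R\<^sub>-\<^sub>m\<close> has degree \<open>m\<close> and satisfies \<open>P(s - m) q(s) = P(s) q(s - 4)\<close>, where
\<open>P(s) = s(s-1)(s-2)(s-3) + c\<^sub>n\<close> has the roots \<open>3/2 \<plusminus> (2n+1) \<plusminus> i \<beta>\<close>. Following the zeros of \<open>q\<close> upwards in steps of 4
shows that \<open>m = 4j\<close> or \<open>m = 4j + 4n + 2\<close> (\<open>homogeneous_orders\<close>). For \<open>m = 4n + 2\<close>, the equation six degrees above
the lowest one has a right-hand side proportional to \<open>g3\<close>. It is summed with an integrating factor along a
chain of step 4 between two zeros of \<open>P\<close>. All unknown values cancel, and what remains is a nonzero multiple of \<open>g3\<close> times a sum of
complex numbers with positive real part, hence \<open>g3 = 0\<close> (\<open>weight_six_obstruction\<close>).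

\<^bold>\<open>Spectral curve.\<close> By the same difference equations the operators of order \<open>4n + 2\<close> commuting with \<open>L\<close> are
\<open>b M + A(L)\<close> with \<open>b \<noteq> 0\<close> (\<open>commutant_order\<close>). Such an operator is annihilated by \<open>(w - A)\<^sup>2 - b\<^sup>2 F\<close>, which generates
the annihilating ideal, because the pole orders of \<open>A(L)\<close> and \<open>B(L) M\<close> differ modulo 4. The curve is
non-singular when \<open>F\<close> has only simple zeros. Scaling reduces this to \<open>g2 = 1\<close>; the two factors of \<open>F\<close> have no
common zero by the recursion, and each has simple zeros by a Bezout identity for every \<open>n < 8\<close>.
\<close>

section \<open>Operators of rank two commuting with a quartic operator\<close>

text \<open>
The linear functional \<open>z\<^sup>i \<mapsto> v\<^sub>i\<close>. With \<open>v\<^sub>i = D\<^sup>k L\<^sup>i F\<close> it turns identities between polynomials in \<open>z\<close>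
into identities between operators.
\<close>

definition poly_app :: "'a::comm_ring_1 poly \<Rightarrow> (nat \<Rightarrow> 'a) \<Rightarrow> 'a" where
  "poly_app A v = (\<Sum>i\<le>degree A. coeff A i * v i)"

lemma poly_app_bound:
  assumes "degree A \<le> N"
  shows "poly_app A v = (\<Sum>i\<le>N. coeff A i * v i)"
  unfolding poly_app_def
  by (rule sum.mono_neutral_left) (use assms in \<open>auto simp: coeff_eq_0\<close>)

lemma poly_app_0 [simp]: "poly_app 0 v = 0"
  by (simp add: poly_app_def)

lemma poly_app_add: "poly_app (A + B) v = poly_app A v + poly_app B v"
proof -
  have "degree (A + B) \<le> max (degree A) (degree B)" by (rule degree_add_le_max)
  then show ?thesis
    by (simp add: poly_app_bound[of _ "max (degree A) (degree B)"] sum.distrib algebra_simps)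
qed

lemma poly_app_smult: "poly_app (smult a A) v = a * poly_app A v"
  using degree_smult_le[of a A]
  by (simp add: poly_app_bound[of _ "degree A"] sum_distrib_left algebra_simps)

lemma poly_app_minus: "poly_app (- A) v = - poly_app A v"
  using poly_app_smult[of "-1" A v] by simp

lemma poly_app_diff: "poly_app (A - B) v = poly_app A v - poly_app B v"
  using poly_app_add[of A "- B" v] by (simp add: poly_app_minus)

lemma poly_app_pCons: "poly_app (pCons a A) v = a * v 0 + poly_app A (\<lambda>i. v (Suc i))"
proof -
  have "poly_app (pCons a A) v = (\<Sum>i\<le>Suc (degree A). coeff (pCons a A) i * v i)"
    by (rule poly_app_bound) (rule degree_pCons_le)
  also have "\<dots> = a * v 0 + (\<Sum>i\<le>degree A. coeff A i * v (Suc i))"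
    by (subst sum.atMost_Suc_shift) simp
  finally show ?thesis by (simp add: poly_app_def)
qed

lemma poly_app_add_fun: "poly_app A (\<lambda>i. u i + v i) = poly_app A u + poly_app A v"
  by (simp add: poly_app_def sum.distrib algebra_simps)

lemma poly_app_diff_fun: "poly_app A (\<lambda>i. u i - v i) = poly_app A u - poly_app A v"
  by (simp add: poly_app_def sum_subtractf algebra_simps)

lemma poly_app_mult_fun: "poly_app A (\<lambda>i. b * v i) = b * poly_app A v"
  by (simp add: poly_app_def sum_distrib_left algebra_simps)

text \<open>
Composing operators multiplies their polynomials. Since this multiplication is commutative, all terms that
are antisymmetric in two factors vanish in \<open>rank2_op_square\<close> below.
\<close>

lemma poly_app_mult: "poly_app A (\<lambda>i. poly_app B (\<lambda>j. v (i + j))) = poly_app (A * B) v"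
proof (induction A arbitrary: v)
  case (pCons a A)
  have "poly_app (pCons a A) (\<lambda>i. poly_app B (\<lambda>j. v (i + j))) =
      a * poly_app B v + poly_app A (\<lambda>i. poly_app B (\<lambda>j. v (Suc (i + j))))"
    by (simp add: poly_app_pCons)
  also have "\<dots> = a * poly_app B v + poly_app (A * B) (\<lambda>i. v (Suc i))"
    using pCons.IH[of "\<lambda>i. v (Suc i)"] by simp
  finally show ?case
    by (simp add: poly_app_add poly_app_smult poly_app_pCons)
qed simp

definition coeff_deriv :: "complex fls poly \<Rightarrow> complex fls poly" where
  "coeff_deriv A = map_poly fls_deriv A"

lemma coeff_coeff_deriv [simp]: "coeff (coeff_deriv A) i = fls_deriv (coeff A i)"
  by (simp add: coeff_deriv_def coeff_map_poly)

lemma degree_coeff_deriv: "degree (coeff_deriv A) \<le> degree A"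
  by (rule degree_le) (simp add: coeff_eq_0)

lemma coeff_deriv_0 [simp]: "coeff_deriv 0 = 0"
  by (simp add: coeff_deriv_def)

lemma coeff_deriv_add [simp]: "coeff_deriv (A + B) = coeff_deriv A + coeff_deriv B"
  by (rule poly_eqI) simp

lemma coeff_deriv_diff [simp]: "coeff_deriv (A - B) = coeff_deriv A - coeff_deriv B"
  by (rule poly_eqI) simp

lemma coeff_deriv_pCons [simp]: "coeff_deriv (pCons a A) = pCons (fls_deriv a) (coeff_deriv A)"
  by (rule poly_eqI) (simp add: coeff_pCons split: nat.split)

lemma coeff_deriv_smult: "coeff_deriv (smult a A) = smult a (coeff_deriv A) + smult (fls_deriv a) A"
  by (rule poly_eqI) simp

definition quartic_op :: "complex fls \<Rightarrow> complex fls \<Rightarrow> complex fls" where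
  "quartic_op W F = (fls_deriv ^^ 4) F + W * F"

text \<open>
On solutions of \<open>L F = z F\<close> this is \<open>A(z)\<close> times the \<open>k\<close>-th derivative of \<open>F\<close>. Keeping \<open>z\<close> formal makes the
identities valid for all \<open>F\<close>.
\<close>

definition jet :: "complex fls \<Rightarrow> nat \<Rightarrow> complex fls poly \<Rightarrow> complex fls \<Rightarrow> complex fls" where
  "jet W k A F = poly_app A (\<lambda>i. (fls_deriv ^^ k) ((quartic_op W ^^ i) F))"

lemma jet_add: "jet W k (A + B) F = jet W k A F + jet W k B F"
  and jet_diff: "jet W k (A - B) F = jet W k A F - jet W k B F"
  and jet_smult: "jet W k (smult a A) F = a * jet W k A F"
  by (simp_all add: jet_def poly_app_add poly_app_diff poly_app_smult)

lemma jet_shift: "jet W k A (quartic_op W F) = jet W k (pCons 0 A) F"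
  by (simp add: jet_def poly_app_pCons funpow_swap1)

lemma jet_mult: "poly_app A (\<lambda>i. jet W k B ((quartic_op W ^^ i) F)) = jet W k (A * B) F"
proof -
  have "poly_app A (\<lambda>i. jet W k B ((quartic_op W ^^ i) F)) =
     poly_app A (\<lambda>i. poly_app B (\<lambda>j. (fls_deriv ^^ k) ((quartic_op W ^^ (i + j)) F)))"
    unfolding jet_def by (subst add.commute) (simp add: funpow_add)
  then show ?thesis
    using poly_app_mult[of A B "\<lambda>j. (fls_deriv ^^ k) ((quartic_op W ^^ j) F)"]
    by (simp add: jet_def)
qed

lemma deriv_jet: "fls_deriv (jet W k A F) = jet W k (coeff_deriv A) F + jet W (Suc k) A F"
  using degree_coeff_deriv[of A]
  by (simp add: jet_def poly_app_bound[of _ "degree A"] fls_deriv_sum sum.distrib[symmetric]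
      algebra_simps)

text \<open>
Since \<open>D\<^sup>4 = L - W\<close>, jets of order at least four reduce to lower order at the price of a factor \<open>z - W\<close>.
\<close>

lemma jet_four: "jet W 4 A F = jet W 0 ([:- W, 1:] * A) F"
proof -
  have "jet W 4 A F = poly_app A (\<lambda>i. (quartic_op W ^^ Suc i) F - W * (quartic_op W ^^ i) F)"
    by (simp add: jet_def quartic_op_def)
  then show ?thesis
    by (simp add: jet_def poly_app_add poly_app_smult poly_app_pCons poly_app_diff poly_app_diff_fun
        poly_app_mult_fun poly_app_minus)
qed

text \<open>
On solutions of \<open>L F = z F\<close> this acts as \<open>2 Q D\<^sup>2 - 2 Q' D + Q''\<close>.
\<close>

definition rank2_op :: "complex fls \<Rightarrow> complex fls poly \<Rightarrow> complex fls \<Rightarrow> complex fls" where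
  "rank2_op W Q F = 2 * jet W 2 Q F - 2 * jet W 1 (coeff_deriv Q) F
     + jet W 0 (coeff_deriv (coeff_deriv Q)) F"

lemma coeff_deriv_smult_numeral [simp]:
  "coeff_deriv (smult (numeral m) A) = smult (numeral m) (coeff_deriv A)"
  by (simp add: coeff_deriv_smult)

lemma jet_0 [simp]: "jet W k 0 F = 0"
  by (simp add: jet_def)

lemma rank2_op_shift: "rank2_op W Q (quartic_op W F) =
    2 * jet W 2 (pCons 0 Q) F - 2 * jet W 1 (pCons 0 (coeff_deriv Q)) F
      + jet W 0 (pCons 0 (coeff_deriv (coeff_deriv Q))) F"
  by (simp add: rank2_op_def jet_shift)

lemma deriv_rank2_op:
  "fls_deriv (rank2_op W Q F) = 2 * jet W 3 Q F - jet W 1 (coeff_deriv (coeff_deriv Q)) F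
     + jet W 0 (coeff_deriv (coeff_deriv (coeff_deriv Q))) F"
  by (simp add: rank2_op_def deriv_jet algebra_simps eval_nat_numeral)

lemma deriv2_rank2_op:
  fixes Q W F
  defines "D \<equiv> coeff_deriv"
  shows "fls_deriv (fls_deriv (rank2_op W Q F)) =
     2 * jet W 4 Q F + 2 * jet W 3 (D Q) F - jet W 2 (D (D Q)) F + jet W 0 (D (D (D (D Q)))) F"
  by (simp add: deriv_rank2_op deriv_jet algebra_simps eval_nat_numeral D_def)

definition rank2_ode :: "complex fls \<Rightarrow> complex fls poly \<Rightarrow> complex fls poly" where
  "rank2_ode W Q = (coeff_deriv ^^ 5) Q + smult 4 ([:- W, 1:] * coeff_deriv Q)
     - smult (2 * fls_deriv W) Q"

lemma fls_deriv_numeral_mult: "fls_deriv (numeral m * F) = numeral m * fls_deriv (F :: complex fls)"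
  by simp

text \<open>
After reduction by \<open>D\<^sup>4 = L - W\<close> the commutator has only jets of order at most one. The first one is
twice the differential equation, and the zeroth one is its derivative.
\<close>

lemma rank2_op_commute:
  assumes "rank2_ode W Q = 0"
  shows "quartic_op W (rank2_op W Q F) = rank2_op W Q (quartic_op W F)"
proof -
  define D where "D = coeff_deriv"
  define J where "J k A = jet W k A F" for k A
  have J_add: "J k (A + B) = J k A + J k B" and J_diff: "J k (A - B) = J k A - J k B"
    and J_smult: "J k (smult a A) = a * J k A" for k a A B
    by (simp_all add: J_def jet_add jet_diff jet_smult)
  have J_four: "J 4 A = J 0 (pCons 0 A) - W * J 0 A" for A
    by (simp add: J_def jet_four jet_diff jet_smult)
  have J_deriv: "fls_deriv (J 0 A) = J 0 (D A) + J 1 A"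
    "fls_deriv (J 1 A) = J 1 (D A) + J 2 A"
    "fls_deriv (J 2 A) = J 2 (D A) + J 3 A"
    "fls_deriv (J 3 A) = J 3 (D A) + (J 0 (pCons 0 A) - W * J 0 A)" for A
    unfolding J_four[symmetric] by (simp_all add: J_def D_def deriv_jet eval_nat_numeral)
  have D_rules: "D (pCons 0 A) = pCons 0 (D A)" for A
    by (simp add: D_def)
  note rules = J_four J_deriv D_rules fls_deriv_add fls_deriv_sub fls_deriv_mult fls_deriv_numeral
    mult_zero_left mult_zero_right add_0_left add_0_right
  have ode: "D (D (D (D (D Q)))) + smult 4 (pCons 0 (D Q) - smult W (D Q)) - smult (2 * fls_deriv W) Q = 0"
    using assms by (simp add: rank2_ode_def D_def eval_nat_numeral)
  have ode1: "J 1 (D (D (D (D (D Q))))) + 4 * (J 1 (pCons 0 (D Q)) - W * J 1 (D Q))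
      - 2 * fls_deriv W * J 1 Q = 0"
    using arg_cong[OF ode, of "J 1"] unfolding J_add J_diff J_smult by (simp add: J_def)
  have "D (D (D (D (D (D Q))))) + smult 4 (pCons 0 (D (D Q)) - (smult W (D (D Q)) + smult (fls_deriv W) (D Q)))
      - (smult (2 * fls_deriv W) (D Q) + smult (2 * fls_deriv (fls_deriv W)) Q) = 0"
    using arg_cong[OF ode, of D]
    by (simp only: D_def coeff_deriv_add coeff_deriv_diff coeff_deriv_smult coeff_deriv_smult_numeral
        coeff_deriv_pCons fls_deriv_numeral_mult fls_deriv_zero coeff_deriv_0 fls_deriv_numeral smult_0_left add_0_right)
  from arg_cong[OF this, of "J 0"]
  have ode0: "J 0 (D (D (D (D (D (D Q))))))
      + 4 * (J 0 (pCons 0 (D (D Q))) - (W * J 0 (D (D Q)) + fls_deriv W * J 0 (D Q)))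
      - (2 * fls_deriv W * J 0 (D Q) + 2 * fls_deriv (fls_deriv W) * J 0 Q) = 0"
    unfolding J_add J_diff J_smult by (simp add: J_def)
  have T: "rank2_op W Q F = 2 * J 2 Q - 2 * J 1 (D Q) + J 0 (D (D Q))"
    by (simp add: rank2_op_def J_def D_def)
  have d2: "fls_deriv (fls_deriv (rank2_op W Q F)) =
     2 * J 4 Q + 2 * J 3 (D Q) - J 2 (D (D Q)) + J 0 (D (D (D (D Q))))"
    by (simp add: deriv2_rank2_op J_def D_def)
  have d3: "fls_deriv (fls_deriv (fls_deriv (rank2_op W Q F))) =
     2 * J 1 (pCons 0 Q) - 2 * W * J 1 Q
     + 4 * (J 0 (pCons 0 (D Q)) - W * J 0 (D Q)) - 2 * fls_deriv W * J 0 Q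
     + J 3 (D (D Q)) - J 2 (D (D (D Q))) + J 1 (D (D (D (D Q)))) + J 0 (D (D (D (D (D Q)))))"
    unfolding d2 by (simp only: rules) algebra
  have d4: "fls_deriv (fls_deriv (fls_deriv (fls_deriv (rank2_op W Q F)))) =
     2 * J 2 (pCons 0 Q) - 2 * W * J 2 Q - 4 * fls_deriv W * J 1 Q
     + 6 * (J 1 (pCons 0 (D Q)) - W * J 1 (D Q)) + 2 * J 1 (D (D (D (D (D Q)))))
     + 5 * (J 0 (pCons 0 (D (D Q))) - W * J 0 (D (D Q))) - 6 * fls_deriv W * J 0 (D Q)
     - 2 * fls_deriv (fls_deriv W) * J 0 Q + J 0 (D (D (D (D (D (D Q))))))"
    unfolding d3 by (simp only: rules) algebra
  have r: "rank2_op W Q (quartic_op W F) =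
      2 * J 2 (pCons 0 Q) - 2 * J 1 (pCons 0 (D Q)) + J 0 (pCons 0 (D (D Q)))"
    by (simp add: rank2_op_shift J_def D_def)
  have "quartic_op W (rank2_op W Q F) - rank2_op W Q (quartic_op W F) =
     2 * (J 1 (D (D (D (D (D Q))))) + 4 * (J 1 (pCons 0 (D Q)) - W * J 1 (D Q))
      - 2 * fls_deriv W * J 1 Q) + (J 0 (D (D (D (D (D (D Q))))))
      + 4 * (J 0 (pCons 0 (D (D Q))) - (W * J 0 (D (D Q)) + fls_deriv W * J 0 (D Q)))
      - (2 * fls_deriv W * J 0 (D Q) + 2 * fls_deriv (fls_deriv W) * J 0 Q))"
  proof -
    have "(fls_deriv ^^ 4) G = fls_deriv (fls_deriv (fls_deriv (fls_deriv G)))" for G :: "complex fls"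
      by (simp add: eval_nat_numeral)
    then have q: "quartic_op W (rank2_op W Q F) =
        fls_deriv (fls_deriv (fls_deriv (fls_deriv (rank2_op W Q F)))) + W * rank2_op W Q F"
      by (simp add: quartic_op_def)
    show ?thesis
      by (simp only: q r) (simp only: d4, simp only: T, algebra)
  qed
  then show ?thesis unfolding ode1 ode0 by simp
qed

definition rank2_square :: "complex fls \<Rightarrow> complex fls poly \<Rightarrow> complex fls poly" where
  "rank2_square W Q = smult 4 ([:- W, 1:] * Q\<^sup>2) + smult 2 (Q * (coeff_deriv ^^ 4) Q)
     - smult 2 (coeff_deriv Q * (coeff_deriv ^^ 3) Q) + ((coeff_deriv ^^ 2) Q)\<^sup>2"

lemma rank2_op_funpow_commute:
  assumes "rank2_ode W Q = 0"
  shows "(quartic_op W ^^ i) (rank2_op W Q F) = rank2_op W Q ((quartic_op W ^^ i) F)"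
  by (induction i) (simp_all add: rank2_op_commute[OF assms])

text \<open>
In the product the jets of orders one, two and three are antisymmetric in the two factors, so only the
jet of order zero survives.
\<close>

theorem rank2_op_square:
  assumes "rank2_ode W Q = 0"
  shows "rank2_op W Q (rank2_op W Q F) = jet W 0 (rank2_square W Q) F"
proof -
  define D where "D = coeff_deriv"
  define J where "J k A = jet W k A F" for k A
  have J_add: "J k (A + B) = J k A + J k B" and J_diff: "J k (A - B) = J k A - J k B"
    and J_smult: "J k (smult a A) = a * J k A" for k a A B
    by (simp_all add: J_def jet_add jet_diff jet_smult)
  have jm: "poly_app A (\<lambda>i. jet W k B ((quartic_op W ^^ i) F)) = J k (A * B)" for k A B
    by (simp add: J_def jet_mult)
  note app_rules = poly_app_add_fun poly_app_diff_fun poly_app_mult_fun jm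
  have j0: "jet W 0 A (rank2_op W Q F) = 2 * J 2 (A * Q) - 2 * J 1 (A * D Q) + J 0 (A * D (D Q))" for A
    unfolding jet_def[of W 0 A] rank2_op_funpow_commute[OF assms]
    by (simp add: rank2_op_def app_rules D_def)
  have j1: "jet W 1 A (rank2_op W Q F) = 2 * J 3 (A * Q) - J 1 (A * D (D Q)) + J 0 (A * D (D (D Q)))" for A
    unfolding jet_def[of W 1 A] rank2_op_funpow_commute[OF assms]
    by (simp add: deriv_rank2_op app_rules D_def)
  have j2: "jet W 2 A (rank2_op W Q F) = 2 * J 0 (A * ([:- W, 1:] * Q)) + 2 * J 3 (A * D Q)
      - J 2 (A * D (D Q)) + J 0 (A * D (D (D (D Q))))" for A
  proof -
    have "(fls_deriv ^^ 2) G = fls_deriv (fls_deriv G)" for G :: "complex fls"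
      by (simp add: numeral_2_eq_2)
    then have "jet W 2 A (rank2_op W Q F) =
       poly_app A (\<lambda>i. fls_deriv (fls_deriv (rank2_op W Q ((quartic_op W ^^ i) F))))"
      by (simp add: jet_def[of W 2 A] rank2_op_funpow_commute[OF assms])
    then show ?thesis
      unfolding deriv2_rank2_op jet_four app_rules D_def .
  qed
  have sq: "J 0 (rank2_square W Q) = 4 * J 0 (Q * ([:- W, 1:] * Q)) + 2 * J 0 (Q * D (D (D (D Q))))
     - 2 * J 0 (D Q * D (D (D Q))) + J 0 (D (D Q) * D (D Q))"
    unfolding rank2_square_def J_add J_diff J_smult
    by (simp add: eval_nat_numeral D_def mult.left_commute[of _ Q] del: mult_pCons_left)
  have "rank2_op W Q (rank2_op W Q F) = 2 * jet W 2 Q (rank2_op W Q F)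
      - 2 * jet W 1 (D Q) (rank2_op W Q F) + jet W 0 (D (D Q)) (rank2_op W Q F)"
    by (simp add: rank2_op_def[of W Q "rank2_op W Q F"] D_def)
  also have "\<dots> = J 0 (rank2_square W Q)"
    unfolding j0 j1 j2 sq mult.commute[of "D (D Q)" Q] mult.commute[of "D Q" Q] mult.commute[of "D (D Q)" "D Q"]
    by algebra
  finally show ?thesis by (simp add: J_def)
qed

section \<open>The commuting operator on the curve with vanishing \<open>g3\<close>\<close>

abbreviation const_poly :: "complex poly \<Rightarrow> complex fls poly" where
  "const_poly a \<equiv> map_poly fls_const a"

lemma coeff_const_poly [simp]: "coeff (const_poly a) i = fls_const (coeff a i)"
  by (simp add: coeff_map_poly)

lemma const_poly_add: "const_poly (a + b) = const_poly a + const_poly b"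
  by (rule poly_eqI) (simp add: fls_plus_const)

lemma const_poly_pCons: "const_poly (pCons a b) = pCons (fls_const a) (const_poly b)"
  by (rule poly_eqI) (simp add: coeff_pCons split: nat.split)

lemma const_poly_smult: "const_poly (smult a b) = smult (fls_const a) (const_poly b)"
  by (rule poly_eqI) (simp add: fls_const_mult_const)

lemma const_poly_mult: "const_poly (a * b) = const_poly a * const_poly b"
proof (induction a)
  case (pCons a1 a2)
  then show ?case by (simp add: const_poly_add const_poly_pCons const_poly_smult)
qed simp

lemma coeff_deriv_const_poly [simp]: "coeff_deriv (const_poly a) = 0"
  by (rule poly_eqI) simp

text \<open>
Evaluation at \<open>y = p\<close> of a polynomial in \<open>y\<close> whose coefficients are polynomials in \<open>z\<close>. The polynomial in \<open>y\<close> is kept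
as the outer one because the differential equation is solved coefficientwise in \<open>p\<close>.
\<close>

definition plug :: "complex fls \<Rightarrow> complex poly poly \<Rightarrow> complex fls poly" where
  "plug p u = poly (map_poly const_poly u) [:p:]"

lemma plug_0 [simp]: "plug p 0 = 0"
  by (simp add: plug_def)

lemma plug_pCons: "plug p (pCons a u) = const_poly a + smult p (plug p u)"
proof -
  have "map_poly const_poly (pCons a u) = pCons (const_poly a) (map_poly const_poly u)"
    by (rule poly_eqI) (simp add: coeff_pCons coeff_map_poly split: nat.split)
  then show ?thesis by (simp add: plug_def)
qed

lemma plug_add: "plug p (u + v) = plug p u + plug p v"
proof (induction u v rule: poly_induct2)
  case (pCons a u b v)
  then show ?case by (simp add: plug_pCons const_poly_add smult_add_right)
qed simp

lemma plug_smult: "plug p (smult a u) = const_poly a * plug p u"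
  by (induction u) (simp_all add: plug_pCons const_poly_mult algebra_simps)

lemma plug_mult: "plug p (u * v) = plug p u * plug p v"
  by (induction u) (simp_all add: plug_add plug_smult plug_pCons algebra_simps)

lemma plug_diff: "plug p (u - v) = plug p u - plug p v"
  using plug_add[of p "u - v" v] by simp

lemma coeff_deriv_plug: "coeff_deriv (plug p u) = smult (fls_deriv p) (plug p (pderiv u))"
  by (induction u)
    (simp_all add: plug_pCons pderiv_pCons plug_add coeff_deriv_smult smult_add_right mult.commute)

text \<open>
The second derivative of \<open>u(p)\<close>, namely \<open>u''(p) p'\<^sup>2 + u'(p) p''\<close>, when \<open>p'\<^sup>2 = 4 p\<^sup>3 + g p\<close>.
\<close>

definition wp_deriv2 :: "complex \<Rightarrow> complex poly poly \<Rightarrow> complex poly poly" where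
  "wp_deriv2 g u = pderiv (pderiv u) * [:0, [:g:], 0, [:4:]:] + pderiv u * [:[:g / 2:], 0, [:6:]:]"

text \<open>
The operators \<open>rank2_ode\<close> and \<open>rank2_square\<close> for \<open>Q = u(p)\<close>, the first one divided by \<open>p'\<close>. Both are
polynomials in \<open>p\<close>, since the odd derivatives of \<open>u(p)\<close> are \<open>p'\<close> times such polynomials.
\<close>

definition wp_ode :: "complex \<Rightarrow> complex \<Rightarrow> complex poly poly \<Rightarrow> complex poly poly" where
  "wp_ode g c u = pderiv (wp_deriv2 g (wp_deriv2 g u))
     + smult 4 ([:[:0, 1:], 0, [:- c:]:] * pderiv u) - [:0, [:4 * c:]:] * u"

definition wp_square :: "complex \<Rightarrow> complex \<Rightarrow> complex poly poly \<Rightarrow> complex poly poly" where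
  "wp_square g c u = smult 4 ([:[:0, 1:], 0, [:- c:]:] * u\<^sup>2)
     + smult 2 (u * wp_deriv2 g (wp_deriv2 g u))
     - smult 2 (pderiv u * pderiv (wp_deriv2 g u) * [:0, [:g:], 0, [:4:]:]) + (wp_deriv2 g u)\<^sup>2"

lemma const_poly_const: "const_poly [:a:] = [:fls_const a:]"
  by (simp add: const_poly_pCons)

lemma coeff_deriv2_plug:
  assumes "(fls_deriv p)\<^sup>2 = 4 * p ^ 3 + fls_const g * p"
    and "fls_deriv (fls_deriv p) = 6 * p\<^sup>2 + fls_const (g / 2)"
  shows "coeff_deriv (coeff_deriv (plug p u)) = plug p (wp_deriv2 g u)"
proof -
  have n: "fls_const 4 = (4 :: complex fls)" "fls_const 6 = (6 :: complex fls)"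
    by (simp_all add: fls_const_numeral)
  have "coeff_deriv (coeff_deriv (plug p u)) =
      smult ((fls_deriv p)\<^sup>2) (plug p (pderiv (pderiv u))) + smult (fls_deriv (fls_deriv p)) (plug p (pderiv u))"
    by (simp add: coeff_deriv_plug coeff_deriv_smult power2_eq_square)
  also have "\<dots> = plug p (wp_deriv2 g u)"
    unfolding assms wp_deriv2_def plug_add plug_mult
    by (simp add: plug_pCons const_poly_const n algebra_simps power2_eq_square power3_eq_cube
        smult_add_left)
  finally show ?thesis .
qed

lemma plug_numeral_smult: "plug p (smult (numeral m) u) = smult (numeral m) (plug p u)"
proof -
  have "smult (numeral m) u = smult [:numeral m:] u"
    by (simp add: numeral_poly)
  also have "plug p \<dots> = smult (numeral m) (plug p u)"
    by (simp only: plug_smult const_poly_const) (simp add: fls_const_numeral)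
  finally show ?thesis .
qed

lemma rank2_ode_plug:
  assumes "(fls_deriv p)\<^sup>2 = 4 * p ^ 3 + fls_const g * p"
    and "fls_deriv (fls_deriv p) = 6 * p\<^sup>2 + fls_const (g / 2)"
  shows "rank2_ode (fls_const c * p\<^sup>2) (plug p u) = smult (fls_deriv p) (plug p (wp_ode g c u))"
proof -
  note d2 = coeff_deriv2_plug[OF assms]
  have d5: "(coeff_deriv ^^ 5) (plug p u) = smult (fls_deriv p) (plug p (pderiv (wp_deriv2 g (wp_deriv2 g u))))"
    by (simp add: eval_nat_numeral d2) (simp add: coeff_deriv_plug)
  have V: "plug p [:[:0, 1:], 0, [:- c:]:] = [:- (fls_const c * p\<^sup>2), 1:]"
    by (simp add: plug_pCons const_poly_pCons power2_eq_square mult_ac fls_const_uminus)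
  have U: "plug p [:0, [:4 * c:]:] = [:4 * fls_const c * p:]"
    by (simp add: plug_pCons const_poly_pCons mult_ac flip: fls_const_mult_const)
  show ?thesis
    unfolding rank2_ode_def wp_ode_def plug_add plug_diff plug_mult plug_numeral_smult d5 V U
    by (simp add: coeff_deriv_plug power2_eq_square smult_diff_right smult_add_right algebra_simps)
qed

lemma rank2_square_plug:
  assumes "(fls_deriv p)\<^sup>2 = 4 * p ^ 3 + fls_const g * p"
    and "fls_deriv (fls_deriv p) = 6 * p\<^sup>2 + fls_const (g / 2)"
  shows "rank2_square (fls_const c * p\<^sup>2) (plug p u) = plug p (wp_square g c u)"
proof -
  note d2 = coeff_deriv2_plug[OF assms]
  have d4: "(coeff_deriv ^^ 4) (plug p u) = plug p (wp_deriv2 g (wp_deriv2 g u))"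
    and d3: "(coeff_deriv ^^ 3) (plug p u) = smult (fls_deriv p) (plug p (pderiv (wp_deriv2 g u)))"
    and d2': "(coeff_deriv ^^ 2) (plug p u) = plug p (wp_deriv2 g u)"
    by (simp_all add: eval_nat_numeral d2) (simp_all add: coeff_deriv_plug)
  have V: "plug p [:[:0, 1:], 0, [:- c:]:] = [:- (fls_const c * p\<^sup>2), 1:]"
    by (simp add: plug_pCons const_poly_pCons power2_eq_square mult_ac fls_const_uminus)
  have S: "plug p [:0, [:g:], 0, [:4:]:] = [:(fls_deriv p)\<^sup>2:]"
    unfolding assms
    by (simp add: plug_pCons const_poly_pCons power3_eq_cube algebra_simps fls_const_numeral)
  have P: "plug p (v\<^sup>2) = (plug p v)\<^sup>2" for v
    by (simp add: power2_eq_square plug_mult)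
  show ?thesis
    unfolding rank2_square_def wp_square_def plug_add plug_diff plug_numeral_smult plug_mult P d4 d3 d2' V S
    by (simp add: coeff_deriv_plug power2_eq_square)
qed

text \<open>
This is the identity \<open>F' = 2 Q (Q''''' + 4 (z - W) Q' - 2 W' Q)\<close> after division by \<open>p'\<close>. Hence \<open>F\<close> is constant along
solutions.
\<close>

lemma pderiv_wp_square: "pderiv (wp_square g c u) = smult 2 (u * wp_ode g c u)"
proof -
  define S :: "complex poly poly" where "S = [:0, [:g:], 0, [:4:]:]"
  define T :: "complex poly poly" where "T = [:[:g / 2:], 0, [:6:]:]"
  define V :: "complex poly poly" where "V = [:[:0, 1:], 0, [:- c:]:]"
  define v where "v = wp_deriv2 g u"
  define w where "w = wp_deriv2 g v"
  have S: "pderiv S = 2 * T"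
    by (simp add: S_def T_def pderiv_pCons numeral_poly)
  have V: "2 * pderiv V = - [:0, [:4 * c:]:]"
    by (simp add: V_def pderiv_pCons numeral_poly)
  have v: "v = pderiv (pderiv u) * S + pderiv u * T"
    by (simp add: v_def wp_deriv2_def S_def T_def)
  have w: "w = pderiv (pderiv v) * S + pderiv v * T"
    by (simp add: w_def wp_deriv2_def S_def T_def)
  have 1: "wp_square g c u = 4 * (V * u\<^sup>2) + 2 * (u * w) - 2 * (pderiv u * pderiv v * S) + v\<^sup>2"
    by (simp add: wp_square_def S_def V_def v_def w_def numeral_mult_conv_smult)
  have "wp_ode g c u = pderiv w + 4 * (V * pderiv u) + - [:0, [:4 * c:]:] * u"
    by (simp add: wp_ode_def V_def v_def w_def numeral_mult_conv_smult
        del: mult_pCons_left minus_pCons)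
  then have 2: "smult 2 (u * wp_ode g c u) = 2 * u * (pderiv w + 4 * (V * pderiv u) + 2 * pderiv V * u)"
    unfolding V by (simp only: numeral_mult_conv_smult mult_smult_left)
  have n: "pderiv (4 :: complex poly poly) = 0" "pderiv (2 :: complex poly poly) = 0"
    by (simp_all add: numeral_poly)
  have "pderiv (wp_square g c u) - smult 2 (u * wp_ode g c u) =
     2 * pderiv u * (w - (pderiv (pderiv v) * S + pderiv v * T))
     + 2 * pderiv v * (v - (pderiv (pderiv u) * S + pderiv u * T))"
    unfolding 1 2 power2_eq_square pderiv_add pderiv_diff pderiv_mult n S by algebra
  then show ?thesis using v w by simp
qed

lemma coeff_wp_deriv2_Suc:
  "coeff (wp_deriv2 g v) (Suc k) = smult (2 * of_nat k * (2 * of_nat k + 1)) (coeff v k)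
     + smult ((of_nat k + 2) * (2 * of_nat k + 3) * (g / 2)) (coeff v (k + 2))"
proof -
  define h where "h = g / 2"
  have h: "g = 2 * h" "g / 2 = h" by (simp_all add: h_def)
  consider "k = 0" | "k = 1" | m where "k = Suc (Suc m)"
    by (metis One_nat_def not0_implies_Suc)
  then show ?thesis
    unfolding wp_deriv2_def h
    by cases (auto intro!: poly_eqI simp: coeff_pderiv coeff_pCons of_nat_poly numeral_poly
       eval_nat_numeral algebra_simps)
qed

lemma coeff_wp_deriv2_0: "coeff (wp_deriv2 g v) 0 = smult (g / 2) (coeff v 1)"
  by (simp add: wp_deriv2_def coeff_pderiv)

text \<open>
\<open>wp_deriv2\<close> shifts the degree in \<open>y\<close> by one up and by one down, so the differential equation relates only
coefficients whose indices differ by two. For \<open>k = 2 j\<close> the factor \<open>C\<close> is \<open>lame_const j\<close>, which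
explains the constant in front of \<open>p\<^sup>2\<close>.
\<close>

lemma coeff_wp_ode_Suc:
  fixes u :: "complex poly poly"
  defines "K \<equiv> \<lambda>s. 2 * s\<^sup>2 * (4 * s\<^sup>2 + 5)"
    and "G \<equiv> \<lambda>s. s * (2 * s - 1) * (s - 1) * (2 * s - 3) / 4"
    and "C \<equiv> \<lambda>s. s * (2 * s + 1) * (2 * s + 3) * (2 * s + 4) / 2"
  shows "coeff (wp_ode g c u) (Suc k) =
     smult (4 * (of_nat k + 1) * (C (of_nat k) - c)) (coeff u k)
     + smult (of_nat k + 2) ([:g * K (of_nat k + 2), 4:] * coeff u (k + 2)
          + smult (g\<^sup>2 * G (of_nat k + 4)) (coeff u (k + 4)))"
proof -
  define x :: complex where "x = of_nat k"
  define h where "h = g / 2"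
  have h: "g = 2 * h" "g / 2 = h" by (simp_all add: h_def)
  have "coeff ([:[:0, 1:], 0, [:- c:]:] * pderiv u) (Suc k) =
     smult (x + 2) (pCons 0 (coeff u (k + 2))) - smult (c * x) (coeff u k)"
    by (cases k) (simp_all add: coeff_pderiv of_nat_poly x_def algebra_simps flip: smult_add_left)
  moreover have "coeff ([:0, [:4 * c:]:] * u) (Suc k) = smult (4 * c) (coeff u k)"
    by simp
  moreover have "coeff (pderiv (wp_deriv2 g (wp_deriv2 g u))) (Suc k) =
      smult (x + 2) (coeff (wp_deriv2 g (wp_deriv2 g u)) (Suc (k + 1)))"
    by (simp add: coeff_pderiv of_nat_poly x_def add.commute)
  moreover have "coeff (wp_deriv2 g (wp_deriv2 g u)) (Suc (k + 1)) =
     smult (2 * (x + 1) * (2 * x + 3)) (coeff (wp_deriv2 g u) (Suc k))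
     + smult ((x + 3) * (2 * x + 5) * h) (coeff (wp_deriv2 g u) (Suc (k + 2)))"
    by (subst coeff_wp_deriv2_Suc) (simp add: x_def h_def algebra_simps)
  moreover have "coeff (wp_deriv2 g u) (Suc k) =
     smult (2 * x * (2 * x + 1)) (coeff u k) + smult ((x + 2) * (2 * x + 3) * h) (coeff u (k + 2))"
    by (subst coeff_wp_deriv2_Suc) (simp add: x_def h_def algebra_simps)
  moreover have "coeff (wp_deriv2 g u) (Suc (k + 2)) =
     smult (2 * (x + 2) * (2 * x + 5)) (coeff u (k + 2)) + smult ((x + 4) * (2 * x + 7) * h) (coeff u (k + 4))"
    by (subst coeff_wp_deriv2_Suc) (simp add: x_def h_def algebra_simps eval_nat_numeral)
  ultimately have "coeff (wp_ode g c u) (Suc k) =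
     smult (x + 2) (smult (2 * (x + 1) * (2 * x + 3))
         (smult (2 * x * (2 * x + 1)) (coeff u k) + smult ((x + 2) * (2 * x + 3) * h) (coeff u (k + 2)))
       + smult ((x + 3) * (2 * x + 5) * h)
         (smult (2 * (x + 2) * (2 * x + 5)) (coeff u (k + 2)) + smult ((x + 4) * (2 * x + 7) * h) (coeff u (k + 4))))
     + smult 4 (smult (x + 2) (pCons 0 (coeff u (k + 2))) - smult (c * x) (coeff u k))
     - smult (4 * c) (coeff u k)"
    by (simp add: wp_ode_def numeral_mult_conv_smult del: mult_pCons_left)
  also have "\<dots> = smult (4 * (x + 1) * (C x - c)) (coeff u k)
     + smult (x + 2) ([:g * K (x + 2), 4:] * coeff u (k + 2)
          + smult (g\<^sup>2 * G (x + 4)) (coeff u (k + 4)))"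
    (is "?l = ?r")
  proof (rule poly_eqI)
    show "coeff ?l i = coeff ?r i" for i
      unfolding C_def K_def G_def h(1)
      by (cases i) (simp_all add: field_simps power2_eq_square)
  qed
  finally show ?thesis by (simp add: x_def)
qed

lemma coeff_wp_ode_0:
  assumes "coeff u 1 = 0" "coeff u 3 = 0"
  shows "coeff (wp_ode g c u) 0 = 0"
proof -
  have "coeff (wp_deriv2 g u) (Suc 1) = 0"
    unfolding coeff_wp_deriv2_Suc using assms by (simp add: eval_nat_numeral)
  then have "coeff (wp_deriv2 g (wp_deriv2 g u)) (Suc 0) = 0"
    by (subst coeff_wp_deriv2_Suc) (simp add: eval_nat_numeral)
  then show ?thesis using assms
    by (simp add: wp_ode_def coeff_pderiv)
qed

text \<open>
The polynomial is constant in \<open>y\<close>, so its value can be read off at \<open>y = 0\<close>, where almost all terms vanish.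
\<close>

lemma wp_square_eq_const:
  assumes "wp_ode g c u = 0" "coeff u 1 = 0"
  shows "wp_square g c u = [:coeff u 0 * (pCons 0 (smult 4 (coeff u 0)) + smult (3 * g\<^sup>2) (coeff u 2)):]"
proof -
  have "pderiv (wp_square g c u) = 0"
    using assms by (simp add: pderiv_wp_square)
  then have "degree (wp_square g c u) = 0"
    by (simp add: pderiv_eq_0_iff)
  then have "wp_square g c u = [:coeff (wp_square g c u) 0:]"
    by (metis degree_eq_zeroE coeff_pCons_0)
  moreover have "coeff (wp_square g c u) 0 =
      coeff u 0 * (pCons 0 (smult 4 (coeff u 0)) + smult (3 * g\<^sup>2) (coeff u 2))"
  proof -
    have 1: "coeff (wp_deriv2 g u) (Suc 0) = smult (3 * g) (coeff u 2)"
      unfolding coeff_wp_deriv2_Suc by (simp add: eval_nat_numeral)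
    have 0: "coeff (wp_deriv2 g u) 0 = 0"
      using assms by (simp add: coeff_wp_deriv2_0)
    have "coeff (wp_deriv2 g (wp_deriv2 g u)) 0 = smult (3 * g\<^sup>2 / 2) (coeff u 2)"
      unfolding coeff_wp_deriv2_0 using 1 by (simp add: power2_eq_square mult_ac)
    with 0 show ?thesis
      by (simp add: wp_square_def coeff_mult_0 power2_eq_square numeral_poly algebra_simps)
  qed
  ultimately show ?thesis by simp
qed


definition lame_const :: "nat \<Rightarrow> nat" where
  "lame_const n = n * (4 * n + 1) * (4 * n + 3) * (4 * n + 4)"

lemma lame_const_less: "j < n \<Longrightarrow> lame_const j < lame_const n"
  unfolding lame_const_def by (intro mult_strict_mono) auto

text \<open>
The coefficients \<open>q\<^sub>j\<close> of the solution, computed downwards from \<open>q\<^sub>n = 1\<close>. The division is possible because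
\<open>lame_const\<close> is strictly increasing.
\<close>

function lame_coeff :: "complex \<Rightarrow> nat \<Rightarrow> nat \<Rightarrow> complex poly" where
  "lame_coeff g n j = (if j > n then 0 else if j = n then 1 else
     smult ((of_nat j + 1) / (2 * (2 * of_nat j + 1) * (of_nat (lame_const n) - of_nat (lame_const j))))
       ([:g * (8 * (of_nat j + 1)\<^sup>2 * (16 * (of_nat j + 1)\<^sup>2 + 5)), 4:] * lame_coeff g n (Suc j)
        + smult (g\<^sup>2 * ((of_nat j + 2) * (4 * of_nat j + 7) * (2 * of_nat j + 3) * (4 * of_nat j + 5) / 2))
            (lame_coeff g n (Suc (Suc j)))))"
  by pat_completeness auto
termination by (relation "Wellfounded.measure (\<lambda>(g, n, j). Suc n - j)") auto

declare lame_coeff.simps [simp del]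

definition lame_poly :: "complex \<Rightarrow> nat \<Rightarrow> complex poly poly" where
  "lame_poly g n = (\<Sum>j\<le>n. monom (lame_coeff g n j) (2 * j))"

lemma coeff_lame_poly:
  "coeff (lame_poly g n) k = (if even k then lame_coeff g n (k div 2) else 0)"
proof -
  have "coeff (lame_poly g n) k = (\<Sum>j\<le>n. if 2 * j = k then lame_coeff g n j else 0)"
    by (simp add: lame_poly_def coeff_sum)
  also have "\<dots> = (\<Sum>j\<in>{j. j \<le> n \<and> 2 * j = k}. lame_coeff g n j)"
    by (rule sum.mono_neutral_cong_right) auto
  also have "{j. j \<le> n \<and> 2 * j = k} = (if even k \<and> k div 2 \<le> n then {k div 2} else {})"
    by auto
  finally show ?thesis
    by (auto simp: lame_coeff.simps)
qed

lemma lame_coeff_degree: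
  assumes "j \<le> n"
  shows "degree (lame_coeff g n j) \<le> n - j \<and> coeff (lame_coeff g n j) (n - j) \<noteq> 0"
  using assms
proof (induction "n - j" arbitrary: j rule: less_induct)
  case less
  show ?case
  proof (cases "j = n")
    case True
    then show ?thesis by (simp add: lame_coeff.simps)
  next
    case False
    with less.prems have j: "j < n" by simp
    define a where "a = lame_coeff g n (Suc j)"
    define b where "b = lame_coeff g n (Suc (Suc j))"
    have a: "degree a \<le> n - Suc j" "coeff a (n - Suc j) \<noteq> 0"
      using less.hyps[of "Suc j"] j by (auto simp: a_def)
    have b: "degree b < n - j"
    proof (cases "Suc (Suc j) \<le> n")
      case True
      then have "degree b \<le> n - Suc (Suc j)"
        using less.hyps[of "Suc (Suc j)"] j by (simp add: b_def diff_less_mono2)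
      then show ?thesis using True by linarith
    next
      case False
      then show ?thesis using j by (simp add: b_def lame_coeff.simps)
    qed
    obtain \<kappa> \<alpha> \<gamma> where eq: "lame_coeff g n j = smult \<kappa> ([:\<alpha>, 4:] * a + smult \<gamma> b)"
      and \<kappa>: "\<kappa> = (of_nat j + 1) / (2 * (2 * of_nat j + 1) * (of_nat (lame_const n) - of_nat (lame_const j)))"
      using j lame_coeff.simps[of g n j] by (auto simp: a_def b_def)
    have "(of_nat (lame_const n) :: complex) \<noteq> of_nat (lame_const j)"
      using lame_const_less[OF j] by (metis less_irrefl of_nat_eq_iff)
    moreover have "1 + 2 * complex_of_nat j \<noteq> 0" "1 + complex_of_nat j \<noteq> 0"
      using of_nat_neq_0[of "2 * j", where 'a = complex] of_nat_neq_0[of j, where 'a = complex]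
      by simp_all
    ultimately have k0: "\<kappa> \<noteq> 0"
      unfolding \<kappa> divide_eq_0_iff mult_eq_0_iff by (simp add: add.commute)
    have nj: "n - j = Suc (n - Suc j)" using j by simp
    have "coeff (lame_coeff g n j) i = \<kappa> * (\<alpha> * coeff a i + 4 * (case i of 0 \<Rightarrow> 0 | Suc i \<Rightarrow> coeff a i) + \<gamma> * coeff b i)" for i
      unfolding eq by (cases i) (simp_all add: algebra_simps)
    then have *: "coeff (lame_coeff g n j) (Suc i) =
       \<kappa> * (\<alpha> * coeff a (Suc i) + 4 * coeff a i + \<gamma> * coeff b (Suc i))" for i
      by simp
    obtain r where r: "n - j = Suc r" "n - Suc j = r" using nj by blast
    have "degree (lame_coeff g n j) \<le> Suc r"
    proof (rule degree_le, intro allI impI)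
      fix i assume "i > Suc r"
      then obtain i' where "i = Suc i'" "i' > r" by (cases i) auto
      then show "coeff (lame_coeff g n j) i = 0"
        using a(1) b unfolding r by (simp add: * coeff_eq_0)
    qed
    moreover have "coeff (lame_coeff g n j) (Suc r) = \<kappa> * (4 * coeff a r)"
      using a(1) b unfolding r by (simp add: * coeff_eq_0)
    ultimately show ?thesis using a(2) k0 unfolding r by simp
  qed
qed

lemma lame_poly_wp_ode: "wp_ode g (of_nat (lame_const n)) (lame_poly g n) = 0"
proof (rule poly_eqI)
  fix i
  define u where "u = lame_poly g n"
  define c :: complex where "c = of_nat (lame_const n)"
  have odd_coeff: "coeff u k = 0" if "odd k" for k
    using that by (simp add: u_def coeff_lame_poly)
  have ev: "coeff u (2 * j) = lame_coeff g n j" for j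
    by (simp add: u_def coeff_lame_poly)
  consider "i = 0" | k where "i = Suc k" "odd k" | j where "i = Suc (2 * j)"
    by (metis evenE not0_implies_Suc)
  then have "coeff (wp_ode g c u) i = 0"
  proof cases
    case 1
    then show ?thesis using coeff_wp_ode_0[of u g c] odd_coeff by simp
  next
    case (2 k)
    then show ?thesis
      unfolding 2(1) coeff_wp_ode_Suc using odd_coeff[of k] odd_coeff[of "k + 2"] odd_coeff[of "k + 4"]
      by simp
  next
    case (3 j)
    define x :: complex where "x = of_nat j"
    define a where "a = lame_coeff g n (Suc j)"
    define b where "b = lame_coeff g n (Suc (Suc j))"
    have C: "2 * x * (2 * (2 * x) + 1) * (2 * (2 * x) + 3) * (2 * (2 * x) + 4) / 2 =
       of_nat (lame_const j)"
      by (simp add: lame_const_def x_def field_simps)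
    have K: "2 * (2 * x + 2)\<^sup>2 * (4 * (2 * x + 2)\<^sup>2 + 5) = 8 * (x + 1)\<^sup>2 * (16 * (x + 1)\<^sup>2 + 5)"
      by (simp add: power2_eq_square algebra_simps)
    have G: "(2 * x + 4) * (2 * (2 * x + 4) - 1) * ((2 * x + 4) - 1) * (2 * (2 * x + 4) - 3) / 4 =
       (x + 2) * (4 * x + 7) * (2 * x + 3) * (4 * x + 5) / 2"
      by (simp add: field_simps)
    have e: "2 * j + 4 = Suc (Suc (Suc (Suc (2 * j))))" by simp
    have "coeff (wp_ode g c u) i =
      smult (4 * (2 * x + 1) * (of_nat (lame_const j) - c)) (lame_coeff g n j)
      + smult (2 * x + 2) ([:g * (8 * (x + 1)\<^sup>2 * (16 * (x + 1)\<^sup>2 + 5)), 4:] * a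
          + smult (g\<^sup>2 * ((x + 2) * (4 * x + 7) * (2 * x + 3) * (4 * x + 5) / 2)) b)"
      unfolding 3 coeff_wp_ode_Suc a_def b_def ev[of "Suc j", symmetric] ev[of "Suc (Suc j)", symmetric]
        ev[symmetric, of j] C[symmetric] K[symmetric] G[symmetric]
      by (simp add: x_def e)
    also have "\<dots> = 0"
    proof (cases "j < n")
      case False
      then have "a = 0" "b = 0" by (simp_all add: a_def b_def lame_coeff.simps)
      moreover have "lame_coeff g n j = 0 \<or> j = n" using False by (simp add: lame_coeff.simps)
      ultimately show ?thesis by (auto simp: c_def)
    next
      case True
      define d where "d = c - of_nat (lame_const j)"
      have d: "d \<noteq> 0" "of_nat (lame_const j) - c = - d"
        using lame_const_less[OF True] by (auto simp: d_def c_def)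
      have x: "2 * x + 1 \<noteq> 0"
        using of_nat_neq_0[of "2 * j", where 'a = complex] by (simp add: x_def add.commute)
      define Z where "Z = [:g * (8 * (x + 1)\<^sup>2 * (16 * (x + 1)\<^sup>2 + 5)), 4:] * a
          + smult (g\<^sup>2 * ((x + 2) * (4 * x + 7) * (2 * x + 3) * (4 * x + 5) / 2)) b"
      have "lame_coeff g n j = smult ((x + 1) / (2 * (2 * x + 1) * d)) Z"
        using True by (subst lame_coeff.simps) (simp add: Z_def a_def b_def x_def d_def c_def)
      moreover have "- (4 * (2 * x + 1) * d) * ((x + 1) / (2 * (2 * x + 1) * d)) + (2 * x + 2) = 0"
      proof -
        have "- (4 * y * d) * ((x + 1) / (2 * y * d)) + (2 * x + 2) = 0" if "y \<noteq> 0" for y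
          using d that by (simp add: field_simps)
        from this[OF x] show ?thesis .
      qed
      ultimately show ?thesis
        unfolding Z_def[symmetric] d(2)
        by (simp flip: smult_add_left add: algebra_simps)
    qed
    finally show ?thesis .
  qed
  then show "coeff (wp_ode g (of_nat (lame_const n)) (lame_poly g n)) i = coeff 0 i"
    by (simp add: u_def c_def)
qed

text \<open>
The polynomial \<open>F\<close>; the curve is \<open>w\<^sup>2 = F(z)\<close>.
\<close>

definition lame_curve :: "complex \<Rightarrow> nat \<Rightarrow> complex poly" where
  "lame_curve g n = lame_coeff g n 0 *
     (pCons 0 (smult 4 (lame_coeff g n 0)) + smult (3 * g\<^sup>2) (lame_coeff g n 1))"

lemma lame_poly_wp_square: "wp_square g (of_nat (lame_const n)) (lame_poly g n) = [:lame_curve g n:]"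
  by (simp add: wp_square_eq_const[OF lame_poly_wp_ode] coeff_lame_poly lame_curve_def)

section \<open>Symbols of differential operators on Laurent series\<close>

text \<open>
The \<open>i\<close>-th derivative of \<open>x\<^sup>s\<close> is \<open>ffact i\<close> at \<open>s\<close> times \<open>x\<^sup>s\<^sup>-\<^sup>i\<close>.
\<close>

primrec ffact :: "nat \<Rightarrow> complex poly" where
  "ffact 0 = 1"
| "ffact (Suc i) = ffact i * [:- of_nat i, 1:]"

lemma degree_ffact: "degree (ffact i) \<le> i"
proof (induction i)
  case (Suc i)
  have "degree (ffact (Suc i)) \<le> degree (ffact i) + degree [:- of_nat i :: complex, 1:]"
    unfolding ffact.simps by (rule degree_mult_le)
  also have "\<dots> \<le> Suc i" using Suc by simp
  finally show ?case .
qed simp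

lemma coeff_ffact: "coeff (ffact i) i = 1"
proof (induction i)
  case (Suc i)
  then show ?case using degree_ffact[of i] by (simp add: coeff_eq_0)
qed simp

lemma fls_nth_higher_deriv:
  "fls_nth ((fls_deriv ^^ i) F) t = poly (ffact i) (of_int (t + int i)) * fls_nth F (t + int i)"
  by (induction i arbitrary: t) (simp_all add: algebra_simps)

lemma fls_times_nth_bounds:
  fixes f g :: "complex fls"
  assumes f: "\<And>u. u < a \<Longrightarrow> fls_nth f u = 0" and g: "\<And>u. u < b \<Longrightarrow> fls_nth g u = 0"
  shows "fls_nth (f * g) t = (\<Sum>u=a..t - b. fls_nth f u * fls_nth g (t - u))"
proof (cases "f = 0 \<or> g = 0")
  case False
  then have "a \<le> fls_subdegree f" "b \<le> fls_subdegree g"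
    using f g by (auto intro: fls_subdegree_geI)
  then have "(\<Sum>u=fls_subdegree f..t - fls_subdegree g. fls_nth f u * fls_nth g (t - u)) =
      (\<Sum>u=a..t - b. fls_nth f u * fls_nth g (t - u))"
    by (intro sum.mono_neutral_left) auto
  then show ?thesis by (simp add: fls_times_nth(2))
qed auto

text \<open>
\<open>T\<close> sends \<open>x\<^sup>s\<close> to \<open>\<Sum>\<^sub>d R\<^sub>d(s) x\<^sup>s\<^sup>+\<^sup>d\<close>, with polynomials that do not depend on the exponent, and this is compatible with
infinite sums. The bound \<open>N\<close> makes the sums finite.
\<close>

definition has_symbol ::
  "(complex fls \<Rightarrow> complex fls) \<Rightarrow> (int \<Rightarrow> complex poly) \<Rightarrow> int \<Rightarrow> bool" where
  "has_symbol T R N \<longleftrightarrow> (\<forall>d<N. R d = 0) \<and>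
     (\<forall>F lo t. (\<forall>u<lo. fls_nth F u = 0) \<longrightarrow>
        fls_nth (T F) t = (\<Sum>j=lo..t - N. poly (R (t - j)) (of_int j) * fls_nth F j))"

lemma has_symbol_nth:
  assumes "has_symbol T R N" "\<And>u. u < lo \<Longrightarrow> fls_nth F u = 0"
  shows "fls_nth (T F) t = (\<Sum>j=lo..t - N. poly (R (t - j)) (of_int j) * fls_nth F j)"
  using assms unfolding has_symbol_def by blast

lemma has_symbol_low: "has_symbol T R N \<Longrightarrow> d < N \<Longrightarrow> R d = 0"
  unfolding has_symbol_def by blast

lemma fls_nth_X_power: "fls_nth (fls_X ^ k) j = (if j = int k then 1 else (0 :: complex))"
  by (simp add: fls_X_power_conv_shift_1)

lemma has_symbol_X_power:
  assumes "has_symbol T R N"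
  shows "fls_nth (T (fls_X ^ k)) t = poly (R (t - int k)) (of_nat k)"
proof -
  have "fls_nth (T (fls_X ^ k)) t =
      (\<Sum>j=int k..t - N. poly (R (t - j)) (of_int j) * fls_nth (fls_X ^ k) j)"
    using assms by (rule has_symbol_nth) (simp add: fls_nth_X_power)
  also have "\<dots> = (\<Sum>j=int k..t - N. if j = int k then poly (R (t - int k)) (of_nat k) else 0)"
    by (intro sum.cong) (auto simp: fls_nth_X_power)
  also have "\<dots> = poly (R (t - int k)) (of_nat k)"
    using has_symbol_low[OF assms, of "t - int k"] by simp
  finally show ?thesis .
qed

lemma poly_eq_0_if_nat_roots:
  fixes p :: "complex poly"
  assumes "\<And>k::nat. poly p (of_nat k) = 0"
  shows "p = 0"
proof (rule ccontr)
  assume "p \<noteq> 0"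
  then have "finite {x. poly p x = 0}" by (rule poly_roots_finite)
  moreover have "range (of_nat :: nat \<Rightarrow> complex) \<subseteq> {x. poly p x = 0}" using assms by auto
  ultimately show False
    using finite_subset infinite_UNIV_char_0 finite_imageD[of "of_nat :: nat \<Rightarrow> complex" UNIV]
    by (metis infinite_UNIV_nat inj_of_nat)
qed

text \<open>
A polynomial is determined by its values at the natural numbers, so an operator with a symbol is determined by
its action on the powers \<open>x\<^sup>k\<close> with \<open>k \<ge> 0\<close>.
\<close>

lemma has_symbol_unique:
  assumes "has_symbol T R N" "has_symbol T' R' N'" "\<And>k. T (fls_X ^ k) = T' (fls_X ^ k)"
  shows "T = T'"
proof -
  have R: "R d = R' d" for d
  proof -
    have "poly (R d - R' d) (of_nat k) = 0" for k
      using has_symbol_X_power[OF assms(1), of k "d + int k"]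
        has_symbol_X_power[OF assms(2), of k "d + int k"] assms(3)[of k] by simp
    then show ?thesis using poly_eq_0_if_nat_roots[of "R d - R' d"] by simp
  qed
  show ?thesis
  proof (rule ext, rule fls_eqI)
    fix F :: "complex fls" and t
    define lo where "lo = fls_subdegree F"
    have "(\<Sum>j=lo..t - N. poly (R (t - j)) (of_int j) * fls_nth F j) =
        (\<Sum>j=lo..t - min N N'. poly (R (t - j)) (of_int j) * fls_nth F j)"
      by (rule sum.mono_neutral_left) (auto simp: has_symbol_low[OF assms(1)])
    moreover have "(\<Sum>j=lo..t - N'. poly (R' (t - j)) (of_int j) * fls_nth F j) =
        (\<Sum>j=lo..t - min N N'. poly (R' (t - j)) (of_int j) * fls_nth F j)"
      by (rule sum.mono_neutral_left) (auto simp: has_symbol_low[OF assms(2)])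
    ultimately show "fls_nth (T F) t = fls_nth (T' F) t"
      using has_symbol_nth[OF assms(1), of lo F t] has_symbol_nth[OF assms(2), of lo F t]
      by (simp add: R lo_def)
  qed
qed

lemma has_symbol_diff:
  assumes "has_symbol T R N" "has_symbol T' R' N'"
  shows "has_symbol (\<lambda>F. T F - T' F) (\<lambda>d. R d - R' d) (min N N')"
  unfolding has_symbol_def
proof (intro conjI allI impI)
  fix d assume "d < min N N'"
  then show "R d - R' d = 0" using has_symbol_low[OF assms(1)] has_symbol_low[OF assms(2)] by simp
next
  fix F :: "complex fls" and lo t assume lo: "\<forall>u<lo. fls_nth F u = 0"
  have "(\<Sum>j=lo..t - N. poly (R (t - j)) (of_int j) * fls_nth F j) =
      (\<Sum>j=lo..t - min N N'. poly (R (t - j)) (of_int j) * fls_nth F j)"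
    by (rule sum.mono_neutral_left) (auto simp: has_symbol_low[OF assms(1)])
  moreover have "(\<Sum>j=lo..t - N'. poly (R' (t - j)) (of_int j) * fls_nth F j) =
      (\<Sum>j=lo..t - min N N'. poly (R' (t - j)) (of_int j) * fls_nth F j)"
    by (rule sum.mono_neutral_left) (auto simp: has_symbol_low[OF assms(2)])
  ultimately show "fls_nth (T F - T' F) t =
      (\<Sum>j=lo..t - min N N'. poly (R (t - j) - R' (t - j)) (of_int j) * fls_nth F j)"
    using has_symbol_nth[OF assms(1), of lo F t] has_symbol_nth[OF assms(2), of lo F t] lo
    by (simp add: sum_subtractf algebra_simps)
qed

lemma fls_nth_sum: "fls_nth (sum f A) t = (\<Sum>i\<in>A. fls_nth (f i :: complex fls) t)"
  by (induction A rule: infinite_finite_induct) auto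

lemma diff_op_has_symbol:
  fixes a :: "nat \<Rightarrow> complex fls"
  shows "\<exists>R N. has_symbol (\<lambda>F. \<Sum>i\<le>m. a i * (fls_deriv ^^ i) F) R N \<and>
     (\<forall>d. degree (R d) \<le> m \<and> coeff (R d) m = fls_nth (a m) (int m + d))"
proof -
  define N where "N = Min ((\<lambda>i. fls_subdegree (a i) - int i) ` {..m})"
  define R where "R d = (\<Sum>i\<le>m. smult (fls_nth (a i) (int i + d)) (ffact i))" for d
  have N: "N \<le> fls_subdegree (a i) - int i" if "i \<le> m" for i
    unfolding N_def using that by (intro Min_le) auto
  have low: "fls_nth (a i) u = 0" if "i \<le> m" "u < N + int i" for i u
    using N[OF that(1)] that(2) by simp
  have "has_symbol (\<lambda>F. \<Sum>i\<le>m. a i * (fls_deriv ^^ i) F) R N"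
    unfolding has_symbol_def
  proof (intro conjI allI impI)
    fix d assume "d < N"
    then show "R d = 0" by (auto simp: R_def low)
  next
    fix F :: "complex fls" and lo t assume lo: "\<forall>u<lo. fls_nth F u = 0"
    have "fls_nth (a i * (fls_deriv ^^ i) F) t =
        (\<Sum>j=lo..t - N. fls_nth (a i) (int i + (t - j)) * poly (ffact i) (of_int j) * fls_nth F j)"
      if i: "i \<le> m" for i
    proof -
      have "fls_nth (a i * (fls_deriv ^^ i) F) t =
        (\<Sum>u=N + int i..t - (lo - int i). fls_nth (a i) u * fls_nth ((fls_deriv ^^ i) F) (t - u))"
        by (rule fls_times_nth_bounds) (use lo low[OF i] in \<open>auto simp: fls_nth_higher_deriv\<close>)
      also have "\<dots> = (\<Sum>j=lo..t - N. fls_nth (a i) (int i + (t - j))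
           * (poly (ffact i) (of_int j) * fls_nth F j))"
        by (rule sum.reindex_bij_witness[of _ "\<lambda>j. int i + (t - j)" "\<lambda>u. int i + (t - u)"])
           (auto simp: fls_nth_higher_deriv algebra_simps)
      finally show ?thesis by (simp add: mult.assoc)
    qed
    then have "fls_nth (\<Sum>i\<le>m. a i * (fls_deriv ^^ i) F) t =
       (\<Sum>i\<le>m. \<Sum>j=lo..t - N. fls_nth (a i) (int i + (t - j)) * poly (ffact i) (of_int j) * fls_nth F j)"
      by (simp add: fls_nth_sum)
    also have "\<dots> = (\<Sum>j=lo..t - N. poly (R (t - j)) (of_int j) * fls_nth F j)"
      by (subst sum.swap) (simp add: R_def poly_sum sum_distrib_right)
    finally show "fls_nth (\<Sum>i\<le>m. a i * (fls_deriv ^^ i) F) t =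
      (\<Sum>j=lo..t - N. poly (R (t - j)) (of_int j) * fls_nth F j)" .
  qed
  moreover have "degree (R d) \<le> m" for d
    unfolding R_def
    by (intro degree_sum_le) (auto intro: order_trans[OF degree_smult_le] order_trans[OF degree_ffact])
  moreover have "coeff (R d) m = fls_nth (a m) (int m + d)" for d
  proof -
    have "coeff (ffact i) m = 0" if "i < m" for i
      by (rule coeff_eq_0) (use degree_ffact[of i] that in linarith)
    then have "coeff (R d) m = (\<Sum>i\<le>m. if i = m then fls_nth (a m) (int m + d) else 0)"
      unfolding R_def coeff_sum
      by (intro sum.cong) (auto simp: coeff_ffact)
    then show ?thesis by simp
  qed
  ultimately show ?thesis by blast
qed

text \<open>
Compare the coefficients of \<open>x\<^sup>k\<^sup>+\<^sup>d\<^sup>-\<^sup>4\<close> in \<open>T L x\<^sup>k\<close> and \<open>L T x\<^sup>k\<close>. The resulting identity holds at all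
natural \<open>k\<close> and hence everywhere, in particular at the complex roots that are used later.
\<close>

lemma symbol_commute:
  assumes T: "has_symbol T R N"
    and W: "\<And>u. u < -4 \<Longrightarrow> fls_nth W u = 0"
    and comm: "\<And>k. T (quartic_op W (fls_X ^ k)) = quartic_op W (T (fls_X ^ k))"
  shows "poly (ffact 4) (s + of_int d) * poly (R d) s - poly (ffact 4) s * poly (R d) (s - 4) =
     (\<Sum>e=0..d - N. fls_nth W (e - 4) *
        (poly (R (d - e)) (s + of_int e - 4) - poly (R (d - e)) s))"
proof -
  define w where "w e = fls_nth W (e - 4)" for e
  define p where "p = pcompose (ffact 4) [:of_int d, 1:] * R d - ffact 4 * pcompose (R d) [:-4, 1:]
     - (\<Sum>e=0..d - N. smult (w e) (pcompose (R (d - e)) [:of_int e - 4, 1:] - R (d - e)))"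
  have "poly p (of_nat k) = 0" for k
  proof -
    define t where "t = int k + d - 4"
    define G where "G = T (fls_X ^ k)"
    define H where "H = quartic_op W (fls_X ^ k)"
    have G: "fls_nth G u = poly (R (u - int k)) (of_nat k)" for u
      unfolding G_def by (rule has_symbol_X_power[OF T])
    have G0: "fls_nth G u = 0" if "u < int k + N" for u
      using that has_symbol_low[OF T, of "u - int k"] by (simp add: G)
    have "fls_nth (W * fls_X ^ k) u = fls_nth W (u - int k)" for u
      by (subst mult.commute) (simp add: fls_X_power_times_conv_shift)
    then have H: "fls_nth H u = (if u = int k - 4 then poly (ffact 4) (of_nat k) else 0)
        + fls_nth W (u - int k)" for u
      by (auto simp: H_def quartic_op_def fls_nth_higher_deriv fls_nth_X_power)
    have H0: "fls_nth H u = 0" if "u < int k - 4" for u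
      using that by (simp add: H W)
    have "fls_nth (T H) t = (\<Sum>j=int k - 4..t - N. poly (R (t - j)) (of_int j) * fls_nth H j)"
      by (rule has_symbol_nth[OF T H0])
    also have "\<dots> = (\<Sum>e=0..d - N. poly (R (d - e)) (of_nat k + of_int e - 4) *
         ((if e = 0 then poly (ffact 4) (of_nat k) else 0) + w e))"
      by (rule sum.reindex_bij_witness[of _ "\<lambda>e. int k - 4 + e" "\<lambda>j. j - (int k - 4)"])
         (auto simp: H t_def w_def algebra_simps)
    also have "\<dots> = (\<Sum>e=0..d - N. (if e = 0 then poly (R d) (of_nat k - 4) * poly (ffact 4) (of_nat k) else 0))
        + (\<Sum>e=0..d - N. w e * poly (R (d - e)) (of_nat k + of_int e - 4))"
      unfolding sum.distrib[symmetric] by (intro sum.cong) (auto simp: algebra_simps)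
    also have "(\<Sum>e=0..d - N. (if e = 0 then poly (R d) (of_nat k - 4) * poly (ffact 4) (of_nat k) else 0))
        = poly (R d) (of_nat k - 4) * poly (ffact 4) (of_nat k)"
      using has_symbol_low[OF T, of d] by simp
    finally have 1: "fls_nth (T H) t = poly (R d) (of_nat k - 4) * poly (ffact 4) (of_nat k)
        + (\<Sum>e=0..d - N. w e * poly (R (d - e)) (of_nat k + of_int e - 4))" .
    have "fls_nth (W * G) t = (\<Sum>u=-4..t - (int k + N). fls_nth W u * fls_nth G (t - u))"
      by (rule fls_times_nth_bounds) (auto simp: W G0)
    also have "\<dots> = (\<Sum>e=0..d - N. w e * poly (R (d - e)) (of_nat k))"
      by (rule sum.reindex_bij_witness[of _ "\<lambda>e. e - 4" "\<lambda>u. u + 4"])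
         (auto simp: G t_def w_def algebra_simps)
    finally have "fls_nth (quartic_op W G) t = poly (ffact 4) (of_nat k + of_int d) * poly (R d) (of_nat k)
        + (\<Sum>e=0..d - N. w e * poly (R (d - e)) (of_nat k))"
      by (simp add: quartic_op_def fls_nth_higher_deriv G t_def)
    moreover have "fls_nth (T H) t = fls_nth (quartic_op W G) t"
      using comm[of k] by (simp add: H_def G_def)
    ultimately show ?thesis
      using 1 by (simp add: p_def poly_sum poly_pcompose sum_subtractf algebra_simps)
  qed
  then have "p = 0" by (rule poly_eq_0_if_nat_roots)
  then have "poly p s = 0" by simp
  then show ?thesis
    by (simp add: p_def poly_sum poly_pcompose w_def algebra_simps)
qed


text \<open>
Taylor expansion: the shift \<open>q(s + a) = q(s) + a q'(s) + \<dots>\<close> changes the two top coefficients only through the first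
derivative.
\<close>

lemma coeff_shift_second_order:
  fixes q :: "complex poly"
  assumes "degree q \<le> m" "m < i + 2"
  shows "coeff (pcompose q [:a, 1:]) i = coeff q i + a * of_nat (Suc i) * coeff q (Suc i)"
  using assms
proof (induction q arbitrary: m i)
  case (pCons c q)
  show ?case
  proof (cases "q = 0")
    case False
    with pCons.prems obtain m' where m: "m = Suc m'" "degree q \<le> m'"
      by (cases m) auto
    have "pcompose (pCons c q) [:a, 1:] = [:c:] + smult a (pcompose q [:a, 1:]) + pCons 0 (pcompose q [:a, 1:])"
      by (simp add: pcompose_pCons)
    then have *: "coeff (pcompose (pCons c q) [:a, 1:]) i =
        coeff [:c:] i + a * coeff (pcompose q [:a, 1:]) i + coeff (pCons 0 (pcompose q [:a, 1:])) i"
      by simp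
    have 1: "coeff (pcompose q [:a, 1:]) i = coeff q i"
      using pCons.IH[OF m(2), of i] pCons.prems(2) m by (simp add: coeff_eq_0)
    show ?thesis
    proof (cases i)
      case 0
      then show ?thesis using * 1 by simp
    next
      case (Suc i')
      have "coeff (pcompose q [:a, 1:]) i' = coeff q i' + a * of_nat (Suc i') * coeff q (Suc i')"
        using pCons.IH[OF m(2), of i'] pCons.prems(2) m Suc by simp
      then show ?thesis unfolding * 1 using Suc by (simp add: algebra_simps)
    qed
  qed simp
qed simp

text \<open>
The two products have the same leading term. In the next coefficient the shift of \<open>ffact 4\<close> contributes \<open>4 d\<close>
and the shift of \<open>q\<close> contributes \<open>4 m\<close>.
\<close>

lemma coeff_euler_recurrence:
  fixes q :: "complex poly"
  assumes "degree q \<le> m"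
  shows "coeff (pcompose (ffact 4) [:d, 1:] * q - ffact 4 * pcompose q [:-4, 1:]) (m + 3) =
    4 * (d + of_nat m) * coeff q m"
proof -
  define A where "A = pcompose (ffact 4) [:d, 1:]"
  have ff: "ffact 4 = [:0, -6, 11, -6, 1:]"
    by (simp add: eval_nat_numeral)
  have "A = [:d * (d - 1) * (d - 2) * (d - 3), 4 * d ^ 3 - 18 * d\<^sup>2 + 22 * d - 6,
      6 * d\<^sup>2 - 18 * d + 11, 4 * d - 6, 1:]"
    unfolding A_def ff
    by (simp add: pcompose_pCons algebra_simps power2_eq_square power3_eq_cube)
  then obtain a0 a1 a2 where A: "A = [:a0, a1, a2, 4 * d - 6, 1:]" by blast
  define r where "r = pcompose q [:-4, 1:]"
  have q0: "coeff q i = 0" if "i > m" for i using that assms by (simp add: coeff_eq_0)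
  have r0: "coeff r i = 0" if "i > m" for i
    using that assms by (simp add: r_def coeff_eq_0 degree_pcompose)
  have rm: "coeff r m = coeff q m"
    using coeff_shift_second_order[OF assms, of m] q0 by (simp add: r_def)
  have three: "m + 3 = Suc (Suc (Suc m))" by simp
  have "coeff (A * q) (m + 3) = (4 * d - 6) * coeff q m + (case m of 0 \<Rightarrow> 0 | Suc i \<Rightarrow> coeff q i)"
    unfolding A three by (cases m) (simp_all add: q0)
  moreover have "coeff (ffact 4 * r) (m + 3) = -6 * coeff r m + (case m of 0 \<Rightarrow> 0 | Suc i \<Rightarrow> coeff r i)"
    unfolding ff three by (cases m) (simp_all add: r0)
  moreover have "(case m of 0 \<Rightarrow> 0 | Suc i \<Rightarrow> coeff r i) =
      (case m of 0 \<Rightarrow> 0 | Suc i \<Rightarrow> coeff q i) - 4 * of_nat m * coeff q m"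
    using coeff_shift_second_order[OF assms, of "m - 1" "-4"] by (cases m) (simp_all add: r_def algebra_simps)
  ultimately have "coeff (A * q) (m + 3) - coeff (ffact 4 * r) (m + 3) = 4 * (d + of_nat m) * coeff q m"
    unfolding rm by algebra
  then show ?thesis
    by (simp add: A_def r_def)
qed

section \<open>Difference equations for the symbol\<close>

text \<open>
The operator \<open>D\<^sup>4 + c\<^sub>n / x\<^sup>4\<close>, the most singular part of \<open>L\<close>, sends \<open>x\<^sup>s\<close> to this multiple of \<open>x\<^sup>s\<^sup>-\<^sup>4\<close>.
\<close>

definition euler_symbol :: "nat \<Rightarrow> complex \<Rightarrow> complex" where
  "euler_symbol n s = poly (ffact 4) s + of_nat (lame_const n)"

text \<open>
The imaginary part \<open>\<beta>\<close> of the roots \<open>3/2 \<plusminus> (2n+1) \<plusminus> i \<beta>\<close> of \<open>euler_symbol\<close>; \<open>top_root\<close> is the one with both signs positive.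
\<close>

definition root_imag :: "nat \<Rightarrow> real" where
  "root_imag n = sqrt (4 * (2 * real n + 1)\<^sup>2 - 5) / 2"

lemma root_imag: "n \<ge> 1 \<Longrightarrow> root_imag n > 0" "n \<ge> 1 \<Longrightarrow> 4 * (root_imag n)\<^sup>2 = 4 * (2 * real n + 1)\<^sup>2 - 5"
proof -
  assume "n \<ge> 1"
  then have "(2 * real n + 1)\<^sup>2 \<ge> 3\<^sup>2" by (intro power_mono) auto
  then show "root_imag n > 0" "4 * (root_imag n)\<^sup>2 = 4 * (2 * real n + 1)\<^sup>2 - 5"
    by (simp_all add: root_imag_def power_divide)
qed

definition top_root :: "nat \<Rightarrow> complex" where
  "top_root n = Complex (2 * real n + 5 / 2) (root_imag n)"

text \<open>
With \<open>s = 3/2 + \<tau>\<close> both sides are \<open>\<tau>\<^sup>4 - 5/2 \<tau>\<^sup>2 + (2 (2n+1)\<^sup>2 - 5/4)\<^sup>2\<close>, because \<open>(2n+1)\<^sup>2 - \<beta>\<^sup>2 = 5/4\<close>.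
\<close>

lemma euler_symbol_line:
  assumes "n \<ge> 1"
  shows "euler_symbol n (top_root n + r) =
    r * (r + (4 * of_nat n + 2)) * (r + 2 * \<i> * of_real (root_imag n)) * (r + (4 * of_nat n + 2) + 2 * \<i> * of_real (root_imag n))"
proof -
  define x :: complex where "x = of_nat n"
  define b where "b = \<i> * of_real (root_imag n)"
  have "4 * b\<^sup>2 = - of_real (4 * (root_imag n)\<^sup>2)"
    by (simp add: b_def power_mult_distrib)
  also have "\<dots> = 5 - 4 * (2 * x + 1)\<^sup>2"
    unfolding root_imag(2)[OF assms] x_def by simp
  finally have b: "4 * b\<^sup>2 = 5 - 4 * (2 * x + 1)\<^sup>2" .
  have t: "top_root n = 2 * x + 5 / 2 + b"
    by (simp add: top_root_def x_def b_def complex_eq_iff)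
  define \<tau> where "\<tau> = 2 * x + 1 + b + r"
  have "r * (r + (4 * x + 2)) * (r + 2 * b) * (r + (4 * x + 2) + 2 * b) =
      \<tau> ^ 4 - 2 * \<tau>\<^sup>2 * (b\<^sup>2 + (2 * x + 1)\<^sup>2) + (2 * (2 * x + 1)\<^sup>2 - (b\<^sup>2 + (2 * x + 1)\<^sup>2))\<^sup>2"
    unfolding \<tau>_def by algebra
  also have "b\<^sup>2 + (2 * x + 1)\<^sup>2 = 5 / 4"
    using b by (simp add: field_simps)
  also have "\<tau> ^ 4 - 2 * \<tau>\<^sup>2 * (5 / 4) + (2 * (2 * x + 1)\<^sup>2 - 5 / 4)\<^sup>2 =
      (\<tau> + 3 / 2) * (\<tau> + 1 / 2) * (\<tau> - 1 / 2) * (\<tau> - 3 / 2) + x * (4 * x + 1) * (4 * x + 3) * (4 * x + 4)"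
    by (simp add: field_simps power2_eq_square power4_eq_xxxx)
  also have "\<dots> = euler_symbol n (top_root n + r)"
  proof -
    have "poly (ffact 4) s = s * (s - 1) * (s - 2) * (s - 3)" for s
      by (simp add: eval_nat_numeral algebra_simps)
    moreover have "top_root n + r = \<tau> + 3 / 2" by (simp add: t \<tau>_def)
    ultimately show ?thesis
      by (simp add: euler_symbol_def lame_const_def x_def) (simp add: algebra_simps)
  qed
  finally show ?thesis by (simp add: x_def b_def mult.assoc)
qed

lemma euler_symbol_real_line:
  assumes "n \<ge> 1"
  shows "euler_symbol n (top_root n + of_int r) = 0 \<longleftrightarrow> r = 0 \<or> r = - (4 * int n + 2)"
proof -
  have nz: "of_int k + 2 * \<i> * of_real (root_imag n) \<noteq> 0" for k
    using root_imag(1)[OF assms] by (simp add: complex_eq_iff)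
  have "of_int r + (4 * of_nat n + 2 :: complex) = of_int (r + (4 * int n + 2))" by simp
  then show ?thesis
    unfolding euler_symbol_line[OF assms] using nz[of r] nz[of "r + (4 * int n + 2)"]
    by (simp only: mult_eq_0_iff of_int_eq_0_iff) auto
qed

lemma poly_not_zero_along_chain:
  fixes q :: "complex poly"
  assumes "q \<noteq> 0"
  obtains k :: nat where "poly q (s + of_nat (4 * k)) \<noteq> 0"
proof -
  have "inj (\<lambda>k::nat. s + of_nat (4 * k) :: complex)"
    by (rule injI) (simp del: of_nat_mult)
  then have "infinite (range (\<lambda>k::nat. s + of_nat (4 * k) :: complex))"
    using finite_imageD infinite_UNIV_nat by blast
  then have "\<not> range (\<lambda>k::nat. s + of_nat (4 * k)) \<subseteq> {x. poly q x = 0}"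
    using poly_roots_finite[OF assms] finite_subset by blast
  then show ?thesis using that by blast
qed

text \<open>
A zero of \<open>q\<close> at \<open>s\<close> makes the right-hand side vanish at \<open>s + 4\<close>, so it moves on to \<open>s + 4\<close> unless the left
factor has a zero there.
\<close>

lemma zeros_propagate:
  fixes q :: "complex poly"
  assumes eq: "\<And>s. euler_symbol n (s - of_int m) * poly q s = euler_symbol n s * poly q (s - 4)"
    and start: "poly q s = 0"
    and nz: "\<And>j. 0 < j \<Longrightarrow> j \<le> k \<Longrightarrow> euler_symbol n (s + of_nat (4 * j) - of_int m) \<noteq> 0"
  shows "poly q (s + of_nat (4 * k)) = 0"
  using nz
proof (induction k)
  case (Suc k)
  then have "poly q (s + of_nat (4 * k)) = 0" by simp
  moreover have "s + of_nat (4 * Suc k) - 4 = s + of_nat (4 * k)" by simp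
  ultimately have "euler_symbol n (s + of_nat (4 * Suc k) - of_int m) * poly q (s + of_nat (4 * Suc k)) = 0"
    using eq[of "s + of_nat (4 * Suc k)"] by (simp del: of_nat_mult)
  then show ?case using Suc.prems[of "Suc k"] by (simp del: of_nat_mult)
qed (use start in simp)

text \<open>
The equation forces a zero of \<open>q\<close> at \<open>top_root n\<close> or a zero of the left factor there. As \<open>q\<close> has finitely many zeros,
the chain starting at \<open>top_root n\<close> must meet a zero of the left factor, and the only candidates give the two
families of orders.
\<close>

lemma homogeneous_orders:
  assumes n: "n \<ge> 1" and q: "q \<noteq> 0"
    and eq: "\<And>s. euler_symbol n (s - of_int m) * poly q s = euler_symbol n s * poly q (s - 4)"
  shows "\<exists>j::nat. m = 4 * int j \<or> m = 4 * int j + 4 * int n + 2"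
proof (rule ccontr)
  assume no: "\<not> ?thesis"
  have nz: "euler_symbol n (top_root n + of_nat (4 * j) - of_int m) \<noteq> 0" for j :: nat
  proof
    assume 0: "euler_symbol n (top_root n + of_nat (4 * j) - of_int m) = 0"
    have "top_root n + of_nat (4 * j) - of_int m = top_root n + of_int (4 * int j - m)" by simp
    with 0 have "4 * int j - m = 0 \<or> 4 * int j - m = - (4 * int n + 2)"
      by (metis euler_symbol_real_line[OF n])
    then have "m = 4 * int j \<or> m = 4 * int j + 4 * int n + 2" by linarith
    with no show False by blast
  qed
  have "euler_symbol n (top_root n) = 0"
    using euler_symbol_real_line[OF n, of 0] by simp
  then have "poly q (top_root n) = 0"
    using eq[of "top_root n"] nz[of 0] by simp
  then have "poly q (top_root n + of_nat (4 * k)) = 0" for k :: nat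
    by (intro zeros_propagate[OF eq]) (use nz in auto)
  then show False using poly_not_zero_along_chain[OF q, of "top_root n"] by metis
qed


lemma polar_right_half_plane:
  assumes "x > 0"
  obtains a where "a > 0" "Complex x y = of_real a * cis (arctan (y / x))"
proof
  define u where "u = y / x"
  have p: "sqrt (1 + u\<^sup>2) > 0" by (simp add: add_pos_nonneg)
  show "x * sqrt (1 + u\<^sup>2) > 0" using assms p by simp
  show "Complex x y = of_real (x * sqrt (1 + u\<^sup>2)) * cis (arctan (y / x))"
    unfolding u_def[symmetric] using p assms
    by (simp add: complex_eq_iff cos_arctan sin_arctan) (simp add: u_def)
qed

text \<open>
Up to sign, the argument of \<open>euler_symbol\<close> on the horizontal line through \<open>top_root\<close>, at horizontal distance \<open>\<tau>\<close> from
the line \<open>Re s = 3/2\<close> (see \<open>euler_symbol_polar\<close>).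
\<close>

definition phase :: "nat \<Rightarrow> real \<Rightarrow> real" where
  "phase n \<tau> = arctan (4 * \<tau> * root_imag n / (5 * (2 * real n + 1)\<^sup>2 - 5 - \<tau>\<^sup>2))"

lemma phase_denominator:
  assumes "n \<ge> 1" "\<bar>\<tau>\<bar> \<le> 2 * real n"
  shows "5 * (2 * real n + 1)\<^sup>2 - 5 - \<tau>\<^sup>2 > 4 * (2 * real n + 1) * (2 * real n)"
proof -
  have "\<tau>\<^sup>2 \<le> (2 * real n)\<^sup>2" using power_mono[OF assms(2), of 2] by simp
  moreover have "real n \<ge> 1" using assms(1) by simp
  ultimately show ?thesis by (simp add: power2_eq_square algebra_simps)
qed

lemma root_imag_less: "n \<ge> 1 \<Longrightarrow> root_imag n < 2 * real n + 1"
proof -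
  assume n: "n \<ge> 1"
  then have "(root_imag n)\<^sup>2 < (2 * real n + 1)\<^sup>2" using root_imag(2)[OF n] by simp
  then show ?thesis by (rule power2_less_imp_less) simp
qed

lemma phase_bounds:
  assumes "n \<ge> 1" "\<bar>\<tau>\<bar> \<le> 2 * real n"
  shows "- (pi / 4) < phase n \<tau>" "phase n \<tau> < pi / 4"
proof -
  define A where "A = 5 * (2 * real n + 1)\<^sup>2 - 5 - \<tau>\<^sup>2"
  have A: "A > 4 * (2 * real n + 1) * (2 * real n)"
    unfolding A_def by (rule phase_denominator[OF assms])
  then have A0: "A > 0" by (rule le_less_trans[rotated]) simp
  have "\<bar>\<tau>\<bar> * root_imag n \<le> (2 * real n) * (2 * real n + 1)"
    using assms root_imag(1)[OF assms(1)] root_imag_less[OF assms(1)] by (intro mult_mono) auto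
  then have "\<bar>4 * \<tau> * root_imag n\<bar> < A"
    using A root_imag(1)[OF assms(1)] by (simp add: abs_mult algebra_simps)
  then have "\<bar>4 * \<tau> * root_imag n / A\<bar> < 1" using A0 by simp
  then have "- 1 < 4 * \<tau> * root_imag n / A" "4 * \<tau> * root_imag n / A < 1" by linarith+
  then have "arctan (- 1) < phase n \<tau>" "phase n \<tau> < arctan 1"
    unfolding phase_def A_def by (simp_all only: arctan_less_iff)
  then show "- (pi / 4) < phase n \<tau>" "phase n \<tau> < pi / 4"
    by (simp_all add: arctan_minus arctan_one)
qed

lemma phase_mono:
  assumes n: "n \<ge> 1" and "\<sigma> \<le> \<tau>" "\<bar>\<sigma>\<bar> \<le> 2 * real n" "\<bar>\<tau>\<bar> \<le> 2 * real n"
  shows "phase n \<sigma> \<le> phase n \<tau>"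
proof -
  define A where "A = 5 * (2 * real n + 1)\<^sup>2 - 5"
  have pos: "A - \<sigma>\<^sup>2 > 0" "A - \<tau>\<^sup>2 > 0"
    unfolding A_def by (rule phase_denominator[OF n assms(3), THEN le_less_trans[rotated]],
      simp, rule phase_denominator[OF n assms(4), THEN le_less_trans[rotated]], simp)
  have "\<bar>\<sigma> * \<tau>\<bar> \<le> (2 * real n) * (2 * real n)"
    unfolding abs_mult using assms by (intro mult_mono) auto
  moreover have "A \<ge> (2 * real n) * (2 * real n)"
    by (simp add: A_def power2_eq_square algebra_simps)
  ultimately have "A + \<sigma> * \<tau> \<ge> 0" by linarith
  then have "(\<tau> - \<sigma>) * (A + \<sigma> * \<tau>) \<ge> 0" using assms(2) by simp
  then have "\<sigma> * (A - \<tau>\<^sup>2) \<le> \<tau> * (A - \<sigma>\<^sup>2)"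
    by (simp add: power2_eq_square algebra_simps)
  then have "4 * root_imag n * (\<sigma> * (A - \<tau>\<^sup>2)) \<le> 4 * root_imag n * (\<tau> * (A - \<sigma>\<^sup>2))"
    using root_imag(1)[OF n] by simp
  then have "4 * \<sigma> * root_imag n / (A - \<sigma>\<^sup>2) \<le> 4 * \<tau> * root_imag n / (A - \<tau>\<^sup>2)"
    using pos by (simp add: divide_simps mult_ac)
  then show ?thesis
    by (simp add: phase_def A_def[symmetric] arctan_le_iff)
qed

lemma euler_symbol_polar:
  assumes n: "n \<ge> 1" and \<tau>: "\<bar>\<tau>\<bar> \<le> 2 * real n"
  obtains a where "a > 0"
    "euler_symbol n (top_root n + of_real (\<tau> - (2 * real n + 1))) = of_real a * cis (- phase n \<tau>)"
proof -
  define M where "M = 2 * real n + 1"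
  define b where "b = root_imag n"
  have b: "4 * b\<^sup>2 = 4 * M\<^sup>2 - 5" using root_imag(2)[OF n] by (simp add: b_def M_def)
  have "euler_symbol n (top_root n + of_real (\<tau> - M)) =
     of_real (\<tau> - M) * of_real (\<tau> + M) * (of_real (\<tau> - M) + 2 * \<i> * of_real b) * (of_real (\<tau> + M) + 2 * \<i> * of_real b)"
  proof -
    have "of_real (\<tau> - M) + (4 * of_nat n + 2) = (of_real (\<tau> + M) :: complex)"
      by (simp add: M_def)
    then show ?thesis
      unfolding euler_symbol_line[OF n] b_def[symmetric] by (simp only:)
  qed
  also have "\<dots> = of_real (M\<^sup>2 - \<tau>\<^sup>2) * Complex (4 * b\<^sup>2 + M\<^sup>2 - \<tau>\<^sup>2) (- 4 * \<tau> * b)"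
    by (simp add: complex_eq_iff power2_eq_square algebra_simps)
  also have "4 * b\<^sup>2 + M\<^sup>2 - \<tau>\<^sup>2 = 5 * M\<^sup>2 - 5 - \<tau>\<^sup>2" using b by simp
  finally have eq: "euler_symbol n (top_root n + of_real (\<tau> - M)) =
     of_real (M\<^sup>2 - \<tau>\<^sup>2) * Complex (5 * M\<^sup>2 - 5 - \<tau>\<^sup>2) (- 4 * \<tau> * b)" .
  have "5 * M\<^sup>2 - 5 - \<tau>\<^sup>2 > 0"
    unfolding M_def by (rule phase_denominator[OF n \<tau>, THEN le_less_trans[rotated]]) simp
  then obtain a where a: "a > 0" "Complex (5 * M\<^sup>2 - 5 - \<tau>\<^sup>2) (- 4 * \<tau> * b) =
      of_real a * cis (arctan (- 4 * \<tau> * b / (5 * M\<^sup>2 - 5 - \<tau>\<^sup>2)))"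
    by (rule polar_right_half_plane)
  have "arctan (- 4 * \<tau> * b / (5 * M\<^sup>2 - 5 - \<tau>\<^sup>2)) = - phase n \<tau>"
    by (simp add: phase_def M_def b_def flip: arctan_minus)
  moreover have "M\<^sup>2 - \<tau>\<^sup>2 > 0"
  proof -
    have "\<bar>\<tau>\<bar> < \<bar>M\<bar>" using \<tau> by (simp add: M_def)
    then have "\<bar>\<tau>\<bar>\<^sup>2 < \<bar>M\<bar>\<^sup>2" by (intro power_strict_mono) auto
    then show ?thesis by simp
  qed
  ultimately show ?thesis
    using that[of "(M\<^sup>2 - \<tau>\<^sup>2) * a"] eq a by (simp add: M_def mult.assoc)
qed

text \<open>
Each step multiplies \<open>w\<close> by a quotient of values of \<open>euler_symbol\<close> at two points at distance two and so turns it
by a small clockwise angle. The intervals between these pairs of points are disjoint and \<open>phase\<close> is increasing, so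
the total angle stays below the full variation of \<open>phase\<close>, which is less than a right angle.
\<close>

lemma obstruction_product:
  fixes w :: "nat \<Rightarrow> complex" and n :: nat
  defines "p \<equiv> \<lambda>r::int. euler_symbol n (top_root n + of_int r)"
  assumes n: "n \<ge> 1" and w0: "w 0 = 1"
    and w: "\<And>j. Suc j < n \<Longrightarrow> w (Suc j) * p (4 * int (Suc j) - 4 * int n - 2) = w j * p (4 * int (Suc j) - 4 * int n)"
    and j: "j < n"
  shows "Re (w j) > 0"
proof -
  \<comment> \<open>Since \<open>phase\<close> is at least \<open>- pi / 4\<close>, the bound dominates its variation up to the right end \<open>\<tau> j\<close>.\<close>
  define \<tau> where "\<tau> j = 4 * real j + 1 - 2 * real n" for j
  have "\<exists>a \<phi>. a > 0 \<and> w j = of_real a * cis (- \<phi>) \<and> 0 \<le> \<phi> \<and> \<phi> \<le> pi / 4 + phase n (\<tau> j)"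
    using j
  proof (induction j)
    case 0
    have "\<bar>\<tau> 0\<bar> \<le> 2 * real n" using n by (simp add: \<tau>_def)
    from phase_bounds(1)[OF n this] have "0 \<le> pi / 4 + phase n (\<tau> 0)" by linarith
    then show ?case using w0
      by (intro exI[of _ "1 :: real"] exI[of _ "0 :: real"])
        simp
  next
    case (Suc j)
    then obtain a \<phi> where a: "a > 0" "w j = of_real a * cis (- \<phi>)" "0 \<le> \<phi>" "\<phi> \<le> pi / 4 + phase n (\<tau> j)"
      by auto
    have "real (Suc j) + 1 \<le> real n" using Suc.prems by linarith
    then have t: "\<bar>\<tau> (Suc j)\<bar> \<le> 2 * real n" "\<bar>\<tau> j + 2\<bar> \<le> 2 * real n" "\<bar>\<tau> j\<bar> \<le> 2 * real n"
      by (auto simp: \<tau>_def)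
    obtain a1 where a1: "a1 > 0" "p (4 * int (Suc j) - 4 * int n) = of_real a1 * cis (- phase n (\<tau> (Suc j)))"
    proof (rule euler_symbol_polar[OF n t(1)])
      fix a assume a: "a > 0" and e: "euler_symbol n (top_root n + of_real (\<tau> (Suc j) - (2 * real n + 1))) =
         of_real a * cis (- phase n (\<tau> (Suc j)))"
      have eq: "of_real (\<tau> (Suc j) - (2 * real n + 1)) = (of_int (4 * int (Suc j) - 4 * int n) :: complex)"
        by (simp add: \<tau>_def)
      show thesis by (rule that[OF a]) (use e in \<open>simp only: p_def eq\<close>)
    qed
    obtain a2 where a2: "a2 > 0" "p (4 * int (Suc j) - 4 * int n - 2) = of_real a2 * cis (- phase n (\<tau> j + 2))"
    proof (rule euler_symbol_polar[OF n t(2)])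
      fix a assume a: "a > 0" and e: "euler_symbol n (top_root n + of_real (\<tau> j + 2 - (2 * real n + 1))) =
         of_real a * cis (- phase n (\<tau> j + 2))"
      have eq: "of_real (\<tau> j + 2 - (2 * real n + 1)) = (of_int (4 * int (Suc j) - 4 * int n - 2) :: complex)"
        by (simp add: \<tau>_def)
      show thesis by (rule that[OF a]) (use e in \<open>simp only: p_def eq\<close>)
    qed
    define \<psi> where "\<psi> = \<phi> + phase n (\<tau> (Suc j)) - phase n (\<tau> j + 2)"
    have "w (Suc j) * (of_real a2 * cis (- phase n (\<tau> j + 2))) =
       of_real a * cis (- \<phi>) * (of_real a1 * cis (- phase n (\<tau> (Suc j))))"
      using w[OF Suc.prems] a a1 a2 by simp
    then have "w (Suc j) * of_real a2 * (cis (- phase n (\<tau> j + 2)) * cis (phase n (\<tau> j + 2))) =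
       of_real (a * a1) * (cis (- \<phi>) * cis (- phase n (\<tau> (Suc j))) * cis (phase n (\<tau> j + 2)))"
      by (simp add: mult_ac)
    then have "w (Suc j) * of_real a2 = of_real (a * a1) * cis (- \<psi>)"
      by (simp add: cis_mult \<psi>_def algebra_simps)
    then have "w (Suc j) = of_real (a * a1 / a2) * cis (- \<psi>)"
      using a2(1) by (simp add: field_simps)
    moreover have "a * a1 / a2 > 0" using a a1 a2 by simp
    moreover have "phase n (\<tau> j + 2) \<le> phase n (\<tau> (Suc j))"
      by (rule phase_mono[OF n _ t(2) t(1)]) (simp add: \<tau>_def)
    moreover have "phase n (\<tau> j) \<le> phase n (\<tau> j + 2)"
      by (rule phase_mono[OF n _ t(3) t(2)]) simp
    ultimately show ?case
      using a(3,4) by (intro exI[of _ "a * a1 / a2"] exI[of _ \<psi>]) (auto simp: \<psi>_def)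
  qed
  then obtain a \<phi> where a: "a > 0" "w j = of_real a * cis (- \<phi>)" "0 \<le> \<phi>" "\<phi> \<le> pi / 4 + phase n (\<tau> j)"
    by blast
  have "real j + 1 \<le> real n" using j by linarith
  then have "\<bar>\<tau> j\<bar> \<le> 2 * real n" by (auto simp: \<tau>_def)
  then have "\<phi> < pi / 2" using a(4) phase_bounds(2)[OF n, of "\<tau> j"] by linarith
  then have "cos \<phi> > 0" using a(3) by (intro cos_gt_zero_pi) auto
  then show ?thesis using a by simp
qed

text \<open>
On the chain \<open>s\<^sub>j = top_root n + 4 j\<close> with \<open>j < n\<close> the unknown values of \<open>r\<close> form a two-term recursion whose end
coefficients vanish. Hence the weighted sum of the right-hand sides is zero. There \<open>q(s\<^sub>j + 2) = 0\<close>,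
so the sum is \<open>- \<kappa> q(s\<^sub>0)\<close> times a sum of numbers to which \<open>obstruction_product\<close> applies.
\<close>

lemma weight_six_obstruction:
  fixes q r :: "complex poly"
  assumes n: "n \<ge> 1" and q: "q \<noteq> 0"
    and eq: "\<And>s. euler_symbol n (s - of_int (4 * int n + 2)) * poly q s = euler_symbol n s * poly q (s - 4)"
    and eq6: "\<And>s. euler_symbol n (s - of_int (4 * int n - 4)) * poly r s - euler_symbol n s * poly r (s - 4) =
        \<kappa> * (poly q (s + 2) - poly q s)"
  shows "\<kappa> = 0"
proof -
  define p where "p r = euler_symbol n (top_root n + of_int r)" for r :: int
  define s where "s j = top_root n + of_nat (4 * j)" for j :: nat
  have p0: "p r = 0 \<longleftrightarrow> r = 0 \<or> r = - (4 * int n + 2)" for r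
    unfolding p_def by (rule euler_symbol_real_line[OF n])
  have ps: "euler_symbol n (s j - of_int i) = p (4 * int j - i)" for j i
    by (simp add: p_def s_def algebra_simps)
  have s_step: "s (Suc j) - 4 = s j" for j by (simp add: s_def)
  \<comment> \<open>A zero here would propagate upwards without end.\<close>
  have q0: "poly q (s 0) \<noteq> 0"
  proof
    assume "poly q (s 0) = 0"
    have "poly q (s 0 + of_nat (4 * k)) = 0" for k :: nat
    proof (rule zeros_propagate[OF eq \<open>poly q (s 0) = 0\<close>])
      fix j :: nat assume "0 < j"
      have "s 0 + of_nat (4 * j) = s j" by (simp add: s_def)
      then show "euler_symbol n (s 0 + of_nat (4 * j) - of_int (4 * int n + 2)) \<noteq> 0"
        using \<open>0 < j\<close> unfolding ps by (simp only: ps p0) presburger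
    qed
    then show False using poly_not_zero_along_chain[OF q, of "s 0"] by metis
  qed
  \<comment> \<open>The chain from the lower root on the same line passes through these points before it can stop.\<close>
  have qs: "poly q (s j + 2) = 0" if j: "j < n" for j
  proof -
    define s' where "s' = top_root n + of_int (- (4 * int n + 2))"
    have "euler_symbol n (s' - of_int (4 * int n + 2)) = p (- (8 * int n + 4))"
      by (simp add: p_def s'_def algebra_simps)
    moreover have "p (- (8 * int n + 4)) \<noteq> 0" unfolding p0 by presburger
    moreover have "euler_symbol n s' = 0"
      using p0[of "- (4 * int n + 2)"] by (simp add: p_def s'_def)
    ultimately have start: "poly q s' = 0" using eq[of s'] by simp
    have "poly q (s' + of_nat (4 * (n + 1 + j))) = 0"
    proof (rule zeros_propagate[OF eq start])
      fix i :: nat assume i: "0 < i" "i \<le> n + 1 + j"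
      have "euler_symbol n (s' + of_nat (4 * i) - of_int (4 * int n + 2)) = p (4 * int i - 8 * int n - 4)"
        by (simp add: p_def s'_def algebra_simps)
      moreover have "p (4 * int i - 8 * int n - 4) \<noteq> 0"
        unfolding p0 using i j by presburger
      ultimately show "euler_symbol n (s' + of_nat (4 * i) - of_int (4 * int n + 2)) \<noteq> 0" by simp
    qed
    moreover have "s' + of_nat (4 * (n + 1 + j)) = s j + 2" by (simp add: s'_def s_def algebra_simps)
    ultimately show ?thesis by (simp only:)
  qed
  have qrec: "p (4 * int (Suc j) - 4 * int n - 2) * poly q (s (Suc j)) = p (4 * int (Suc j)) * poly q (s j)" for j
    using eq[of "s (Suc j)"] ps[of "Suc j" 0] ps[of "Suc j" "4 * int n + 2"]
    by (simp add: s_step algebra_simps)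
  \<comment> \<open>The integrating factor, chosen such that the terms with \<open>r\<close> telescope.\<close>
  define h where "h = rec_nat (1::complex) (\<lambda>j x. x * p (4 * int (Suc j) - 4 * int n) / p (4 * int (Suc j)))"
  have h0: "h 0 = 1" by (simp add: h_def)
  have hrec: "h (Suc j) * p (4 * int (Suc j)) = h j * p (4 * int (Suc j) - 4 * int n)" for j
  proof -
    have "p (4 * int (Suc j)) \<noteq> 0" unfolding p0 by presburger
    moreover have "h (Suc j) = h j * p (4 * int (Suc j) - 4 * int n) / p (4 * int (Suc j))"
      by (simp add: h_def)
    ultimately show ?thesis by simp
  qed
  define w where "w j = h j * poly q (s j) / poly q (s 0)" for j
  have Re_w: "Re (w j) > 0" if "j < n" for j
  proof (rule obstruction_product[OF n _ _ that])
    show "w 0 = 1" using q0 by (simp add: w_def h0)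
    fix j
    have "h (Suc j) * poly q (s (Suc j)) * p (4 * int (Suc j) - 4 * int n - 2) =
        h (Suc j) * p (4 * int (Suc j)) * poly q (s j)"
      using qrec[of j] by (simp add: mult_ac)
    also have "\<dots> = h j * poly q (s j) * p (4 * int (Suc j) - 4 * int n)"
      unfolding hrec by (simp add: mult_ac)
    finally show "w (Suc j) * euler_symbol n (top_root n + of_int (4 * int (Suc j) - 4 * int n - 2)) =
        w j * euler_symbol n (top_root n + of_int (4 * int (Suc j) - 4 * int n))"
      unfolding p_def[symmetric] w_def by (simp add: field_simps)
  qed
  have tele: "- \<kappa> * (\<Sum>i\<le>j. h i * poly q (s i)) = h j * p (4 * int j - (4 * int n - 4)) * poly r (s j)"
    if "j < n" for j
    using that
  proof (induction j)
    case 0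
    have "p (- (4 * int n - 4)) * poly r (s 0) - p 0 * poly r (s 0 - 4) = \<kappa> * (0 - poly q (s 0))"
      using eq6[of "s 0"] ps[of 0 "4 * int n - 4"] ps[of 0 0] qs[of 0] 0 by simp
    moreover have "p 0 = 0" by (simp add: p0)
    ultimately show ?case by (simp add: h0)
  next
    case (Suc j)
    have "p (4 * int (Suc j) - (4 * int n - 4)) * poly r (s (Suc j)) - p (4 * int (Suc j)) * poly r (s j)
        = \<kappa> * (0 - poly q (s (Suc j)))"
      using eq6[of "s (Suc j)"] ps[of "Suc j" "4 * int n - 4"] ps[of "Suc j" 0] qs[of "Suc j"] Suc.prems
      by (simp add: s_step)
    then have "h (Suc j) * p (4 * int (Suc j) - (4 * int n - 4)) * poly r (s (Suc j)) =
       (h (Suc j) * p (4 * int (Suc j))) * poly r (s j) - \<kappa> * h (Suc j) * poly q (s (Suc j))"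
      by (simp add: algebra_simps) algebra
    also have "(h (Suc j) * p (4 * int (Suc j))) * poly r (s j) =
        h j * p (4 * int j - (4 * int n - 4)) * poly r (s j)"
      unfolding hrec by (simp add: algebra_simps)
    finally show ?case using Suc by (simp add: algebra_simps)
  qed
  have "- \<kappa> * (\<Sum>i\<le>n - 1. h i * poly q (s i)) = 0"
    using tele[of "n - 1"] n p0[of 0] by (simp add: of_nat_diff)
  moreover have "(\<Sum>i\<le>n - 1. h i * poly q (s i)) = poly q (s 0) * (\<Sum>i\<le>n - 1. w i)"
    unfolding sum_distrib_left by (intro sum.cong) (use q0 in \<open>auto simp: w_def\<close>)
  moreover have "(\<Sum>i\<le>n - 1. w i) \<noteq> 0"
  proof -
    have "Re (\<Sum>i\<le>n - 1. w i) > 0"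
      unfolding Re_sum by (intro sum_pos) (use Re_w n in auto)
    then show ?thesis by (metis less_irrefl zero_complex.sel(1))
  qed
  ultimately show ?thesis using q0 by simp
qed

section \<open>Orders of commuting operators\<close>

text \<open>
The ring \<open>K\<close> of coefficients is a parameter: all Laurent series serve for the algebra, germs of globally meromorphic
functions for the construction of an operator on the plane. \<open>A\<close> is the leading coefficient, which may be zero.
\<close>

definition diff_operator ::
  "complex fls set \<Rightarrow> nat \<Rightarrow> complex fls \<Rightarrow> (complex fls \<Rightarrow> complex fls) \<Rightarrow> bool" where
  "diff_operator K m A T \<longleftrightarrow> (\<exists>a. (\<forall>i\<le>m. a i \<in> K) \<and> a m = A \<and>
     T = (\<lambda>F. \<Sum>i\<le>m. a i * (fls_deriv ^^ i) F))"

locale differential_subring =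
  fixes K :: "complex fls set"
  assumes const_mem [simp, intro]: "fls_const c \<in> K"
    and add_mem [intro]: "a \<in> K \<Longrightarrow> b \<in> K \<Longrightarrow> a + b \<in> K"
    and mult_mem [intro]: "a \<in> K \<Longrightarrow> b \<in> K \<Longrightarrow> a * b \<in> K"
    and deriv_mem [intro]: "a \<in> K \<Longrightarrow> fls_deriv a \<in> K"
begin

lemma zero_mem [simp, intro]: "0 \<in> K" and one_mem [simp, intro]: "1 \<in> K"
  and numeral_mem [simp, intro]: "numeral k \<in> K"
  using const_mem[of 0] const_mem[of 1] const_mem[of "numeral k"]
  by (simp_all add: fls_const_numeral)

lemma uminus_mem [intro]:
  assumes "a \<in> K"
  shows "- a \<in> K"
proof -
  have "fls_const (-1) * a = - a" by (simp add: fls_const_uminus)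
  then show ?thesis using mult_mem[OF const_mem assms, of "-1"] by simp
qed

lemma power_mem [intro]: "a \<in> K \<Longrightarrow> a ^ k \<in> K"
  by (induction k) auto

lemma sum_mem [intro]: "(\<And>i. i \<in> I \<Longrightarrow> f i \<in> K) \<Longrightarrow> sum f I \<in> K"
  by (induction I rule: infinite_finite_induct) auto

lemma diff_operator_id: "diff_operator K 0 1 (\<lambda>F. F)"
  unfolding diff_operator_def by (rule exI[of _ "\<lambda>_. 1"]) auto

lemma diff_operator_pad:
  assumes "diff_operator K m A T" "m < m'"
  shows "diff_operator K m' 0 T"
proof -
  obtain a where a: "\<forall>i\<le>m. a i \<in> K" "T = (\<lambda>F. \<Sum>i\<le>m. a i * (fls_deriv ^^ i) F)"
    using assms(1) unfolding diff_operator_def by blast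
  define b where "b i = (if i \<le> m then a i else 0)" for i
  have "(\<Sum>i\<le>m. a i * (fls_deriv ^^ i) F) = (\<Sum>i\<le>m'. b i * (fls_deriv ^^ i) F)" for F
    by (rule sum.mono_neutral_cong_left) (use assms(2) in \<open>auto simp: b_def\<close>)
  then show ?thesis
    unfolding diff_operator_def using a assms(2)
    by (intro exI[of _ b]) (auto simp: b_def)
qed

lemma diff_operator_add:
  assumes "diff_operator K m A T" "diff_operator K m B S"
  shows "diff_operator K m (A + B) (\<lambda>F. T F + S F)"
proof -
  obtain a b where "\<forall>i\<le>m. a i \<in> K" "a m = A" "T = (\<lambda>F. \<Sum>i\<le>m. a i * (fls_deriv ^^ i) F)"
    "\<forall>i\<le>m. b i \<in> K" "b m = B" "S = (\<lambda>F. \<Sum>i\<le>m. b i * (fls_deriv ^^ i) F)"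
    using assms unfolding diff_operator_def by blast
  then show ?thesis unfolding diff_operator_def
    by (intro exI[of _ "\<lambda>i. a i + b i"]) (auto simp: sum.distrib algebra_simps)
qed

lemma diff_operator_mult:
  assumes "diff_operator K m A T" "g \<in> K"
  shows "diff_operator K m (g * A) (\<lambda>F. g * T F)"
proof -
  obtain a where "\<forall>i\<le>m. a i \<in> K" "a m = A" "T = (\<lambda>F. \<Sum>i\<le>m. a i * (fls_deriv ^^ i) F)"
    using assms unfolding diff_operator_def by blast
  then show ?thesis unfolding diff_operator_def using assms(2)
    by (intro exI[of _ "\<lambda>i. g * a i"]) (auto simp: sum_distrib_left mult.assoc)
qed

lemma diff_operator_deriv:
  assumes "diff_operator K m A T"
  shows "diff_operator K (Suc m) A (\<lambda>F. fls_deriv (T F))"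
proof -
  obtain a where a: "\<forall>i\<le>m. a i \<in> K" "a m = A" "T = (\<lambda>F. \<Sum>i\<le>m. a i * (fls_deriv ^^ i) F)"
    using assms unfolding diff_operator_def by blast
  have 1: "diff_operator K m (fls_deriv A) (\<lambda>F. \<Sum>i\<le>m. fls_deriv (a i) * (fls_deriv ^^ i) F)"
    unfolding diff_operator_def using a by (intro exI[of _ "\<lambda>i. fls_deriv (a i)"]) auto
  define b where "b i = (case i of 0 \<Rightarrow> 0 | Suc j \<Rightarrow> a j)" for i
  have "(\<Sum>i\<le>Suc m. b i * (fls_deriv ^^ i) F) = (\<Sum>i\<le>m. a i * (fls_deriv ^^ Suc i) F)" for F
    by (subst sum.atMost_Suc_shift) (simp add: b_def)
  then have "diff_operator K (Suc m) A (\<lambda>F. \<Sum>i\<le>m. a i * (fls_deriv ^^ Suc i) F)"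
    unfolding diff_operator_def using a
    by (intro exI[of _ b]) (auto simp: b_def split: nat.splits)
  from diff_operator_add[OF diff_operator_pad[OF 1, of "Suc m"] this]
  show ?thesis by (simp add: a fls_deriv_sum sum.distrib algebra_simps)
qed

lemma diff_operator_higher_deriv:
  "diff_operator K m A T \<Longrightarrow> diff_operator K (m + k) A (\<lambda>F. (fls_deriv ^^ k) (T F))"
  by (induction k) (auto intro: diff_operator_deriv)

lemma diff_operator_quartic:
  assumes "diff_operator K m A T" "W \<in> K"
  shows "diff_operator K (m + 4) A (\<lambda>F. quartic_op W (T F))"
  using diff_operator_add[OF diff_operator_higher_deriv[OF assms(1), of 4]
      diff_operator_pad[OF diff_operator_mult[OF assms], of "m + 4"]]
  by (simp add: quartic_op_def)

lemma diff_operator_quartic_power: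
  assumes "W \<in> K"
  shows "diff_operator K (4 * j) 1 (quartic_op W ^^ j)"
proof (induction j)
  case (Suc j)
  from diff_operator_quartic[OF this assms] show ?case by (simp add: comp_def add.commute)
qed (use diff_operator_id in \<open>simp add: id_def\<close>)

lemma diff_operator_jet:
  assumes "W \<in> K" "\<And>i. coeff Q i \<in> K" "degree Q \<le> N"
  shows "diff_operator K (4 * N + k) (coeff Q N) (jet W k Q)"
proof -
  have term_op: "diff_operator K (4 * i + k) (coeff Q i)
      (\<lambda>F. coeff Q i * (fls_deriv ^^ k) ((quartic_op W ^^ i) F))" for i
    using diff_operator_mult[OF diff_operator_higher_deriv[OF diff_operator_quartic_power[OF assms(1)]] assms(2)]
    by simp
  have "diff_operator K (4 * N + k) (coeff Q N)
      (\<lambda>F. \<Sum>i\<le>N. coeff Q i * (fls_deriv ^^ k) ((quartic_op W ^^ i) F))"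
  proof (induction N)
    case 0
    then show ?case using term_op[of 0] by simp
  next
    case (Suc N)
    from diff_operator_add[OF diff_operator_pad[OF Suc, of "4 * Suc N + k"] term_op[of "Suc N"]]
    show ?case by simp
  qed
  moreover have "jet W k Q F = (\<Sum>i\<le>N. coeff Q i * (fls_deriv ^^ k) ((quartic_op W ^^ i) F))" for F
    unfolding jet_def by (rule poly_app_bound[OF assms(3)])
  then have "jet W k Q = (\<lambda>F. \<Sum>i\<le>N. coeff Q i * (fls_deriv ^^ k) ((quartic_op W ^^ i) F))" ..
  ultimately show ?thesis by simp
qed

text \<open>
Only the term with \<open>i = N\<close> and two derivatives reaches the order \<open>4 N + 2\<close>.
\<close>

lemma diff_operator_rank2:
  assumes "W \<in> K" "\<And>i. coeff Q i \<in> K" "degree Q \<le> N"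
  shows "diff_operator K (4 * N + 2) (2 * coeff Q N) (rank2_op W Q)"
proof -
  have 2: "diff_operator K (4 * N + 2) (2 * coeff Q N) (\<lambda>F. 2 * jet W 2 Q F)"
    by (intro diff_operator_mult diff_operator_jet assms) auto
  have "diff_operator K (4 * N + 1) (- 2 * coeff (coeff_deriv Q) N) (\<lambda>F. - 2 * jet W 1 (coeff_deriv Q) F)"
    by (intro diff_operator_mult diff_operator_jet)
      (use assms order_trans[OF degree_coeff_deriv] in auto)
  then have 1: "diff_operator K (4 * N + 2) 0 (\<lambda>F. - 2 * jet W 1 (coeff_deriv Q) F)"
    by (rule diff_operator_pad) simp
  have "diff_operator K (4 * N + 0) (coeff (coeff_deriv (coeff_deriv Q)) N) (jet W 0 (coeff_deriv (coeff_deriv Q)))"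
    by (intro diff_operator_jet)
      (use assms order_trans[OF degree_coeff_deriv] order_trans[OF degree_coeff_deriv[of "coeff_deriv Q"]] in auto)
  then have 0: "diff_operator K (4 * N + 2) 0 (jet W 0 (coeff_deriv (coeff_deriv Q)))"
    by (rule diff_operator_pad) simp
  from diff_operator_add[OF diff_operator_add[OF 2 1] 0]
  show ?thesis by (simp add: rank2_op_def[abs_def])
qed

end

lemma diff_operator_has_symbol:
  assumes "diff_operator K m A T"
  obtains R N where "has_symbol T R N" "\<And>d. degree (R d) \<le> m"
    "\<And>d. coeff (R d) m = fls_nth A (int m + d)"
  using assms diff_op_has_symbol unfolding diff_operator_def by metis

text \<open>
The order of the pole and its leading coefficient are all that the analysis of the lowest symbol requires.
\<close>

locale euler_potential =
  fixes n :: nat and W :: "complex fls"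
  assumes n: "n \<ge> 1"
    and W_low: "\<And>u. u < -4 \<Longrightarrow> fls_nth W u = 0"
    and W_pole: "fls_nth W (-4) = of_nat (lame_const n)"
begin

definition commutes :: "(complex fls \<Rightarrow> complex fls) \<Rightarrow> bool" where
  "commutes T \<longleftrightarrow> (\<forall>k. T (quartic_op W (fls_X ^ k)) = quartic_op W (T (fls_X ^ k)))"

lemma symbol_recurrence:
  assumes "has_symbol T R N" "commutes T"
  shows "euler_symbol n (s + of_int d) * poly (R d) s - euler_symbol n s * poly (R d) (s - 4) =
     (\<Sum>e=1..d - N. fls_nth W (e - 4) *
        (poly (R (d - e)) (s + of_int e - 4) - poly (R (d - e)) s))"
proof (cases "d < N")
  case True
  then show ?thesis using has_symbol_low[OF assms(1)] by simp
next
  case False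
  then have "{0..d - N} = insert 0 {1..d - N}" by auto
  then show ?thesis
    using symbol_commute[OF assms(1) W_low, of s d] assms(2) W_pole
    by (simp add: commutes_def euler_symbol_def algebra_simps)
qed

text \<open>
The leading coefficient of an operator commuting with \<open>L\<close> is a constant. In the symbol this appears in the
coefficient of \<open>s\<^sup>m\<^sup>+\<^sup>3\<close>, which the right-hand side of the recurrence cannot reach.
\<close>

lemma symbol_top_coeff:
  assumes T: "has_symbol T R N" "commutes T" and deg: "\<And>d. degree (R d) \<le> m"
  shows "d + int m = 0 \<or> coeff (R d) m = 0"
proof -
  define L where "L = pcompose (ffact 4) [:of_int d, 1:] * R d - ffact 4 * pcompose (R d) [:-4, 1:]"
  define B where "B = (\<Sum>e=0..d - N. smult (fls_nth W (e - 4))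
      (pcompose (R (d - e)) [:of_int e - 4, 1:] - R (d - e)))"
  have "poly L s = poly B s" for s
    using symbol_commute[OF T(1) W_low, of s d] T(2)
    by (simp add: commutes_def L_def B_def poly_pcompose poly_sum algebra_simps)
  then have "L = B" by (simp add: poly_eq_poly_eq_iff[symmetric] fun_eq_iff)
  moreover have "degree B \<le> m"
    unfolding B_def
    by (intro degree_sum_le) (auto intro!: order_trans[OF degree_smult_le] degree_diff_le simp: degree_pcompose deg)
  ultimately have "coeff L (m + 3) = 0" by (simp add: coeff_eq_0)
  then have "4 * (of_int d + of_nat m) * coeff (R d) m = (0 :: complex)"
    unfolding L_def coeff_euler_recurrence[OF deg] .
  moreover have "of_int d + of_nat m = (of_int (d + int m) :: complex)" by simp
  ultimately show ?thesis by (simp only: mult_eq_0_iff of_int_eq_0_iff) auto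
qed

text \<open>
The same coefficient comparison for a single polynomial: the leading terms cancel only if its degree is \<open>- d\<close>.
\<close>

lemma homogeneous_degree:
  assumes q: "q \<noteq> 0"
    and eq: "\<And>s. euler_symbol n (s + of_int d) * poly q s = euler_symbol n s * poly q (s - 4)"
  shows "int (degree q) = - d"
proof -
  define L where "L = pcompose (ffact 4) [:of_int d, 1:] * q - ffact 4 * pcompose q [:-4, 1:]"
  define B where "B = smult (of_nat (lame_const n)) (pcompose q [:-4, 1:] - q)"
  have "poly L s = poly B s" for s
    using eq[of s] by (simp add: euler_symbol_def L_def B_def poly_pcompose algebra_simps)
  then have "L = B" by (simp add: poly_eq_poly_eq_iff[symmetric] fun_eq_iff)
  moreover have "degree B \<le> degree q"
    unfolding B_def by (auto intro!: order_trans[OF degree_smult_le] degree_diff_le simp: degree_pcompose)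
  ultimately have "coeff L (degree q + 3) = 0" by (simp add: coeff_eq_0)
  then have "4 * (of_int d + of_nat (degree q)) * coeff q (degree q) = (0 :: complex)"
    unfolding L_def coeff_euler_recurrence[OF order_refl] .
  moreover have "of_int d + of_nat (degree q) = (of_int (d + int (degree q)) :: complex)" by simp
  ultimately have "d + int (degree q) = 0"
    using q by (simp only: mult_eq_0_iff of_int_eq_0_iff) auto
  then show ?thesis by simp
qed

lemma symbol_lowest:
  assumes T: "has_symbol T R N" "commutes T" and low: "\<And>d'. d' < d \<Longrightarrow> R d' = 0"
  shows "euler_symbol n (s + of_int d) * poly (R d) s = euler_symbol n s * poly (R d) (s - 4)"
  using symbol_recurrence[OF T, of s d] low by simp

lemma symbol_has_lowest:
  assumes "has_symbol T R N" "R d \<noteq> 0"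
  obtains d0 where "d0 \<le> d" "R d0 \<noteq> 0" "\<And>d'. d' < d0 \<Longrightarrow> R d' = 0"
proof -
  have dN: "N \<le> d" using assms has_symbol_low[of T R N d] by (meson linorder_not_less)
  define k where "k = (LEAST k::nat. R (N + int k) \<noteq> 0)"
  have ex: "R (N + int (nat (d - N))) \<noteq> 0" using assms(2) dN by simp
  have "R (N + int k) \<noteq> 0" unfolding k_def by (rule LeastI[of _ "nat (d - N)"]) (rule ex)
  moreover have "N + int k \<le> d"
    using Least_le[of "\<lambda>k. R (N + int k) \<noteq> 0", OF ex] dN by (simp add: k_def)
  moreover have "R d' = 0" if "d' < N + int k" for d'
  proof (cases "d' < N")
    case True
    then show ?thesis using has_symbol_low[OF assms(1)] by simp
  next
    case False
    then have "nat (d' - N) < k" using that by simp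
    then have "R (N + int (nat (d' - N))) = 0"
      unfolding k_def using not_less_Least by blast
    then show ?thesis using False by simp
  qed
  ultimately show ?thesis using that by blast
qed

text \<open>
The lowest polynomial has degree \<open>- d\<close> by \<open>homogeneous_degree\<close>, but the degree is bounded by the order of the operator.
\<close>

lemma symbol_low_bound:
  assumes T: "has_symbol T R N" "commutes T" and deg: "\<And>d. degree (R d) \<le> m" and d: "d < - int m"
  shows "R d = 0"
proof (rule ccontr)
  assume "R d \<noteq> 0"
  then obtain d0 where d0: "d0 \<le> d" "R d0 \<noteq> 0" "\<And>d'. d' < d0 \<Longrightarrow> R d' = 0"
    using symbol_has_lowest[OF T(1)] by metis
  have "int (degree (R d0)) = - d0"
    by (rule homogeneous_degree[OF d0(2)]) (rule symbol_lowest[OF T d0(3)])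
  then show False using deg[of d0] d0(1) d by linarith
qed

lemma commuting_symbol:
  assumes op: "diff_operator K m A T" "A \<noteq> 0" and comm: "commutes T"
  obtains R N where "has_symbol T R N" "\<And>d. degree (R d) \<le> m" "coeff (R (- int m)) m \<noteq> 0"
    "\<And>d. d < - int m \<Longrightarrow> R d = 0"
proof -
  obtain R N where R: "has_symbol T R N" "\<And>d. degree (R d) \<le> m"
    "\<And>d. coeff (R d) m = fls_nth A (int m + d)"
    using diff_operator_has_symbol[OF op(1)] by metis
  obtain u where u: "fls_nth A u \<noteq> 0" using op(2) by (metis fls_eqI fls_zero_nth)
  then have "coeff (R (u - int m)) m \<noteq> 0" by (simp add: R(3))
  with symbol_top_coeff[OF R(1) comm R(2), of "u - int m"] have "u = 0" by auto
  with u have "coeff (R (- int m)) m \<noteq> 0" by (simp add: R(3))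
  then show ?thesis using that[OF R(1,2)] symbol_low_bound[OF R(1) comm R(2)] by blast
qed

text \<open>
The first correction to the pole of \<open>W\<close> is its constant term, which commutes with everything. The next one, the
coefficient of \<open>x\<^sup>2\<close>, enters the recurrence six degrees above the lowest one.
\<close>

theorem commuting_order_obstruction:
  assumes op: "diff_operator K (4 * n + 2) A T" "A \<noteq> 0" and comm: "commutes T"
    and W: "fls_nth W (-3) = 0" "fls_nth W (-2) = 0" "fls_nth W (-1) = 0" "fls_nth W 1 = 0"
  shows "fls_nth W 2 = 0"
proof -
  define m :: int where "m = 4 * int n + 2"
  have m: "int (4 * n + 2) = m" by (simp add: m_def)
  obtain R N where R: "has_symbol T R N" "coeff (R (- m)) (4 * n + 2) \<noteq> 0"
    "\<And>d. d < - m \<Longrightarrow> R d = 0"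
    using commuting_symbol[OF op comm] unfolding m by metis
  show ?thesis
  proof (rule weight_six_obstruction[OF n])
    show "R (- m) \<noteq> 0" using R(2) by auto
    show "euler_symbol n (s - of_int (4 * int n + 2)) * poly (R (- m)) s =
        euler_symbol n s * poly (R (- m)) (s - 4)" for s
    proof -
      have "euler_symbol n (s + of_int (- m)) * poly (R (- m)) s = euler_symbol n s * poly (R (- m)) (s - 4)"
        by (rule symbol_lowest[OF R(1) comm]) (rule R(3))
      moreover have "s + of_int (- m) = s - of_int (4 * int n + 2)" by (simp add: m_def)
      ultimately show ?thesis by (simp only:)
    qed
    show "euler_symbol n (s - of_int (4 * int n - 4)) * poly (R (6 - m)) s
        - euler_symbol n s * poly (R (6 - m)) (s - 4) =
        fls_nth W 2 * (poly (R (- m)) (s + 2) - poly (R (- m)) s)" for s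
    proof -
      define f where "f e = fls_nth W (e - 4) *
         (poly (R (6 - m - e)) (s + of_int e - 4) - poly (R (6 - m - e)) s)" for e
      have N: "N \<le> - m" using has_symbol_low[OF R(1), of "- m"] R(2) by (metis coeff_0 linorder_not_less)
      have "f e = 0" if "e \<in> {1..6 - m - N} - {6}" for e
      proof -
        \<comment> \<open>For \<open>e = 4\<close> the shift \<open>e - 4\<close> vanishes, so the difference is zero.\<close>
        have "e = 1 \<or> e = 2 \<or> e = 3 \<or> e = 4 \<or> e = 5 \<or> e > 6"
          using that by auto
        then show ?thesis by (auto simp: f_def W R(3))
      qed
      then have "(\<Sum>e=1..6 - m - N. f e) = (\<Sum>e\<in>{6}. f e)"
        using N by (intro sum.mono_neutral_right) auto
      then show ?thesis
        using symbol_recurrence[OF R(1) comm, of s "6 - m"]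
        by (simp add: f_def m_def algebra_simps)
    qed
  qed
qed

lemma quartic_op_diff: "quartic_op W (F - G) = quartic_op W F - quartic_op W G"
  by (simp add: quartic_op_def eval_nat_numeral algebra_simps)

lemma quartic_op_const: "quartic_op W (fls_const c * F) = fls_const c * quartic_op W F"
  by (simp add: quartic_op_def eval_nat_numeral algebra_simps)

lemma commutes_quartic_power: "commutes (quartic_op W ^^ j)"
  by (simp add: commutes_def funpow_swap1)

lemma commutes_diff: "commutes T \<Longrightarrow> commutes S \<Longrightarrow> commutes (\<lambda>F. T F - S F)"
  by (simp add: commutes_def quartic_op_diff)

lemma commutes_const: "commutes T \<Longrightarrow> commutes (\<lambda>F. fls_const c * T F)"
  by (simp add: commutes_def quartic_op_const)

text \<open>
The degree of a nonzero solution is known, so the space of solutions has dimension at most one.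
\<close>

lemma homogeneous_unique:
  assumes "\<And>s. euler_symbol n (s + of_int d) * poly q s = euler_symbol n s * poly q (s - 4)"
    and "coeff q (nat (- d)) = 0"
  shows "q = 0"
proof (rule ccontr)
  assume "q \<noteq> 0"
  then have "int (degree q) = - d" by (rule homogeneous_degree) (rule assms(1))
  then have "nat (- d) = degree q" by simp
  with assms(2) \<open>q \<noteq> 0\<close> show False by simp
qed

text \<open>
By \<open>homogeneous_unique\<close> the lowest polynomials of \<open>T\<close> and \<open>S\<close> are proportional, so a multiple of \<open>S\<close> removes that of \<open>T\<close>.
\<close>

lemma commuting_difference:
  assumes T: "has_symbol T R N" "commutes T" "\<And>d. d < - int m \<Longrightarrow> R d = 0"
    and S: "diff_operator UNIV m B S" "B \<noteq> 0" "commutes S"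
  obtains b R' N' where "has_symbol (\<lambda>F. T F - fls_const b * S F) R' N'"
    "commutes (\<lambda>F. T F - fls_const b * S F)" "\<And>d. d \<le> - int m \<Longrightarrow> R' d = 0"
    "b = 0 \<longleftrightarrow> coeff (R (- int m)) m = 0"
proof -
  interpret U: differential_subring UNIV by unfold_locales auto
  obtain RS NS where RS: "has_symbol S RS NS" "coeff (RS (- int m)) m \<noteq> 0"
    using commuting_symbol[OF S] by metis
  define b where "b = coeff (R (- int m)) m / coeff (RS (- int m)) m"
  define S' where "S' F = fls_const b * S F" for F
  have S': "diff_operator UNIV m (fls_const b * B) S'"
    unfolding S'_def by (rule U.diff_operator_mult[OF S(1)]) simp
  obtain R1 N1 where R1: "has_symbol S' R1 N1" "\<And>d. degree (R1 d) \<le> m"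
    using diff_operator_has_symbol[OF S'] by metis
  have cS': "commutes S'" unfolding S'_def[abs_def] by (rule commutes_const[OF S(3)])
  have R1_eq: "R1 d = smult b (RS d)" for d
  proof -
    have "poly (R1 d - smult b (RS d)) (of_nat k) = 0" for k
      using has_symbol_X_power[OF R1(1), of k "d + int k"] has_symbol_X_power[OF RS(1), of k "d + int k"]
      by (simp add: S'_def)
    then show ?thesis using poly_eq_0_if_nat_roots[of "R1 d - smult b (RS d)"] by simp
  qed
  have sym: "has_symbol (\<lambda>F. T F - S' F) (\<lambda>d. R d - R1 d) (min N N1)"
    by (rule has_symbol_diff[OF T(1) R1(1)])
  have comm: "commutes (\<lambda>F. T F - S' F)" by (rule commutes_diff[OF T(2) cS'])
  have low: "R d - R1 d = 0" if "d < - int m" for d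
    using that T(3) symbol_low_bound[OF R1(1) cS' R1(2) that] by simp
  have "R (- int m) - R1 (- int m) = 0"
  proof (rule homogeneous_unique)
    show "euler_symbol n (s + of_int (- int m)) * poly (R (- int m) - R1 (- int m)) s =
        euler_symbol n s * poly (R (- int m) - R1 (- int m)) (s - 4)" for s
      by (rule symbol_lowest[OF sym comm low])
    show "coeff (R (- int m) - R1 (- int m)) (nat (- (- int m))) = 0"
      using RS(2) by (simp add: R1_eq b_def)
  qed
  then have "R d - R1 d = 0" if "d \<le> - int m" for d
    using that low by (cases "d = - int m") auto
  moreover have "b = 0 \<longleftrightarrow> coeff (R (- int m)) m = 0" using RS(2) by (simp add: b_def)
  ultimately show ?thesis using that[of b] sym comm by (simp add: S'_def)
qed

text \<open>
By \<open>homogeneous_orders\<close> only orders divisible by four occur below \<open>4 n + 2\<close>. There a power of \<open>L\<close> removes the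
lowest polynomial of the symbol, until nothing is left.
\<close>

lemma polynomial_in_quartic:
  assumes "has_symbol T R N" "commutes T" "\<And>d. d \<le> - int m \<Longrightarrow> R d = 0" "m \<le> 4 * n + 2"
  shows "\<exists>A. \<forall>k. T (fls_X ^ k) = jet W 0 (const_poly A) (fls_X ^ k)"
  using assms
proof (induction m arbitrary: T R N)
  case 0
  have R0: "R d = 0" for d
  proof (rule ccontr)
    assume "R d \<noteq> 0"
    then obtain d0 where d0: "R d0 \<noteq> 0" "\<And>d'. d' < d0 \<Longrightarrow> R d' = 0"
      using symbol_has_lowest[OF 0(1)] by metis
    have "int (degree (R d0)) = - d0"
      by (rule homogeneous_degree[OF d0(1)]) (rule symbol_lowest[OF 0(1,2) d0(2)])
    moreover have "d0 > 0" using 0(3)[of d0] d0(1) by force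
    ultimately show False by simp
  qed
  have "T (fls_X ^ k) = jet W 0 (const_poly 0) (fls_X ^ k)" for k
    by (rule fls_eqI) (simp add: has_symbol_X_power[OF 0(1)] R0)
  then show ?case by blast
next
  case (Suc m)
  have low: "R d = 0" if "d < - int m" for d using Suc.prems(3)[of d] that by simp
  show ?case
  proof (cases "R (- int m) = 0")
    case True
    have "R d = 0" if "d \<le> - int m" for d using that low True by (cases "d = - int m") auto
    then show ?thesis using Suc.IH[OF Suc.prems(1,2)] Suc.prems(4) by simp
  next
    case False
    have "\<exists>j::nat. int m = 4 * int j \<or> int m = 4 * int j + 4 * int n + 2"
    proof (rule homogeneous_orders[OF n False])
      show "euler_symbol n (s - of_int (int m)) * poly (R (- int m)) s =
          euler_symbol n s * poly (R (- int m)) (s - 4)" for s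
      proof -
        have "euler_symbol n (s + of_int (- int m)) * poly (R (- int m)) s =
            euler_symbol n s * poly (R (- int m)) (s - 4)"
          by (rule symbol_lowest[OF Suc.prems(1,2)]) (rule low)
        then show ?thesis by simp
      qed
    qed
    then obtain j :: nat where "int m = 4 * int j" using Suc.prems(4) by auto
    then have j: "m = 4 * j" by linarith
    interpret U: differential_subring UNIV by unfold_locales auto
    have op: "diff_operator UNIV m 1 (quartic_op W ^^ j)"
      unfolding j by (rule U.diff_operator_quartic_power) simp
    obtain b R' N' where b: "has_symbol (\<lambda>F. T F - fls_const b * (quartic_op W ^^ j) F) R' N'"
      "commutes (\<lambda>F. T F - fls_const b * (quartic_op W ^^ j) F)" "\<And>d. d \<le> - int m \<Longrightarrow> R' d = 0"
      by (rule commuting_difference[OF Suc.prems(1,2) _ op one_neq_zero commutes_quartic_power],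
          rule low, assumption, rule that)
    obtain A where A: "\<forall>k. T (fls_X ^ k) - fls_const b * (quartic_op W ^^ j) (fls_X ^ k) =
        jet W 0 (const_poly A) (fls_X ^ k)"
      using Suc.IH[OF b] Suc.prems(4) by auto
    have "jet W 0 (const_poly (A + monom b j)) F =
        jet W 0 (const_poly A) F + fls_const b * (quartic_op W ^^ j) F" for F
    proof -
      have "const_poly (monom b j) = monom (fls_const b) j"
        by (rule poly_eqI) (simp add: coeff_monom)
      moreover have "jet W 0 (monom (fls_const b) j) F = fls_const b * (quartic_op W ^^ j) F"
        unfolding jet_def
        by (subst poly_app_bound[of _ j]) (auto simp: degree_monom_le if_distrib[of "\<lambda>x. x * _"] cong: if_cong)
      ultimately show ?thesis by (simp add: const_poly_add jet_add)
    qed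
    then have "T (fls_X ^ k) = jet W 0 (const_poly (A + monom b j)) (fls_X ^ k)" for k
      using A[rule_format, of k] by (simp add: algebra_simps)
    then show ?thesis by blast
  qed
qed

theorem commutant_order:
  assumes T: "diff_operator UNIV (4 * n + 2) A T" "A \<noteq> 0" "commutes T"
    and S: "diff_operator UNIV (4 * n + 2) B S" "B \<noteq> 0" "commutes S"
  shows "\<exists>b P. b \<noteq> 0 \<and> T = (\<lambda>F. fls_const b * S F + jet W 0 (const_poly P) F)"
proof -
  interpret U: differential_subring UNIV by unfold_locales auto
  define m where "m = 4 * n + 2"
  obtain R N where R: "has_symbol T R N" "coeff (R (- int m)) m \<noteq> 0" "\<And>d. d < - int m \<Longrightarrow> R d = 0"
    using commuting_symbol[OF T] unfolding m_def by metis
  obtain b R' N' where b: "has_symbol (\<lambda>F. T F - fls_const b * S F) R' N'"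
    "commutes (\<lambda>F. T F - fls_const b * S F)" "\<And>d. d \<le> - int m \<Longrightarrow> R' d = 0"
    "b = 0 \<longleftrightarrow> coeff (R (- int m)) m = 0"
    by (rule commuting_difference[OF R(1) T(3) _ S[folded m_def]], rule R(3), assumption, rule that)
  obtain P where P: "\<forall>k. T (fls_X ^ k) - fls_const b * S (fls_X ^ k) = jet W 0 (const_poly P) (fls_X ^ k)"
    using polynomial_in_quartic[OF b(1,2), of m] b(3) by (auto simp: m_def)
  have "diff_operator UNIV (4 * degree (const_poly P) + 0) (coeff (const_poly P) (degree (const_poly P)))
      (jet W 0 (const_poly P))"
    by (rule U.diff_operator_jet) auto
  then have "diff_operator UNIV (m + 4 * degree (const_poly P) + 1) 0 (jet W 0 (const_poly P))"
    by (rule U.diff_operator_pad) simp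
  moreover have "diff_operator UNIV (m + 4 * degree (const_poly P) + 1) 0 (\<lambda>F. fls_const b * S F)"
    by (rule U.diff_operator_pad[OF U.diff_operator_mult[OF S(1)]]) (auto simp: m_def)
  ultimately obtain R2 N2 where R2: "has_symbol (\<lambda>F. fls_const b * S F + jet W 0 (const_poly P) F) R2 N2"
    using diff_operator_has_symbol[OF U.diff_operator_add] by metis
  have "T = (\<lambda>F. fls_const b * S F + jet W 0 (const_poly P) F)"
    by (rule has_symbol_unique[OF R(1) R2]) (use P in \<open>simp add: algebra_simps\<close>)
  then show ?thesis using b(4) R(2) by blast
qed

end

section \<open>Germs of meromorphic functions\<close>

definition germ :: "(complex \<Rightarrow> complex) \<Rightarrow> complex fls" where
  "germ f = laurent_expansion f 0"

lemma germ_expansion: "f meromorphic_on UNIV \<Longrightarrow> f has_laurent_expansion germ f"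
  using meromorphic_on_imp_has_laurent_expansion[of f UNIV 0] by (simp add: germ_def)

lemma germ_eqI: "f has_laurent_expansion F \<Longrightarrow> germ f = F"
  unfolding germ_def by (rule laurent_expansion_0_eqI)

lemma germ_add: "f meromorphic_on UNIV \<Longrightarrow> g meromorphic_on UNIV \<Longrightarrow> germ (\<lambda>x. f x + g x) = germ f + germ g"
  and germ_diff: "f meromorphic_on UNIV \<Longrightarrow> g meromorphic_on UNIV \<Longrightarrow> germ (\<lambda>x. f x - g x) = germ f - germ g"
  and germ_mult: "f meromorphic_on UNIV \<Longrightarrow> g meromorphic_on UNIV \<Longrightarrow> germ (\<lambda>x. f x * g x) = germ f * germ g"
  and germ_power: "f meromorphic_on UNIV \<Longrightarrow> germ (\<lambda>x. f x ^ k) = germ f ^ k"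
  and germ_deriv: "f meromorphic_on UNIV \<Longrightarrow> germ (deriv f) = fls_deriv (germ f)"
  by (intro germ_eqI laurent_expansion_intros germ_expansion; assumption)+

lemma germ_const: "germ (\<lambda>x. c) = fls_const c"
  by (intro germ_eqI laurent_expansion_intros)

lemma germ_sum:
  "(\<And>i. i \<in> I \<Longrightarrow> f i meromorphic_on UNIV) \<Longrightarrow> germ (\<lambda>x. \<Sum>i\<in>I. f i x) = (\<Sum>i\<in>I. germ (f i))"
  by (intro germ_eqI laurent_expansion_intros germ_expansion)

lemma germ_higher_deriv:
  "f meromorphic_on UNIV \<Longrightarrow> germ ((deriv ^^ i) f) = (fls_deriv ^^ i) (germ f)"
proof (induction i)
  case (Suc i)
  then show ?case using germ_deriv[of "(deriv ^^ i) f"] by (simp add: meromorphic_intros)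
qed simp

lemma germ_monomial: "germ (\<lambda>x. x ^ k) = fls_X ^ k"
  by (intro germ_eqI laurent_expansion_intros)

text \<open>
The plane is connected, so a meromorphic function that vanishes near 0 vanishes almost everywhere.
\<close>

lemma germ_eq_iff:
  assumes f: "f meromorphic_on UNIV" and g: "g meromorphic_on UNIV"
  shows "(\<forall>\<^sub>\<approx>x. f x = g x) \<longleftrightarrow> germ f = germ g"
proof
  assume "\<forall>\<^sub>\<approx>x. f x = g x"
  then have "eventually (\<lambda>x. f x = g x) (at 0)"
    by (rule eventually_cosparse_imp_eventually_at) auto
  then show "germ f = germ g" unfolding germ_def by (intro laurent_expansion_cong) auto
next
  assume eq: "germ f = germ g"
  define h where "h x = f x - g x" for x
  have h: "h meromorphic_on UNIV" unfolding h_def by (intro meromorphic_intros f g)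
  have "h has_laurent_expansion 0"
    using germ_expansion[OF h] germ_diff[OF f g] eq by (simp add: h_def[abs_def])
  then have ev: "eventually (\<lambda>x. h x = 0) (at 0)"
    by (auto simp: has_laurent_expansion_def)
  have "(\<forall>\<^sub>\<approx>x. h x = 0) \<or> (\<forall>\<^sub>\<approx>x. h x \<noteq> 0)"
    by (rule meromorphic_imp_constant_or_avoid[OF h]) auto
  moreover have "\<not> (\<forall>\<^sub>\<approx>x. h x \<noteq> 0)"
  proof
    assume "\<forall>\<^sub>\<approx>x. h x \<noteq> 0"
    then have "eventually (\<lambda>x. h x \<noteq> 0) (at 0)"
      by (rule eventually_cosparse_imp_eventually_at) auto
    with ev have "eventually (\<lambda>x. False) (at (0::complex))" by eventually_elim simp
    then show False by simp
  qed
  ultimately show "\<forall>\<^sub>\<approx>x. f x = g x" by (auto simp: h_def)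
qed

definition mero_germs :: "complex fls set" where
  "mero_germs = {germ f | f. f meromorphic_on UNIV}"

lemma germ_mem: "f meromorphic_on UNIV \<Longrightarrow> germ f \<in> mero_germs"
  unfolding mero_germs_def by blast

interpretation mero: differential_subring mero_germs
proof
  show "fls_const c \<in> mero_germs" for c
    using germ_mem[OF meromorphic_on_const[of c]] by (simp add: germ_const)
next
  fix a b assume "a \<in> mero_germs" "b \<in> mero_germs"
  then obtain f g where f: "f meromorphic_on UNIV" "a = germ f" and g: "g meromorphic_on UNIV" "b = germ g"
    unfolding mero_germs_def by blast
  show "a + b \<in> mero_germs"
    using germ_mem[of "\<lambda>x. f x + g x"] f g by (simp add: germ_add meromorphic_intros)
  show "a * b \<in> mero_germs"
    using germ_mem[of "\<lambda>x. f x * g x"] f g by (simp add: germ_mult meromorphic_intros)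
next
  fix a assume "a \<in> mero_germs"
  then obtain f where f: "f meromorphic_on UNIV" "a = germ f"
    unfolding mero_germs_def by blast
  then show "fls_deriv a \<in> mero_germs"
    using germ_mem[of "deriv f"] by (simp add: germ_deriv meromorphic_intros)
qed

text \<open>
\<open>S\<close> describes \<open>T\<close> on Laurent expansions at 0.
\<close>

definition represents :: "oper \<Rightarrow> (complex fls \<Rightarrow> complex fls) \<Rightarrow> bool" where
  "represents T S \<longleftrightarrow> (\<forall>f. f meromorphic_on UNIV \<longrightarrow> T f meromorphic_on UNIV \<and> germ (T f) = S (germ f))"

lemma oper_eq_iff:
  assumes "represents T S" "represents T' S'"
  shows "oper_eq T T' \<longleftrightarrow> (\<forall>F\<in>mero_germs. S F = S' F)"
  using assms germ_eq_iff unfolding oper_eq_def represents_def mero_germs_def by auto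

lemma represents_comp: "represents T S \<Longrightarrow> represents T' S' \<Longrightarrow> represents (T \<circ> T') (S \<circ> S')"
  unfolding represents_def by auto

lemma represents_funpow: "represents T S \<Longrightarrow> represents (T ^^ k) (S ^^ k)"
  by (induction k) (auto simp: represents_def)

lemma represents_sum:
  assumes "\<And>i. i \<in> I \<Longrightarrow> represents (T i) (S i)"
  shows "represents (\<lambda>f x. \<Sum>i\<in>I. T i f x) (\<lambda>F. \<Sum>i\<in>I. S i F)"
  unfolding represents_def
proof (intro allI impI conjI)
  fix f :: "complex \<Rightarrow> complex" assume f: "f meromorphic_on UNIV"
  show "(\<lambda>x. \<Sum>i\<in>I. T i f x) meromorphic_on UNIV"
    using assms f by (intro meromorphic_intros) (auto simp: represents_def)
  show "germ (\<lambda>x. \<Sum>i\<in>I. T i f x) = (\<Sum>i\<in>I. S i (germ f))"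
    using assms f by (subst germ_sum) (auto simp: represents_def)
qed

lemma represents_mult:
  assumes "represents T S" "g meromorphic_on UNIV"
  shows "represents (\<lambda>f x. g x * T f x) (\<lambda>F. germ g * S F)"
  using assms unfolding represents_def by (auto simp: germ_mult intro: meromorphic_intros)

lemma represents_add:
  assumes "represents T S" "represents T' S'"
  shows "represents (\<lambda>f x. T f x + T' f x) (\<lambda>F. S F + S' F)"
  using assms unfolding represents_def by (auto simp: germ_add intro: meromorphic_intros)

lemma represents_deriv: "represents (deriv ^^ i) (fls_deriv ^^ i)"
  unfolding represents_def by (auto simp: germ_higher_deriv intro: meromorphic_intros)

lemma represents_id: "represents (\<lambda>f. f) (\<lambda>F. F)"
  by (simp add: represents_def)

lemma represents_diff_op:
  assumes "\<And>i. i \<le> m \<Longrightarrow> a i meromorphic_on UNIV"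
  shows "represents (diff_op m a) (\<lambda>F. \<Sum>i\<le>m. germ (a i) * (fls_deriv ^^ i) F)"
  unfolding diff_op_def
  by (intro represents_sum represents_mult represents_deriv) (use assms in auto)

lemma represents_L4:
  assumes "p meromorphic_on UNIV"
  shows "represents (L4 n p) (quartic_op (fls_const (of_nat (lame_const n)) * (germ p)\<^sup>2))"
proof -
  define c :: complex where "c = of_nat (lame_const n)"
  have mero: "(\<lambda>x. c * (p x)\<^sup>2) meromorphic_on UNIV"
    by (intro meromorphic_intros assms)
  have "germ (\<lambda>x. c * (p x)\<^sup>2) = fls_const c * (germ p)\<^sup>2"
    using assms germ_mult[of "\<lambda>_. c" "\<lambda>x. (p x)\<^sup>2"] germ_power[of p 2]
    by (simp add: germ_const meromorphic_intros)
  then have "represents (\<lambda>f x. (deriv ^^ 4) f x + c * (p x)\<^sup>2 * f x)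
      (\<lambda>F. (fls_deriv ^^ 4) F + fls_const c * (germ p)\<^sup>2 * F)"
    using represents_add[OF represents_deriv represents_mult[OF represents_id mero], of 4] by simp
  then show ?thesis
    by (simp add: L4_def[abs_def] quartic_op_def[abs_def] c_def lame_const_def)
qed

lemma represents_oper_poly:
  assumes "represents L S" "represents M T"
  shows "represents (oper_poly R L M)
    (\<lambda>F. \<Sum>j\<le>degree R. \<Sum>i\<le>degree (coeff R j). fls_const (coeff (coeff R j) i) * (S ^^ i) ((T ^^ j) F))"
proof -
  have "represents (\<lambda>f x. coeff (coeff R j) i * ((L ^^ i) ((M ^^ j) f)) x)
     (\<lambda>F. fls_const (coeff (coeff R j) i) * (S ^^ i) ((T ^^ j) F))" for i j
    using represents_mult[OF represents_comp[OF represents_funpow[OF assms(1), of i] represents_funpow[OF assms(2), of j]]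
      meromorphic_on_const[of "coeff (coeff R j) i"]]
    by (simp add: germ_const comp_def)
  then show ?thesis
    unfolding oper_poly_def by (intro represents_sum)
qed

lemma diff_op_of_order_germ:
  assumes "diff_op_of_order m M"
  obtains A T where "represents M T" "diff_operator mero_germs m A T" "A \<noteq> 0"
proof -
  obtain a where a: "\<forall>i\<le>m. a i meromorphic_on UNIV" "\<not> (\<forall>\<^sub>\<approx>x. a m x = 0)" "M = diff_op m a"
    using assms unfolding diff_op_of_order_def by blast
  define T where "T F = (\<Sum>i\<le>m. germ (a i) * (fls_deriv ^^ i) F)" for F
  have "represents M T"
    unfolding a(3) T_def[abs_def] by (rule represents_diff_op) (use a in auto)
  moreover have "diff_operator mero_germs m (germ (a m)) T"
    unfolding diff_operator_def T_def[abs_def] using a germ_mem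
    by (intro exI[of _ "\<lambda>i. germ (a i)"]) auto
  moreover have "germ (a m) \<noteq> 0"
    using germ_eq_iff[of "a m" "\<lambda>_. 0"] a by (auto simp: germ_const meromorphic_intros)
  ultimately show ?thesis by (rule that)
qed

lemma diff_op_of_order_from_germ:
  assumes "diff_operator mero_germs m A T" "A \<noteq> 0"
  obtains M where "diff_op_of_order m M" "represents M T"
proof -
  obtain b where b: "\<forall>i\<le>m. b i \<in> mero_germs" "b m = A" "T = (\<lambda>F. \<Sum>i\<le>m. b i * (fls_deriv ^^ i) F)"
    using assms unfolding diff_operator_def by blast
  from b(1) have "\<forall>i. \<exists>f. i \<le> m \<longrightarrow> f meromorphic_on UNIV \<and> b i = germ f"
    unfolding mero_germs_def by blast
  then obtain a where a: "\<And>i. i \<le> m \<Longrightarrow> a i meromorphic_on UNIV" "\<And>i. i \<le> m \<Longrightarrow> b i = germ (a i)"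
    by metis
  have "represents (diff_op m a) T"
    using represents_diff_op[of m a] a b(3) by simp
  moreover have "diff_op_of_order m (diff_op m a)"
    unfolding diff_op_of_order_def
    using a assms(2) b(2) germ_eq_iff[of "a m" "\<lambda>_. 0"]
    by (intro exI[of _ a]) (auto simp: germ_const meromorphic_intros)
  ultimately show ?thesis using that by blast
qed

lemma weierstrass_ode_germ:
  assumes "p meromorphic_on UNIV"
  shows "weierstrass_ode g2 g3 p \<longleftrightarrow>
    (fls_deriv (germ p))\<^sup>2 = 4 * germ p ^ 3 + fls_const g2 * germ p + fls_const g3"
proof -
  have d: "deriv p meromorphic_on UNIV" by (intro meromorphic_intros assms)
  have "(\<lambda>x. (deriv p x)\<^sup>2) meromorphic_on UNIV"
    "(\<lambda>x. 4 * p x ^ 3 + g2 * p x + g3) meromorphic_on UNIV"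
    by (intro meromorphic_intros assms)+
  moreover have "germ (\<lambda>x. (deriv p x)\<^sup>2) = (fls_deriv (germ p))\<^sup>2"
    by (intro germ_eqI laurent_expansion_intros germ_expansion assms)
  moreover have "germ (\<lambda>x. 4 * p x ^ 3 + g2 * p x + g3) =
      4 * germ p ^ 3 + fls_const g2 * germ p + fls_const g3"
    by (intro germ_eqI laurent_expansion_intros germ_expansion assms)
  ultimately show ?thesis
    unfolding weierstrass_ode_def by (simp add: germ_eq_iff)
qed

lemma germ_inverse_square: "germ (\<lambda>x. 1 / x\<^sup>2) = fls_X_inv\<^sup>2"
proof -
  have "(\<lambda>x. 1 / x\<^sup>2) has_laurent_expansion (1 / fls_X\<^sup>2 :: complex fls)"
    by (intro laurent_expansion_intros)
  moreover have "(1 / fls_X\<^sup>2 :: complex fls) = fls_X_inv\<^sup>2"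
    by (simp add: divide_inverse fls_inverse_X flip: power_inverse)
  ultimately show ?thesis by (simp add: germ_eqI)
qed

text \<open>
The quotient \<open>(p - 1/x\<^sup>2) / x\<^sup>2\<close> is bounded near 0, so its Laurent series has no principal part.
\<close>

lemma weierstrass_p_germ:
  assumes "weierstrass_p g2 g3 p"
  obtains h where "germ p = fls_X_inv\<^sup>2 + fls_X\<^sup>2 * fps_to_fls h"
proof -
  have p: "p meromorphic_on UNIV" and O: "(\<lambda>x. p x - 1 / x\<^sup>2) \<in> O[at 0](\<lambda>x. x\<^sup>2)"
    using assms by (auto simp: weierstrass_p_def)
  define q where "q x = (p x - 1 / x\<^sup>2) / x\<^sup>2" for x
  define G where "G = (germ p - fls_X_inv\<^sup>2) / fls_X\<^sup>2"
  have inv: "(\<lambda>x. 1 / x\<^sup>2 :: complex) meromorphic_on UNIV" by (intro meromorphic_intros)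
  have q: "q has_laurent_expansion G"
    unfolding q_def G_def germ_inverse_square[symmetric]
    by (intro laurent_expansion_intros germ_expansion p inv)
  obtain c where c: "eventually (\<lambda>x. norm (p x - 1 / x\<^sup>2) \<le> c * norm (x\<^sup>2)) (at 0)"
    using O by (elim landau_o.bigE)
  have "eventually (\<lambda>x::complex. x \<noteq> 0) (at 0)" by (simp add: eventually_at_filter)
  with c have bounded: "eventually (\<lambda>x. norm (q x) \<le> c) (at 0)"
  proof eventually_elim
    case (elim x)
    then have "norm (x\<^sup>2) > 0" by simp
    with elim(1) show ?case
      unfolding q_def norm_divide by (simp only: pos_divide_le_eq)
  qed
  have "fls_subdegree G \<ge> 0"
  proof (rule ccontr)
    assume "\<not> fls_subdegree G \<ge> 0"
    then have "filterlim q at_infinity (at 0)"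
      by (intro has_laurent_expansion_imp_filterlim_infinity_0[OF q]) simp
    then have "eventually (\<lambda>x. c + 1 \<le> norm (q x)) (at 0)"
      unfolding filterlim_at_infinity_conv_norm_at_top filterlim_at_top by blast
    with bounded have "eventually (\<lambda>x. False) (at (0::complex))" by eventually_elim simp
    then show False by simp
  qed
  then have "fps_to_fls (fls_regpart G) = G" by simp
  moreover have "fls_X\<^sup>2 * G = germ p - fls_X_inv\<^sup>2"
    unfolding G_def times_divide_eq_right by (rule nonzero_mult_div_cancel_left) simp
  ultimately have "germ p = fls_X_inv\<^sup>2 + fls_X\<^sup>2 * fps_to_fls (fls_regpart G)"
    by (simp only:) simp
  then show ?thesis by (rule that)
qed

lemma weierstrass_series:
  fixes h :: "complex fps"
  assumes "P = fls_X_inv\<^sup>2 + fls_X\<^sup>2 * fps_to_fls h"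
    and "(fls_deriv P)\<^sup>2 = 4 * P ^ 3 + fls_const g2 * P + fls_const g3"
  shows "fps_X ^ 4 * (2 * h + fps_X * fps_deriv h)\<^sup>2 - 8 * h - 4 * fps_X * fps_deriv h =
    12 * h + 12 * fps_X ^ 4 * h\<^sup>2 + 4 * fps_X ^ 8 * h ^ 3 + fps_const g2
      + fps_const g2 * fps_X ^ 4 * h + fps_const g3 * fps_X\<^sup>2" (is "?l = ?r")
proof -
  define x i H H' :: "complex fls" where "x = fls_X" and "i = fls_X_inv" and "H = fps_to_fls h"
    and "H' = fps_to_fls (fps_deriv h)"
  have ix: "i * x = 1" by (simp add: i_def x_def flip: fls_inverse_X)
  have d: "fls_deriv P = - 2 * i ^ 3 + 2 * x * H + x\<^sup>2 * H'"
    unfolding assms(1)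
    by (simp add: x_def i_def H_def H'_def fls_deriv_fps_to_fls power2_eq_square power3_eq_cube algebra_simps)
  have "(- 2 * i ^ 3 + 2 * x * H + x\<^sup>2 * H')\<^sup>2 = 4 * (i\<^sup>2 + x\<^sup>2 * H) ^ 3
      + fls_const g2 * (i\<^sup>2 + x\<^sup>2 * H) + fls_const g3"
    using assms(2) unfolding d unfolding assms(1) by (simp add: x_def i_def H_def)
  then have "x ^ 4 * (2 * H + x * H')\<^sup>2 - 8 * H - 4 * x * H' =
    12 * H + 12 * x ^ 4 * H\<^sup>2 + 4 * x ^ 8 * H ^ 3 + fls_const g2
      + fls_const g2 * x ^ 4 * H + fls_const g3 * x\<^sup>2"
    using ix by algebra
  moreover have "fps_to_fls ?l = x ^ 4 * (2 * H + x * H')\<^sup>2 - 8 * H - 4 * x * H'"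
    by (simp add: x_def H_def H'_def fls_times_fps_to_fls fps_to_fls_power)
  moreover have "fps_to_fls ?r = 12 * H + 12 * x ^ 4 * H\<^sup>2 + 4 * x ^ 8 * H ^ 3 + fls_const g2
      + fls_const g2 * x ^ 4 * H + fls_const g3 * x\<^sup>2"
    by (simp add: x_def H_def fls_times_fps_to_fls fps_to_fls_power)
  ultimately have "fps_to_fls ?l = fps_to_fls ?r" by (simp only:)
  then show ?thesis by (simp only: fps_to_fls_eq_iff)
qed

text \<open>
The differential equation determines the coefficients one after the other, because \<open>20 + 4 k\<close> does not vanish. The
coefficient at \<open>k = 2\<close> is the one that detects \<open>g3\<close>.
\<close>

lemma weierstrass_series_coeffs:
  fixes h :: "complex fps"
  assumes "P = fls_X_inv\<^sup>2 + fls_X\<^sup>2 * fps_to_fls h"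
    and "(fls_deriv P)\<^sup>2 = 4 * P ^ 3 + fls_const g2 * P + fls_const g3"
  shows "fps_nth h 1 = 0" "fps_nth h 2 = - g3 / 28" "g2 = 0 \<Longrightarrow> g3 = 0 \<Longrightarrow> h = 0"
proof -
  define u where "u = (2 * h + fps_X * fps_deriv h)\<^sup>2"
  define v where "v = 12 * h\<^sup>2 + 4 * fps_X ^ 4 * h ^ 3 + fps_const g2 * h"
  have eq: "fps_X ^ 4 * (u - v) - 8 * h - 4 * (fps_X * fps_deriv h) =
      12 * h + fps_const g2 + fps_const g3 * fps_X\<^sup>2"
    using weierstrass_series[OF assms] unfolding u_def v_def by algebra
  have n: "fps_nth (numeral k * a) i = numeral k * fps_nth a i" for k i and a :: "complex fps"
    by (simp add: numeral_fps_const)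
  have n': "fps_nth (- numeral k * a) i = - numeral k * fps_nth a i" for k i and a :: "complex fps"
    by (simp add: n)
  have eqn: "fps_nth (fps_X ^ 4 * (u - v) - 8 * h - 4 * (fps_X * fps_deriv h)) k =
      fps_nth (12 * h + fps_const g2 + fps_const g3 * fps_X\<^sup>2) k" for k
    by (simp only: eq)
  show "fps_nth h 1 = 0"
    using eqn[of 1] unfolding fps_add_nth fps_sub_nth n by (simp add: fps_X_power_mult_nth)
  show "fps_nth h 2 = - g3 / 28"
  proof -
    have "fps_nth (fps_X ^ 4 * (u - v)) 2 = 0" by (simp only: fps_X_power_mult_nth) simp
    moreover have "fps_nth (fps_X * fps_deriv h) 2 = 2 * fps_nth h 2" by (simp add: numeral_2_eq_2)
    ultimately have "28 * fps_nth h 2 + g3 = 0"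
      using eqn[of 2] unfolding fps_add_nth fps_sub_nth n by (simp add: algebra_simps)
    then have "28 * fps_nth h 2 = - g3" by (simp only: add_eq_0_iff2)
    then show ?thesis by (simp add: field_simps)
  qed
  assume g: "g2 = 0" "g3 = 0"
  show "h = 0"
  proof (rule ccontr)
    assume "h \<noteq> 0"
    define k where "k = subdegree h"
    \<comment> \<open>In degree \<open>k\<close> all nonlinear terms vanish, since they carry a factor \<open>fps_X ^ 4\<close>.\<close>
    have hk: "fps_nth h k \<noteq> 0" unfolding k_def using \<open>h \<noteq> 0\<close> by simp
    have low: "fps_nth h i = 0" if "i < k" for i using that unfolding k_def by (rule nth_less_subdegree_zero)
    have sq: "fps_nth (a * b) i = 0" if "\<And>j. j < k \<Longrightarrow> fps_nth a j = 0" "i < k" for a b :: "complex fps" and i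
      unfolding fps_mult_nth
    proof (intro sum.neutral ballI)
      fix j assume "j \<in> {0..i}"
      with that(2) have "j < k" by simp
      then show "fps_nth a j * fps_nth b (i - j) = 0" by (simp add: that(1))
    qed
    have w: "fps_nth (2 * h + fps_X * fps_deriv h) j = 0" if "j < k" for j
      using low[OF that] that by (cases j) (auto simp: n low)
    have "fps_nth (fps_X ^ 4 * (u - v)) k = 0"
    proof (cases "k < 4")
      case False
      have "fps_nth u (k - 4) = 0"
        unfolding u_def power2_eq_square by (rule sq[OF w]) (use False in auto)
      moreover have "fps_nth v (k - 4) = 0"
      proof -
        have "v = h * (12 * h + 4 * fps_X ^ 4 * h\<^sup>2 + fps_const g2)"
          by (simp add: v_def power2_eq_square power3_eq_cube algebra_simps)
        then show ?thesis using sq[OF low, of "k - 4"] False by simp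
      qed
      ultimately show ?thesis using False by (simp add: fps_X_power_mult_nth)
    qed (simp add: fps_X_power_mult_nth)
    moreover have "fps_nth (fps_X * fps_deriv h) k = of_nat k * fps_nth h k" by (cases k) simp_all
    ultimately have "0 - 8 * fps_nth h k - 4 * (of_nat k * fps_nth h k) = 12 * fps_nth h k"
      using eqn[of k] g unfolding fps_add_nth fps_sub_nth n by (simp only:) simp
    then have "(20 + 4 * of_nat k) * fps_nth h k = 0" by algebra
    then have "(20 + 4 * of_nat k :: complex) = 0" using hk by simp
    moreover have "(20 + 4 * of_nat k :: complex) = of_nat (20 + 4 * k)" by simp
    ultimately show False by (simp only: of_nat_eq_0_iff)
  qed
qed

lemma weierstrass_deriv2:
  fixes h :: "complex fps"
  assumes "P = fls_X_inv\<^sup>2 + fls_X\<^sup>2 * fps_to_fls h"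
    and ode: "(fls_deriv P)\<^sup>2 = 4 * P ^ 3 + fls_const g2 * P + fls_const g3"
  shows "fls_deriv (fls_deriv P) = 6 * P\<^sup>2 + fls_const (g2 / 2)"
proof -
  have "2 * fls_deriv P * fls_deriv (fls_deriv P) = fls_deriv ((fls_deriv P)\<^sup>2)"
    by (simp add: power2_eq_square)
  also have "\<dots> = fls_deriv P * (12 * P\<^sup>2 + fls_const g2)"
    unfolding ode by (simp add: power2_eq_square power3_eq_cube algebra_simps)
  finally have "fls_deriv P * (2 * fls_deriv (fls_deriv P) - (12 * P\<^sup>2 + fls_const g2)) = 0"
    by (simp add: algebra_simps)
  moreover have "fls_deriv P \<noteq> 0"
  proof -
    have "fls_nth P (-2) = 1"
      unfolding assms(1) by (simp add: fls_X_inv_power_conv_shift_1 fls_X_power_times_conv_shift)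
    then have "fls_nth (fls_deriv P) (-3) \<noteq> 0" by simp
    then show ?thesis by (metis fls_zero_nth)
  qed
  ultimately have "2 * fls_deriv (fls_deriv P) = 12 * P\<^sup>2 + fls_const g2" by simp
  moreover have "fls_const g2 = 2 * fls_const (g2 / 2)"
    by (metis fls_const_mult_const fls_const_numeral nonzero_mult_div_cancel_left times_divide_eq_right zero_neq_numeral)
  ultimately have "2 * fls_deriv (fls_deriv P) = 2 * (6 * P\<^sup>2 + fls_const (g2 / 2))" by simp
  then show ?thesis by (simp only: mult_cancel_left) simp
qed

section \<open>Simple branch points for small n\<close>

definition simple_roots :: "complex poly \<Rightarrow> bool" where
  "simple_roots f \<longleftrightarrow> (\<forall>v. poly f v = 0 \<longrightarrow> poly (pderiv f) v \<noteq> 0)"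

text \<open>
A Bezout identity for \<open>g\<close> and its derivative excludes a common root. The cofactors used below come from the extended
Euclidean algorithm.
\<close>

lemma simple_rootsI:
  assumes "f = smult c g" "pderiv g = h" "a * g + b * h = [:D:]" "c \<noteq> 0" "D \<noteq> 0"
  shows "simple_roots f"
  unfolding simple_roots_def
proof (intro allI impI notI)
  fix v assume "poly f v = 0" "poly (pderiv f) v = 0"
  then have "poly g v = 0" "poly h v = 0"
    using assms(1,4) by (simp_all add: pderiv_smult assms(2))
  then have "poly (a * g + b * h) v = 0" by simp
  with assms(3,5) show False by simp
qed

lemma lame_coeff_step:
  assumes "j < n"
  shows "lame_coeff g n j =
     smult ((of_nat j + 1) / (2 * (2 * of_nat j + 1) * (of_nat (lame_const n) - of_nat (lame_const j))))
       ([:g * (8 * (of_nat j + 1)\<^sup>2 * (16 * (of_nat j + 1)\<^sup>2 + 5)), 4:] * lame_coeff g n (j + 1)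
        + smult (g\<^sup>2 * ((of_nat j + 2) * (4 * of_nat j + 7) * (2 * of_nat j + 3) * (4 * of_nat j + 5) / 2))
            (lame_coeff g n (j + 2)))"
  using assms by (subst lame_coeff.simps) simp

lemma lame_coeff_top: "lame_coeff g n n = 1" and lame_coeff_above: "n < j \<Longrightarrow> lame_coeff g n j = 0"
  by (simp_all add: lame_coeff.simps)

text \<open>
Arithmetic with large coefficients, kept to the rules for numerals to avoid costly rearrangements of sums.
\<close>

lemmas numeral_poly_arith =
  mult_pCons_left mult_zero_left mult_zero_right smult_pCons smult_0_right add_pCons add_0_left
  add_0_right arith_simps more_arith_simps mult_1_left mult_1_right minus_zero pCons_0_0

lemma lame_curve_simple_roots_1:
  "simple_roots (lame_coeff 1 1 0)"
  "simple_roots (pCons 0 (smult 4 (lame_coeff 1 1 0)) + smult 3 (lame_coeff 1 1 1))"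
proof -
  have q1: "lame_coeff 1 1 1 = 1" by (simp add: lame_coeff.simps)
  have q0: "lame_coeff 1 1 0 = [:3 / 10, 1 / 140:]"
    using lame_coeff_step[of 0 1 1] lame_coeff_above[of 1 2 1] q1
    by (simp add: lame_const_def del: One_nat_def add_2_eq_Suc add_2_eq_Suc')
  show "simple_roots (lame_coeff 1 1 0)"
  proof (rule simple_rootsI)
    let ?f = "[:42, 1:]"
    let ?d = "[:1:] :: complex poly"
    show "lame_coeff 1 1 0 = smult (1 / 140) ?f"
      using q0 q1 by simp
    show "pderiv ?f = ?d"
      by (simp add: pderiv_pCons)
    show "0 * ?f + [:1:] * ?d = [:1:]"
      by (simp only: numeral_poly_arith)
  qed simp_all
  show "simple_roots (pCons 0 (smult 4 (lame_coeff 1 1 0)) + smult 3 (lame_coeff 1 1 1))"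
  proof (rule simple_rootsI)
    let ?f = "[:105, 42, 1:]"
    let ?d = "[:42, 2:] :: complex poly"
    show "pCons 0 (smult 4 (lame_coeff 1 1 0)) + smult 3 (lame_coeff 1 1 1) = smult (1 / 35) ?f"
      using q0 q1 by simp
    show "pderiv ?f = ?d"
      by (simp add: pderiv_pCons)
    show "[:-2:] * ?f + [:21, 1:] * ?d = [:672:]"
      by (simp only: numeral_poly_arith)
  qed simp_all
qed

lemma lame_curve_simple_roots_2:
  "simple_roots (lame_coeff 1 2 0)"
  "simple_roots (pCons 0 (smult 4 (lame_coeff 1 2 0)) + smult 3 (lame_coeff 1 2 1))"
proof -
  have q2: "lame_coeff 1 2 2 = 1" by (simp add: lame_coeff.simps)
  have q1: "lame_coeff 1 2 1 = [:46 / 131, 1 / 1572:]"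
    using lame_coeff_step[of 1 2 1] lame_coeff_above[of 2 3 1] q2
    by (simp add: lame_const_def del: One_nat_def add_2_eq_Suc add_2_eq_Suc')
  have q0: "lame_coeff 1 2 0 = [:217 / 6288, 1 / 3144, 1 / 1867536:]"
    using lame_coeff_step[of 0 2 1] q1 q2
    by (simp add: lame_const_def del: One_nat_def add_2_eq_Suc add_2_eq_Suc')
  show "simple_roots (lame_coeff 1 2 0)"
  proof (rule simple_rootsI)
    let ?f = "[:64449, 594, 1:]"
    let ?d = "[:594, 2:] :: complex poly"
    show "lame_coeff 1 2 0 = smult (1 / 1867536) ?f"
      using q0 q1 by simp
    show "pderiv ?f = ?d"
      by (simp add: pderiv_pCons)
    show "[:-2:] * ?f + [:297, 1:] * ?d = [:47520:]"
      by (simp only: numeral_poly_arith)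
  qed simp_all
  show "simple_roots (pCons 0 (smult 4 (lame_coeff 1 2 0)) + smult 3 (lame_coeff 1 2 1))"
  proof (rule simple_rootsI)
    let ?f = "[:491832, 65340, 594, 1:]"
    let ?d = "[:65340, 1188, 3:] :: complex poly"
    show "pCons 0 (smult 4 (lame_coeff 1 2 0)) + smult 3 (lame_coeff 1 2 1) = smult (1 / 466884) ?f"
      using q0 q1 by simp
    show "pderiv ?f = ?d"
      by (simp add: pderiv_pCons)
    show "[:-9450, -33:] * ?f + [:240372, 5328, 11:] * ?d = [:11058094080:]"
      by (simp only: numeral_poly_arith)
  qed simp_all
qed

lemma lame_curve_simple_roots_3:
  "simple_roots (lame_coeff 1 3 0)"
  "simple_roots (pCons 0 (smult 4 (lame_coeff 1 3 0)) + smult 3 (lame_coeff 1 3 1))"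
proof -
  have q3: "lame_coeff 1 3 3 = 1" by (simp add: lame_coeff.simps)
  have q2: "lame_coeff 1 3 2 = [:447 / 970, 1 / 5820:]"
    using lame_coeff_step[of 2 3 1] lame_coeff_above[of 3 4 1] q3
    by (simp add: lame_const_def del: One_nat_def add_2_eq_Suc add_2_eq_Suc')
  have q1: "lame_coeff 1 3 1 = [:569067 / 8807600, 539 / 6605700, 1 / 39634200:]"
    using lame_coeff_step[of 1 3 1] q2 q3
    by (simp add: lame_const_def del: One_nat_def add_2_eq_Suc add_2_eq_Suc')
  have q0: "lame_coeff 1 3 0 = [:113232 / 35780875, 128 / 8257125, 7 / 396342000, 1 /
      185488056000:]"
    using lame_coeff_step[of 0 3 1] q1 q2
    by (simp add: lame_const_def del: One_nat_def add_2_eq_Suc add_2_eq_Suc')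
  show "simple_roots (lame_coeff 1 3 0)"
  proof (rule simple_rootsI)
    let ?f = "[:586994688, 2875392, 3276, 1:]"
    let ?d = "[:2875392, 6552, 3:] :: complex poly"
    show "lame_coeff 1 3 0 = smult (1 / 185488056000) ?f"
      using q0 q1 by simp
    show "pderiv ?f = ?d"
      by (simp add: pderiv_pCons)
    show "[:-46872, -39:] * ?f + [:10977408, 29820, 13:] * ?d = [:4050736128000:]"
      by (simp only: numeral_poly_arith)
  qed simp_all
  show "simple_roots (pCons 0 (smult 4 (lame_coeff 1 3 0)) + smult 3 (lame_coeff 1 3 1))"
  proof (rule simple_rootsI)
    let ?f = "[:8988413265, 598346028, 2878902, 3276, 1:]"
    let ?d = "[:598346028, 5757804, 9828, 4:] :: complex poly"
    show "pCons 0 (smult 4 (lame_coeff 1 3 0)) + smult 3 (lame_coeff 1 3 1) = smult (1 / 46372014000) ?f"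
      using q0 q1 by simp
    show "pderiv ?f = ?d"
      by (simp add: pderiv_pCons)
    show "[:-1558563005844, -3855491640, -1803124:] * ?f + [:72291317116095, 920830882959,
        1333062549, 450781:] * ?d = [:29246214059237376000000:]"
      by (simp only: numeral_poly_arith)
  qed simp_all
qed

lemma lame_curve_simple_roots_4:
  "simple_roots (lame_coeff 1 4 0)"
  "simple_roots (pCons 0 (smult 4 (lame_coeff 1 4 0)) + smult 3 (lame_coeff 1 4 1))"
proof -
  have q4: "lame_coeff 1 4 4 = 1" by (simp add: lame_coeff.simps)
  have q3: "lame_coeff 1 4 3 = [:2088 / 3605, 1 / 14420:]"
    using lame_coeff_step[of 3 4 1] lame_coeff_above[of 4 5 1] q4
    by (simp add: lame_const_def del: One_nat_def add_2_eq_Suc add_2_eq_Suc')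
  have q2: "lame_coeff 1 4 2 = [:48362571 / 422938600, 16551 / 422938600, 3 / 845877200:]"
    using lame_coeff_step[of 2 4 1] q3 q4
    by (simp add: lame_const_def del: One_nat_def add_2_eq_Suc add_2_eq_Suc')
  have q1: "lame_coeff 1 4 1 = [:167054656 / 18767900375, 27974713 / 3603436872000, 1931 /
      900859218000, 1 / 5405155308000:]"
    using lame_coeff_step[of 1 4 1] q2 q3
    by (simp add: lame_const_def del: One_nat_def add_2_eq_Suc add_2_eq_Suc')
  have q0: "lame_coeff 1 4 0 = [:15242378133 / 58341358880000, 4766649 / 6005728120000, 22163 /
      36034368720000, 1 / 6005728120000, 1 / 69834606579360000:]"
    using lame_coeff_step[of 0 4 1] q1 q2
    by (simp add: lame_const_def del: One_nat_def add_2_eq_Suc add_2_eq_Suc')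
  show "simple_roots (lame_coeff 1 4 0)"
  proof (rule simple_rootsI)
    let ?f = "[:18245126625201, 55426594572, 42951894, 11628, 1:]"
    let ?d = "[:55426594572, 85903788, 34884, 4:] :: complex poly"
    show "lame_coeff 1 4 0 = smult (1 / 69834606579360000) ?f"
      using q0 q1 by simp
    show "pderiv ?f = ?d"
      by (simp add: pderiv_pCons)
    show "[:-52091049728316, -41796061416, -6562204:] * ?f + [:18588738860113653, 37039274390157,
        15218097111, 1640551:] * ?d = [:79902694071533297664000000:]"
      by (simp only: numeral_poly_arith)
  qed simp_all
  show "simple_roots (pCons 0 (smult 4 (lame_coeff 1 4 0)) + smult 3 (lame_coeff 1 4 1))"
  proof (rule simple_rootsI)
    let ?f = "[:466202769592320, 18651739078656, 55538862912, 42961584, 11628, 1:]"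
    let ?d = "[:18651739078656, 111077725824, 128884752, 46512, 5:] :: complex poly"
    show "pCons 0 (smult 4 (lame_coeff 1 4 0)) + smult 3 (lame_coeff 1 4 1) = smult (1 / 17458651644840000) ?f"
      using q0 q1 by simp
    show "pderiv ?f = ?d"
      by (simp add: pderiv_pCons)
    show "[:-3756107248447131912647147507712, -6530068262455530035017696032,
        -2760096484686132599507628, -320808768816474634945:] * ?f +
        [:275309303684801943110622079472640, 2279762585582734095616978152192,
        2304332300692196101381698768, 701233871489145202107144, 64161753763294926989:] * ?d =
        [:3383889696143551407039381328724087537664000000:]"
      by (simp only: numeral_poly_arith)
  qed simp_all
qed

lemma lame_curve_simple_roots_5:
  "simple_roots (lame_coeff 1 5 0)"
  "simple_roots (pCons 0 (smult 4 (lame_coeff 1 5 0)) + smult 3 (lame_coeff 1 5 1))"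
proof -
  have q5: "lame_coeff 1 5 5 = 1" by (simp add: lame_coeff.simps)
  have q4: "lame_coeff 1 5 4 = [:1125 / 1606, 1 / 28908:]"
    using lame_coeff_step[of 4 5 1] lame_coeff_above[of 5 6 1] q5
    by (simp add: lame_const_def del: One_nat_def add_2_eq_Suc add_2_eq_Suc')
  have q3: "lame_coeff 1 5 3 = [:156367 / 867240, 227 / 9756450, 1 / 1229312700:]"
    using lame_coeff_step[of 3 5 1] q4 q5
    by (simp add: lame_const_def del: One_nat_def add_2_eq_Suc add_2_eq_Suc')
  have q2: "lame_coeff 1 5 2 = [:23166529 / 1115848800, 577397 / 100426392000, 79 / 143792334000, 1
      / 56941764264000:]"
    using lame_coeff_step[of 2 5 1] q3 q4
    by (simp add: lame_const_def del: One_nat_def add_2_eq_Suc add_2_eq_Suc')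
  have q1: "lame_coeff 1 5 1 = [:4774688321 / 4597297056000, 67558087 / 103439183760000, 1869053 /
      13033337153760000, 379 / 29325008595960000, 1 / 2463300722060640000:]"
    using lame_coeff_step[of 1 5 1] q2 q3
    by (simp add: lame_const_def del: One_nat_def add_2_eq_Suc add_2_eq_Suc')
  have q0: "lame_coeff 1 5 0 = [:58359149 / 2873310660000, 25338023 / 603395238600000, 42073 /
      1810185715800000, 53 / 10636013480400000, 1 / 2239364292782400000, 1 /
      71386454925317347200000:]"
    using lame_coeff_step[of 0 5 1] q1 q2
    by (simp add: lame_const_def del: One_nat_def add_2_eq_Suc add_2_eq_Suc')
  show "simple_roots (lame_coeff 1 5 0)"
  proof (rule simple_rootsI)
    let ?f = "[:1449913793717098080, 2997689608858896, 1659190154832, 355723704, 31878, 1:]"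
    let ?d = "[:2997689608858896, 3318380309664, 1067171112, 127512, 5:] :: complex poly"
    show "lame_coeff 1 5 0 = smult (1 / 71386454925317347200000) ?f"
      using q0 q1 by simp
    show "pderiv ?f = ?d"
      by (simp add: pderiv_pCons)
    show "[:-122172174233420531002776, -81956486923121606796, -13934244517655274, -668028975685:] *
        ?f + [:62401860278932801512750480, 92735082647685446665536, 31446449981094345624,
        3638666011006512, 133605795137:] * ?d = [:9922287502176487568712682577068032000000:]"
      by (simp only: numeral_poly_arith)
  qed simp_all
  show "simple_roots (pCons 0 (smult 4 (lame_coeff 1 5 0)) + smult 3 (lame_coeff 1 5 1))"
  proof (rule simple_rootsI)
    let ?f = "[:55605729049745627025, 1484881676465882310, 3005367519713391, 1659882110292,
        355745439, 31878, 1:]"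
    let ?d = "[:1484881676465882310, 6010735039426782, 4979646330876, 1422981756, 159390, 6:] ::
        complex poly"
    show "pCons 0 (smult 4 (lame_coeff 1 5 0)) + smult 3 (lame_coeff 1 5 1) = smult (1 / 17846613731329336800000) ?f"
      using q0 q1 by simp
    show "pderiv ?f = ?d"
      by (simp add: pderiv_pCons)
    show "[:-7498891697113076386367910215106, -9545118388609760745529484268,
        -3245434680012026313932568, -396995265830805632820, -15713466357820998:] * ?f +
        [:795936479937153761777930760895515, 4634421019304687269789461018093,
        3415088755563944448118699206, 833367608406741186324882, 80080152098318099199,
        2618911059636833:] * ?d = [:764890154806377100982778740528670865725849600000000:]"
      by (simp only: numeral_poly_arith)
  qed simp_all
qed

lemma lame_curve_simple_roots_6:
  "simple_roots (lame_coeff 1 6 0)"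
  "simple_roots (pCons 0 (smult 4 (lame_coeff 1 6 0)) + smult 3 (lame_coeff 1 6 1))"
proof -
  have q6: "lame_coeff 1 6 6 = 1" by (simp add: lame_coeff.simps)
  have q5: "lame_coeff 1 6 5 = [:498 / 605, 1 / 50820:]"
    using lame_coeff_step[of 5 6 1] lame_coeff_above[of 6 7 1] q6
    by (simp add: lame_const_def del: One_nat_def add_2_eq_Suc add_2_eq_Suc')
  have q4: "lame_coeff 1 6 4 = [:1110691 / 4237904, 3449 / 222489960, 1 / 4004819280:]"
    using lame_coeff_step[of 4 6 1] q5 q6
    by (simp add: lame_const_def del: One_nat_def add_2_eq_Suc add_2_eq_Suc')
  have q3: "lame_coeff 1 6 3 = [:12392429 / 306188564, 18108877 / 3857975906400, 559 /
      2893481929800, 1 / 364578723154800:]"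
    using lame_coeff_step[of 3 6 1] q4 q5
    by (simp add: lame_const_def del: One_nat_def add_2_eq_Suc add_2_eq_Suc')
  have q2: "lame_coeff 1 6 2 = [:234680965253 / 75542842510080, 33432731 / 48602931762000, 2595667 /
      44617491357516000, 677 / 312322439502612000, 1 / 33730823466282096000:]"
    using lame_coeff_step[of 2 6 1] q3 q4
    by (simp add: lame_const_def del: One_nat_def add_2_eq_Suc add_2_eq_Suc')
  have q1: "lame_coeff 1 6 1 = [:129666093881 / 1192160483362200, 4114821201451 /
      80113184481939840000, 3211819229 / 360509330168729280000, 10687081 / 15141391867086629760000,
      877 / 34068131700944916960000, 1 / 2861723062879373024640000:]"
    using lame_coeff_step[of 1 6 1] q2 q3
    by (simp add: lame_const_def del: One_nat_def add_2_eq_Suc add_2_eq_Suc')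
  have q0: "lame_coeff 1 6 0 = [:208587985765787 / 137336887683325440000, 9111961884713 /
      4005659224096992000000, 284476041257 / 302827837341732595200000, 12011183 /
      75706959335433148800000, 714349 / 57234461257587460492800000, 13 / 28617230628793730246400000,
      1 / 162259697665260450497088000000:]"
    using lame_coeff_step[of 0 6 1] q1 q2
    by (simp add: lame_const_def del: One_nat_def add_2_eq_Suc add_2_eq_Suc')
  show "simple_roots (lame_coeff 1 6 0)"
  proof (rule simple_rootsI)
    let ?f = "[:246440880362774830898025, 369103834808666704782, 152426530046119455, 25743088076580,
        2025179415, 73710, 1:]"
    let ?d = "[:369103834808666704782, 304853060092238910, 77229264229740, 8100717660, 368550, 6:]
        :: complex poly"
    show "lame_coeff 1 6 0 = smult (1 / 162259697665260450497088000000) ?f"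
      using q0 q1 by simp
    show "pderiv ?f = ?d"
      by (simp add: pderiv_pCons)
    show "[:-2815640705351101487286388031956483622262, -1546155651747170335996213615446990804,
        -237741221039966626626885781384488, -13516194282415999502974665516,
        -253450869692162100588642:] * ?f + [:1956463476948487914075798318917891177721525,
        2232070724227356515065042474476133128687, 614758319521076290322027592929132874,
        63937763969106025429272207058518, 2771639702764035151451022081, 42241811615360350098107:] *
        ?d = [:28249197792794642268799908953763508123895056117782282240000000:]"
      by (simp only: numeral_poly_arith)
  qed simp_all
  show "simple_roots (pCons 0 (smult 4 (lame_coeff 1 6 0)) + smult 3 (lame_coeff 1 6 1))"
  proof (rule simple_rootsI)
    let ?f = "[:13236209481144661033680000, 252691439946802081444800, 370188027588384284832,
        152512424520709680, 25746220808280, 2025221940, 73710, 1:]"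
    let ?d = "[:252691439946802081444800, 740376055176768569664, 457537273562129040,
        102984883233120, 10126109700, 442260, 7:] :: complex poly"
    show "pCons 0 (smult 4 (lame_coeff 1 6 0)) + smult 3 (lame_coeff 1 6 1) = smult (1 / 40564924416315112624272000000) ?f"
      using q0 q1 by simp
    show "pderiv ?f = ?d"
      by (simp add: pderiv_pCons)
    show "[:-4368365236343562231797897036070868466173796942561447416224,
        -4230569330606096815403002838902686889530272169954050160,
        -1148036893587743576382721607654012887341976329290160,
        -124360907589456077584874627338267921082028182280,
        -5745116457783356219728533263808763020322170, -94172596875416744437180965699223860407:] * ?f
        + [:632914537268038428098648234383998815161590845557753724318400,
        2735551451400968923030396577674512362950147162070773898112,
        1529224889333395140447857374645803031861034198613086640,
        297130677357260142571057023021351824600183930414400,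
        25242410804857958205679638158142236659484607780, 962393414697356362664578404660227181486840,
        13453228125059534919597280814174837201:] * ?d =
        [:102111488427131163949178599349126133867540215280794122738183805561958354124800000000:]"
      by (simp only: numeral_poly_arith)
  qed simp_all
qed

lemma lame_curve_simple_roots_7:
  "simple_roots (lame_coeff 1 7 0)"
  "simple_roots (pCons 0 (smult 4 (lame_coeff 1 7 0)) + smult 3 (lame_coeff 1 7 1))"
proof -
  have q7: "lame_coeff 1 7 7 = 1" by (simp add: lame_coeff.simps)
  have q6: "lame_coeff 1 7 6 = [:38661 / 40846, 1 / 81692:]"
    using lame_coeff_step[of 6 7 1] lame_coeff_above[of 7 8 1] q7
    by (simp add: lame_const_def del: One_nat_def add_2_eq_Suc add_2_eq_Suc')
  have q5: "lame_coeff 1 7 5 = [:3310093107 / 9205381328, 25533 / 2301345332, 3 / 32218834648:]"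
    using lame_coeff_step[of 5 7 1] q6 q7
    by (simp add: lame_const_def del: One_nat_def add_2_eq_Suc add_2_eq_Suc')
  have q4: "lame_coeff 1 7 4 = [:2355285228865 / 33664079516496, 809344955 / 201984477098976, 58085
      / 706945669846416, 5 / 8483348038156992:]"
    using lame_coeff_step[of 4 7 1] q5 q6
    by (simp add: lame_const_def del: One_nat_def add_2_eq_Suc add_2_eq_Suc')
  have q3: "lame_coeff 1 7 3 = [:15872241207495705 / 2154680630813165312, 1188711504755 /
      1616010473109873984, 1964246215 / 67872439870614707328, 8795 / 16968109967653676832, 5 /
      1425321237282908853888:]"
    using lame_coeff_step[of 3 7 1] q4 q5
    by (simp add: lame_const_def del: One_nat_def add_2_eq_Suc add_2_eq_Suc')
  have q2: "lame_coeff 1 7 2 = [:43637034886067924823 / 107195361382954974272000, 78438982382429 /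
      1077340315406582656000, 491666982437 / 93795941210085602488000, 1668721 /
      9004410356168217838848, 25073 / 7878859061647190608992000, 1 / 47273154369883143653952000:]"
    using lame_coeff_step[of 2 7 1] q3 q4
    by (simp add: lame_const_def del: One_nat_def add_2_eq_Suc add_2_eq_Suc')
  have q1: "lame_coeff 1 7 1 = [:833530211334034964461 / 78961752354090525663744000,
      1490046926224449157 / 384938542726191312610752000, 668515979704933 /
      1243647599576925779203968000, 5501742563 / 152522818816038067260864000, 120742991 /
      97004512767000210777909504000, 719 / 33951579468450073772268326400, 1 /
      7129831688374515492176348544000:]"
    using lame_coeff_step[of 1 7 1] q2 q3
    by (simp add: lame_const_def del: One_nat_def add_2_eq_Suc add_2_eq_Suc')
  have q0: "lame_coeff 1 7 0 = [:267770628445984856 / 2422573294066742201760375, 220049731427083 /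
      1754277212944882284033375, 73286106977 / 1830550135246833687687000, 587849443 /
      108819164962981005680347200, 127177 / 353662286129688268461128400, 191 /
      15432536122022760805576512000, 1 / 4753221125583010328117565696000, 1 /
      717888493039053215876252182198272000:]"
    using lame_coeff_step[of 0 7 1] q1 q2
    by (simp add: lame_const_def del: One_nat_def add_2_eq_Suc add_2_eq_Suc')
  show "simple_roots (lame_coeff 1 7 0)"
  proof (rule simple_rootsI)
    let ?f = "[:79349282602102505677053100032, 90049148972671691048730624, 28740678490798727104512,
        3878088486643687680, 258152787164160, 8884910496, 151032, 1:]"
    let ?d = "[:90049148972671691048730624, 57481356981597454209024, 11634265459931063040,
        1032611148656640, 44424552480, 906192, 7:] :: complex poly"
    show "lame_coeff 1 7 0 = smult (1 / 717888493039053215876252182198272000) ?f"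
      using q0 q1 by simp
    show "pderiv ?f = ?d"
      by (simp add: pderiv_pCons)
    show "[:-39417608654753378542048099329486793094273241907900195505054252144153490701021184,
        -17798849334567746007912615712095214393322232672591251194959831903028853194752,
        -2371639310702653236205440291532469395476836518944232383234990959650862784,
        -129862193112906273855196700772544707501126708862855187184011626863408,
        -3093988727186236527808061885955006583022669689451273638868360436,
        -26556347257840185463199511368326992422223391093147325121529:] * ?f +
        [:35820967952140895262293756266895908079848620173034306831113105856821986956711002112,
        32235842610092834059372786257428111459473498962175049035694201626136081225207808,
        7264225270207874549486808526835896712694235200909030619772180272855579043328,
        651838996705900833538777897055443730283538248314297539769838915992811456,
        27122418979877375292692332952567179416014500832141722330247782446192,
        523852639374485195623150649034004253074937367953860046527210020,
        3793763893977169351885644481189570346031913013306760731647:] * ?d =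
        [:97888710822526454127832058985786484585180205588715856128734644964284784251590013245372111877602017280000000:]"
      by (simp only: numeral_poly_arith)
  qed simp_all
  show "simple_roots (pCons 0 (smult 4 (lame_coeff 1 7 0)) + smult 3 (lame_coeff 1 7 1))"
  proof (rule simple_rootsI)
    let ?f = "[:5683591069196763609006214659201, 81433422192637644315099202296,
        90338571753734930179944348, 28760100032317727553480, 3878758661680251846, 258164189325000,
        8884986012, 151032, 1:]"
    let ?d = "[:81433422192637644315099202296, 180677143507469860359888696, 86280300096953182660440,
        15515034646721007384, 1290820946625000, 53309916072, 1057224, 8:] :: complex poly"
    show "pCons 0 (smult 4 (lame_coeff 1 7 0)) + smult 3 (lame_coeff 1 7 1) = smult (1 / 179472123259763303969063045549568000) ?f"
      using q0 q1 by simp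
    show "pderiv ?f = ?d"
      by (simp add: pderiv_pCons)
    show
        "[:-9612299944600743746737131129439581277645872751578178054945072366892993663177350124457932208249999528,
        -7310271239582121788684368886649614236089815777774534623986867007324971314836916769959855547823440,
        -1602647832145213163016725700067908109254765420775005560529019900146323251396874787729104566680,
        -148033424434518058377913102485423027826914899545983699409564283419989613264555749693048672,
        -6501709925206720353613702107068802266075510110095725068084824481049407694456049885528,
        -134049400699444635719147582644414984168423664270391442311892381923972573649474128,
        -1040888443504012928829709574667846135027504070838512066299108344288116409704:] * ?f +
        [:1821605710341106635592337700901937722273070383315927261075893241261823021816448540863416583254330690443,
        6080900719717975490049994736459479271026202190944136328428822803764626079942581233012160135469819275,
        2663798010530721461413753178680962887598033732128796548134611615937032745272769305500379261502839,
        417383905151876725496347217440641676097814579406194200832940803548940909803486676164412543111,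
        30195043698694813972359914194644236499778095353475057971686868229913767110018275481815137,
        1093446079666500938648358695223589561887967698653766830465394604949561325393830102913,
        19212541703044611975315458713071156418950989202968963951444156044473490418534493,
        130111055438001616103713696833480766878438008854814008287388543036014551213:] * ?d =
        [:93707204759153600756572144873702541420266095616804946658876596648683879823764926116383830824792093828422641525497296878305280000000:]"
      by (simp only: numeral_poly_arith)
  qed simp_all
qed

lemma lame_curve_simple_roots_small:
  assumes "n \<ge> 1" "n < 8"
  shows "simple_roots (lame_coeff 1 n 0)"
    "simple_roots (pCons 0 (smult 4 (lame_coeff 1 n 0)) + smult 3 (lame_coeff 1 n 1))"
proof -
  consider "n = 1" | "n = 2" | "n = 3" | "n = 4" | "n = 5" | "n = 6" | "n = 7"
    using assms by linarith
  then have "simple_roots (lame_coeff 1 n 0) \<and>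
      simple_roots (pCons 0 (smult 4 (lame_coeff 1 n 0)) + smult 3 (lame_coeff 1 n 1))"
    by cases (use lame_curve_simple_roots_1 lame_curve_simple_roots_2 lame_curve_simple_roots_3
      lame_curve_simple_roots_4 lame_curve_simple_roots_5 lame_curve_simple_roots_6
      lame_curve_simple_roots_7 in simp_all)
  then show "simple_roots (lame_coeff 1 n 0)"
    "simple_roots (pCons 0 (smult 4 (lame_coeff 1 n 0)) + smult 3 (lame_coeff 1 n 1))"
    by blast+
qed

text \<open>
By the recursion a common root of two neighbours is a root of the next one, and finally of \<open>q\<^sub>n = 1\<close>.
\<close>

lemma lame_coeff_no_common_root:
  assumes "j < n" "poly (lame_coeff 1 n j) v = 0" "poly (lame_coeff 1 n (j + 1)) v = 0"
  shows False
  using assms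
proof (induction "n - j" arbitrary: j rule: less_induct)
  case less
  show ?case
  proof (cases "j + 1 = n")
    case True
    then show ?thesis using less.prems lame_coeff_top[of 1 n] by simp
  next
    case False
    obtain \<kappa> where \<kappa>: "\<kappa> = (of_nat j + 1 :: complex) / (2 * (2 * of_nat j + 1) * (of_nat (lame_const n) - of_nat (lame_const j)))"
      by blast
    have "(of_nat (lame_const n) :: complex) \<noteq> of_nat (lame_const j)"
      using lame_const_less[OF less.prems(1)] by (metis less_irrefl of_nat_eq_iff)
    moreover have "1 + 2 * complex_of_nat j \<noteq> 0" "1 + complex_of_nat j \<noteq> 0"
      using of_nat_neq_0[of "2 * j", where 'a = complex] of_nat_neq_0[of j, where 'a = complex]
      by simp_all
    ultimately have k0: "\<kappa> \<noteq> 0"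
      unfolding \<kappa> divide_eq_0_iff mult_eq_0_iff by (simp add: add.commute)
    define \<gamma> :: complex where
      "\<gamma> = (of_nat j + 2) * (4 * of_nat j + 7) * (2 * of_nat j + 3) * (4 * of_nat j + 5) / 2"
    define N where "N = (j + 2) * (4 * j + 7) * (2 * j + 3) * (4 * j + 5)"
    have "\<gamma> = of_nat N / 2"
      by (simp only: \<gamma>_def N_def of_nat_mult of_nat_add of_nat_numeral)
    moreover have "N \<noteq> 0" by (simp add: N_def)
    ultimately have g0: "\<gamma> \<noteq> 0"
      by (metis divide_eq_0_iff of_nat_eq_0_iff zero_neq_numeral)
    have "poly (lame_coeff 1 n j) v = \<kappa> * \<gamma> * poly (lame_coeff 1 n (j + 2)) v"
      using lame_coeff_step[OF less.prems(1), of 1] less.prems(3)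
      by (simp add: \<kappa> \<gamma>_def)
    then have "poly (lame_coeff 1 n (Suc j + 1)) v = 0"
      using less.prems(2) k0 g0 by simp
    moreover have "n - Suc j < n - j" using less.prems(1) by linarith
    ultimately show False
      using less.hyps[of "Suc j"] less.prems False by simp
  qed
qed

lemma lame_curve_simple_roots:
  assumes "n \<ge> 1" "n < 8"
  shows "simple_roots (lame_curve 1 n)"
  unfolding simple_roots_def
proof (intro allI impI)
  fix v assume "poly (lame_curve 1 n) v = 0"
  define a where "a = lame_coeff 1 n 0"
  define b where "b = pCons 0 (smult 4 (lame_coeff 1 n 0)) + smult 3 (lame_coeff 1 n 1)"
  have ab: "lame_curve 1 n = a * b" by (simp add: lame_curve_def a_def b_def)
  have simple: "simple_roots a" "simple_roots b"
    using lame_curve_simple_roots_small[OF assms] by (simp_all add: a_def b_def)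
  have "\<not> (poly a v = 0 \<and> poly b v = 0)"
    using lame_coeff_no_common_root[of 0 n v] assms(1) by (auto simp: a_def b_def)
  moreover have "poly a v = 0 \<or> poly b v = 0"
    using \<open>poly (lame_curve 1 n) v = 0\<close> by (simp add: ab)
  ultimately show "poly (pderiv (lame_curve 1 n)) v \<noteq> 0"
    using simple unfolding ab simple_roots_def by (auto simp: pderiv_mult)
qed

text \<open>
Both \<open>z\<close> and \<open>g\<close> have weight four, and \<open>q\<^sub>j\<close> is homogeneous.
\<close>

lemma lame_coeff_scaling:
  assumes "j \<le> n"
  shows "poly (lame_coeff g n j) (g * v) = g ^ (n - j) * poly (lame_coeff 1 n j) v"
  using assms
proof (induction "n - j" arbitrary: j rule: less_induct)
  case less
  show ?case
  proof (cases "j = n")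
    case True
    then show ?thesis by (simp add: lame_coeff_top)
  next
    case False
    then have j: "j < n" using less.prems by simp
    then obtain d where d: "n = Suc (j + d)" using less_imp_Suc_add by blast
    have 1: "poly (lame_coeff g n (j + 1)) (g * v) = g ^ d * poly (lame_coeff 1 n (j + 1)) v"
      using less.hyps[of "j + 1"] j by (simp add: d)
    have 2: "g\<^sup>2 * poly (lame_coeff g n (j + 2)) (g * v) = g * g ^ d * poly (lame_coeff 1 n (j + 2)) v"
    proof (cases d)
      case 0
      then show ?thesis by (simp add: lame_coeff_above d)
    next
      case (Suc d')
      then show ?thesis
        using less.hyps[of "j + 2"] j by (simp add: d power2_eq_square mult_ac)
    qed
    define \<kappa> \<alpha> \<gamma> :: complex where
      "\<kappa> = (of_nat j + 1) / (2 * (2 * of_nat j + 1) * (of_nat (lame_const n) - of_nat (lame_const j)))"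
      and "\<alpha> = 8 * (of_nat j + 1)\<^sup>2 * (16 * (of_nat j + 1)\<^sup>2 + 5)"
      and "\<gamma> = (of_nat j + 2) * (4 * of_nat j + 7) * (2 * of_nat j + 3) * (4 * of_nat j + 5) / 2"
    have *: "poly (lame_coeff h n j) x = \<kappa> * ((h * \<alpha> + 4 * x) * poly (lame_coeff h n (j + 1)) x
        + \<gamma> * (h\<^sup>2 * poly (lame_coeff h n (j + 2)) x))" for h x
      by (subst lame_coeff_step[OF j]) (simp add: \<kappa>_def \<alpha>_def \<gamma>_def algebra_simps del: add_2_eq_Suc')
    show ?thesis
      unfolding * 1 2 by (simp add: d algebra_simps)
  qed
qed

lemma lame_curve_scaling:
  assumes "n \<ge> 1"
  shows "poly (lame_curve g n) (g * v) = g ^ (2 * n + 1) * poly (lame_curve 1 n) v"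
proof -
  obtain d where d: "n = Suc d" using assms by (cases n) auto
  have "poly (lame_coeff g n 0) (g * v) = g ^ n * poly (lame_coeff 1 n 0) v"
    "poly (lame_coeff g n 1) (g * v) = g ^ d * poly (lame_coeff 1 n 1) v"
    using lame_coeff_scaling[of 0 n g v] lame_coeff_scaling[of 1 n g v] by (simp_all add: d)
  then show ?thesis
    by (simp add: lame_curve_def d algebra_simps power2_eq_square power_add power_mult)
qed

lemma lame_curve_simple_roots_scaled:
  assumes "n \<ge> 1" "n < 8" "g \<noteq> 0"
  shows "simple_roots (lame_curve g n)"
  unfolding simple_roots_def
proof (intro allI impI)
  fix z assume z: "poly (lame_curve g n) z = 0"
  define v where "v = z / g"
  have gv: "z = g * v" using assms(3) by (simp add: v_def)
  have "poly (pcompose (lame_curve g n) [:0, g:]) x = poly (smult (g ^ (2 * n + 1)) (lame_curve 1 n)) x" for x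
    using lame_curve_scaling[OF assms(1), of g x] by (simp add: poly_pcompose mult.commute)
  then have eq: "pcompose (lame_curve g n) [:0, g:] = smult (g ^ (2 * n + 1)) (lame_curve 1 n)"
    by (simp add: poly_eq_poly_eq_iff[symmetric] fun_eq_iff)
  have "poly (lame_curve 1 n) v = 0"
    using z lame_curve_scaling[OF assms(1), of g v] assms(3) by (simp add: gv)
  then have "poly (pderiv (lame_curve 1 n)) v \<noteq> 0"
    using lame_curve_simple_roots[OF assms(1,2)] by (simp add: simple_roots_def)
  moreover have "poly (pderiv (pcompose (lame_curve g n) [:0, g:])) v =
      g ^ (2 * n + 1) * poly (pderiv (lame_curve 1 n)) v"
    unfolding eq by (simp add: pderiv_smult)
  moreover have "poly (pderiv (pcompose (lame_curve g n) [:0, g:])) v = poly (pderiv (lame_curve g n)) z * g"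
    by (simp add: pderiv_pcompose poly_pcompose pderiv_pCons gv mult.commute)
  ultimately show "poly (pderiv (lame_curve g n)) z \<noteq> 0" using assms(3) by auto
qed

section \<open>The spectral curve\<close>

text \<open>
The operator \<open>R(L, T)\<close>, grouped by powers of \<open>T\<close> so that the inner polynomials act through \<open>jet\<close>.
\<close>

definition oper_poly_germ ::
  "complex fls \<Rightarrow> (complex fls \<Rightarrow> complex fls) \<Rightarrow> complex poly poly \<Rightarrow> complex fls \<Rightarrow> complex fls" where
  "oper_poly_germ W T R F = (\<Sum>j\<le>degree R. jet W 0 (const_poly (coeff R j)) ((T ^^ j) F))"

lemma jet_const_poly_bound:
  assumes "degree a \<le> N"
  shows "jet W 0 (const_poly a) F = (\<Sum>i\<le>N. fls_const (coeff a i) * (quartic_op W ^^ i) F)"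
proof -
  have "degree (const_poly a) \<le> N"
    using assms by (intro degree_le) (auto simp: coeff_eq_0)
  then show ?thesis by (simp add: jet_def poly_app_bound)
qed

lemma jet_const_poly_add_arg:
  "jet W 0 (const_poly a) (F + G) = jet W 0 (const_poly a) F + jet W 0 (const_poly a) G"
proof -
  have "(quartic_op W ^^ i) (F + G) = (quartic_op W ^^ i) F + (quartic_op W ^^ i) G" for i
    by (induction i) (simp_all add: quartic_op_def eval_nat_numeral algebra_simps)
  then show ?thesis by (simp add: jet_const_poly_bound[OF order_refl] sum.distrib algebra_simps)
qed

lemma jet_const_poly_const_arg:
  "jet W 0 (const_poly a) (fls_const c * F) = fls_const c * jet W 0 (const_poly a) F"
proof -
  have "(quartic_op W ^^ i) (fls_const c * F) = fls_const c * (quartic_op W ^^ i) F" for i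
    by (induction i) (simp_all add: quartic_op_def eval_nat_numeral algebra_simps)
  then show ?thesis by (simp add: jet_const_poly_bound[OF order_refl] sum_distrib_left algebra_simps)
qed

lemma jet_const_poly_0_arg: "jet W 0 (const_poly a) 0 = 0"
  using jet_const_poly_const_arg[of W a 0 0] by simp

lemma quartic_op_jet_const_poly:
  "quartic_op W (jet W 0 (const_poly a) F) = jet W 0 (const_poly a) (quartic_op W F)"
proof -
  have "fls_deriv (jet W k (const_poly a) F) = jet W (Suc k) (const_poly a) F" for k
    by (simp add: deriv_jet)
  then have "(fls_deriv ^^ k) (jet W 0 (const_poly a) F) = jet W k (const_poly a) F" for k
    by (induction k) simp_all
  then have "(fls_deriv ^^ 4) (jet W 0 (const_poly a) F) = jet W 4 (const_poly a) F" .
  then show ?thesis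
    by (simp add: quartic_op_def[of W "jet W 0 (const_poly a) F"] jet_four jet_shift jet_diff jet_smult)
qed

lemma jet_const_poly_mult:
  "jet W 0 (const_poly (a * b)) F = jet W 0 (const_poly a) (jet W 0 (const_poly b) F)"
proof -
  have "(quartic_op W ^^ i) (jet W 0 (const_poly b) F) = jet W 0 (const_poly b) ((quartic_op W ^^ i) F)" for i
    by (induction i) (simp_all add: quartic_op_jet_const_poly)
  then have "jet W 0 (const_poly a) (jet W 0 (const_poly b) F) =
      poly_app (const_poly a) (\<lambda>i. jet W 0 (const_poly b) ((quartic_op W ^^ i) F))"
    by (simp add: jet_def[of W 0 "const_poly a"])
  then show ?thesis by (simp add: jet_mult const_poly_mult)
qed

lemma jet_const_poly_add:
  "jet W 0 (const_poly (a + b)) F = jet W 0 (const_poly a) F + jet W 0 (const_poly b) F"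
  by (simp add: const_poly_add jet_add)

lemma oper_poly_germ_bound:
  assumes "degree R \<le> N"
  shows "oper_poly_germ W T R F = (\<Sum>j\<le>N. jet W 0 (const_poly (coeff R j)) ((T ^^ j) F))"
  unfolding oper_poly_germ_def
  by (rule sum.mono_neutral_left) (use assms in \<open>auto simp: coeff_eq_0\<close>)

lemma oper_poly_germ_0 [simp]: "oper_poly_germ W T 0 F = 0"
  by (simp add: oper_poly_germ_def)

lemma oper_poly_germ_add:
  "oper_poly_germ W T (R + S) F = oper_poly_germ W T R F + oper_poly_germ W T S F"
proof -
  define N where "N = max (degree R) (degree S)"
  have "degree (R + S) \<le> N" "degree R \<le> N" "degree S \<le> N"
    by (simp_all add: N_def degree_add_le_max)
  then show ?thesis
    by (simp add: oper_poly_germ_bound jet_const_poly_add sum.distrib)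
qed

lemma oper_poly_germ_smult:
  "oper_poly_germ W T (smult a R) F = jet W 0 (const_poly a) (oper_poly_germ W T R F)"
proof -
  have "jet W 0 (const_poly a) (\<Sum>j\<in>I. f j) = (\<Sum>j\<in>I. jet W 0 (const_poly a) (f j))" for I :: "nat set" and f
    by (induction I rule: infinite_finite_induct) (simp_all add: jet_const_poly_0_arg jet_const_poly_add_arg)
  then show ?thesis
    using degree_smult_le[of a R]
    by (simp add: oper_poly_germ_bound[of _ "degree R"] jet_const_poly_mult)
qed

lemma oper_poly_germ_pCons:
  "oper_poly_germ W T (pCons a R) F = jet W 0 (const_poly a) F + oper_poly_germ W T R (T F)"
proof -
  have "oper_poly_germ W T (pCons a R) F =
      (\<Sum>j\<le>Suc (degree R). jet W 0 (const_poly (coeff (pCons a R) j)) ((T ^^ j) F))"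
    by (rule oper_poly_germ_bound) (rule degree_pCons_le)
  also have "\<dots> = jet W 0 (const_poly a) F + (\<Sum>j\<le>degree R. jet W 0 (const_poly (coeff R j)) ((T ^^ j) (T F)))"
    by (subst sum.atMost_Suc_shift) (simp add: funpow_swap1)
  finally show ?thesis by (simp add: oper_poly_germ_def)
qed

lemma oper_poly_germ_multiple:
  assumes "\<And>F. oper_poly_germ W T R F = 0"
  shows "oper_poly_germ W T (Q * R) F = 0"
proof (induction Q arbitrary: F)
  case (pCons a Q)
  have "oper_poly_germ W T (pCons a Q * R) F =
      jet W 0 (const_poly a) (oper_poly_germ W T R F) + (jet W 0 (const_poly 0) F + oper_poly_germ W T (Q * R) (T F))"
    by (simp only: mult_pCons_left oper_poly_germ_add oper_poly_germ_smult oper_poly_germ_pCons)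
  then show ?case using pCons.IH assms by (simp add: jet_const_poly_0_arg)
qed simp

lemma represents_oper_poly_germ:
  assumes "represents L (quartic_op W)" "represents M T"
  shows "represents (oper_poly R L M) (oper_poly_germ W T R)"
  using represents_oper_poly[OF assms, of R]
  by (simp add: oper_poly_germ_def[abs_def] jet_const_poly_bound[OF order_refl])

context euler_potential
begin

text \<open>
The product of four consecutive integers is not negative. Hence \<open>L\<close> lowers the order at 0 of every nonzero Laurent
series by exactly four.
\<close>

lemma euler_symbol_int_nonzero: "poly (ffact 4) (of_int s) + of_nat (lame_const n) \<noteq> 0"
proof -
  have "s * (s - 1) * (s - 2) * (s - 3) \<ge> 0"
  proof (cases "s \<le> 0 \<or> s \<ge> 3")
    case True
    then have "s * (s - 3) \<ge> 0" "(s - 1) * (s - 2) \<ge> 0"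
      by (auto intro: mult_nonneg_nonneg mult_nonpos_nonpos)
    then have "(s * (s - 3)) * ((s - 1) * (s - 2)) \<ge> 0" by (rule mult_nonneg_nonneg)
    then show ?thesis by (simp add: mult_ac)
  next
    case False
    then have "s = 1 \<or> s = 2" by auto
    then show ?thesis by auto
  qed
  moreover have "lame_const n > 0" using n by (simp add: lame_const_def)
  ultimately have "s * (s - 1) * (s - 2) * (s - 3) + int (lame_const n) \<noteq> 0" by linarith
  then have "(of_int (s * (s - 1) * (s - 2) * (s - 3) + int (lame_const n)) :: complex) \<noteq> 0"
    by (simp only: of_int_eq_0_iff) simp
  then show ?thesis by (simp add: eval_nat_numeral algebra_simps)
qed

text \<open>
In contrast to \<open>fls_subdegree\<close>, no number is the exact order of the zero series.
\<close>

definition exact_order :: "complex fls \<Rightarrow> int \<Rightarrow> bool" where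
  "exact_order F s \<longleftrightarrow> fls_nth F s \<noteq> 0 \<and> (\<forall>u<s. fls_nth F u = 0)"

lemma exact_order_unique: "exact_order F s \<Longrightarrow> exact_order F t \<Longrightarrow> s = t"
  unfolding exact_order_def by (metis linorder_neqE)

lemma exact_order_quartic_op:
  assumes "exact_order F s"
  shows "exact_order (quartic_op W F) (s - 4)"
proof -
  have low: "fls_nth F u = 0" if "u < s" for u using assms that by (simp add: exact_order_def)
  have WF: "fls_nth (W * F) t = (\<Sum>u=-4..t - s. fls_nth W u * fls_nth F (t - u))" for t
    by (rule fls_times_nth_bounds) (auto simp: W_low low)
  have "fls_nth (quartic_op W F) (s - 4) = (poly (ffact 4) (of_int s) + of_nat (lame_const n)) * fls_nth F s"
    by (simp add: quartic_op_def fls_nth_higher_deriv WF W_pole distrib_right)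
  moreover have "fls_nth (quartic_op W F) u = 0" if "u < s - 4" for u
    using that by (simp add: quartic_op_def fls_nth_higher_deriv WF low)
  ultimately show ?thesis
    using euler_symbol_int_nonzero[of s] assms by (simp add: exact_order_def)
qed

lemma exact_order_quartic_power:
  "exact_order F s \<Longrightarrow> exact_order ((quartic_op W ^^ i) F) (s - 4 * int i)"
proof (induction i)
  case (Suc i)
  from exact_order_quartic_op[OF Suc.IH[OF Suc.prems]] show ?case by (simp add: algebra_simps)
qed simp

lemma exact_order_jet:
  assumes F: "exact_order F s" and a: "a \<noteq> 0"
  shows "exact_order (jet W 0 (const_poly a) F) (s - 4 * int (degree a))"
proof -
  have ord: "exact_order ((quartic_op W ^^ i) F) (s - 4 * int i)" for i
    by (rule exact_order_quartic_power[OF F])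
  have const: "fls_nth (fls_const c * G) u = c * fls_nth G u" for c :: complex and G u by simp
  have nth: "fls_nth (jet W 0 (const_poly a) F) u =
      (\<Sum>i\<le>degree a. coeff a i * fls_nth ((quartic_op W ^^ i) F) u)" for u
    by (simp add: jet_const_poly_bound[OF order_refl] fls_nth_sum)
  have "fls_nth (jet W 0 (const_poly a) F) (s - 4 * int (degree a)) =
      (\<Sum>i\<in>{degree a}. coeff a i * fls_nth ((quartic_op W ^^ i) F) (s - 4 * int (degree a)))"
    unfolding nth using ord by (intro sum.mono_neutral_right) (auto simp: exact_order_def)
  moreover have "fls_nth (jet W 0 (const_poly a) F) u = 0" if "u < s - 4 * int (degree a)" for u
    unfolding nth using ord that by (intro sum.neutral) (auto simp: exact_order_def)
  ultimately show ?thesis using ord[of "degree a"] a by (simp add: exact_order_def)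
qed

text \<open>
Applied to a power of \<open>x\<close>, the first summand has order at 0 congruent to \<open>k\<close> and the second one to \<open>k + 2\<close> modulo 4. The
exponent \<open>k\<close> is chosen such that the lowest polynomial of \<open>T\<close> does not vanish at it.
\<close>

lemma no_linear_relation:
  assumes T: "diff_operator UNIV (4 * n + 2) A T" "A \<noteq> 0" "commutes T"
    and rel: "\<And>k. jet W 0 (const_poly a) (fls_X ^ k) + jet W 0 (const_poly b) (T (fls_X ^ k)) = 0"
  shows "a = 0 \<and> b = 0"
proof -
  define m where "m = 4 * n + 2"
  obtain R N where R: "has_symbol T R N" "coeff (R (- int m)) m \<noteq> 0" "\<And>d. d < - int m \<Longrightarrow> R d = 0"
    using commuting_symbol[OF T] unfolding m_def by metis
  have "R (- int m) \<noteq> 0" using R(2) by auto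
  then obtain k :: nat where k: "poly (R (- int m)) (of_nat k) \<noteq> 0"
    using poly_eq_0_if_nat_roots by blast
  have X: "exact_order (fls_X ^ k) (int k)"
    by (simp add: exact_order_def fls_nth_X_power)
  have TX: "exact_order (T (fls_X ^ k)) (int k - int m)"
    using k R(3) by (simp add: exact_order_def has_symbol_X_power[OF R(1)])
  have z: "\<not> exact_order 0 s" for s by (simp add: exact_order_def)
  have neg: "exact_order (- F) s \<longleftrightarrow> exact_order F s" for F s by (simp add: exact_order_def)
  have b: "b = 0"
  proof (rule ccontr)
    assume "b \<noteq> 0"
    then have 1: "exact_order (jet W 0 (const_poly b) (T (fls_X ^ k))) (int k - int m - 4 * int (degree b))"
      by (rule exact_order_jet[OF TX])
    have eq: "jet W 0 (const_poly b) (T (fls_X ^ k)) = - jet W 0 (const_poly a) (fls_X ^ k)"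
      using rel[of k] by (simp add: add_eq_0_iff)
    show False
    proof (cases "a = 0")
      case True
      then show False using 1 z unfolding eq by simp
    next
      case False
      then have "exact_order (jet W 0 (const_poly a) (fls_X ^ k)) (int k - 4 * int (degree a))"
        by (rule exact_order_jet[OF X])
      then have "int k - int m - 4 * int (degree b) = int k - 4 * int (degree a)"
        using 1 exact_order_unique unfolding eq neg by blast
      then show False unfolding m_def by presburger
    qed
  qed
  moreover have "a = 0"
  proof (rule ccontr)
    assume "a \<noteq> 0"
    then have "exact_order (jet W 0 (const_poly a) (fls_X ^ k)) (int k - 4 * int (degree a))"
      by (rule exact_order_jet[OF X])
    then show False using rel[of k] z by (simp add: b)
  qed
  ultimately show ?thesis by simp
qed

end

definition lame_operator :: "complex \<Rightarrow> nat \<Rightarrow> complex fls \<Rightarrow> complex fls \<Rightarrow> complex fls" where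
  "lame_operator g n P = rank2_op (fls_const (of_nat (lame_const n)) * P\<^sup>2) (plug P (lame_poly g n))"

lemma plug_lame_poly:
  "plug P (lame_poly g n) = (\<Sum>j\<le>n. smult (P ^ (2 * j)) (const_poly (lame_coeff g n j)))"
proof -
  have monom: "plug P (monom a k) = smult (P ^ k) (const_poly a)" for a k
  proof (induction k)
    case 0
    then show ?case by (simp add: monom_0 plug_pCons)
  next
    case (Suc k)
    then show ?case by (simp add: monom_Suc plug_pCons)
  qed
  have "plug P (\<Sum>j\<in>I. f j) = (\<Sum>j\<in>I. plug P (f j))" for I :: "nat set" and f
    by (induction I rule: infinite_finite_induct) (simp_all add: plug_add)
  then show ?thesis by (simp add: lame_poly_def monom)
qed

lemma coeff_plug_lame_poly:
  "coeff (plug P (lame_poly g n)) i = (\<Sum>j\<le>n. P ^ (2 * j) * fls_const (coeff (lame_coeff g n j) i))"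
  by (simp add: plug_lame_poly coeff_sum)

lemma degree_plug_lame_poly: "degree (plug P (lame_poly g n)) \<le> n"
proof (rule degree_le, intro allI impI)
  fix i assume i: "n < i"
  have "coeff (lame_coeff g n j) i = 0" if "j \<le> n" for j
    using lame_coeff_degree[OF that, of g] i that by (intro coeff_eq_0) linarith
  then show "coeff (plug P (lame_poly g n)) i = 0"
    by (simp add: coeff_plug_lame_poly)
qed

text \<open>
Only \<open>q\<^sub>0\<close> has degree \<open>n\<close> in \<open>z\<close>, so the leading coefficient of the operator is a constant.
\<close>

lemma lead_coeff_plug_lame_poly:
  "coeff (plug P (lame_poly g n)) n = fls_const (coeff (lame_coeff g n 0) n)"
proof -
  have "coeff (lame_coeff g n j) n = 0" if "j \<le> n" "j \<noteq> 0" for j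
    using lame_coeff_degree[OF that(1), of g] that by (intro coeff_eq_0) linarith
  then have "coeff (plug P (lame_poly g n)) n =
      (\<Sum>j\<in>{0}. P ^ (2 * j) * fls_const (coeff (lame_coeff g n j) n))"
    unfolding coeff_plug_lame_poly by (intro sum.mono_neutral_right) auto
  then show ?thesis by simp
qed

lemma lame_operator_diff_operator:
  assumes "differential_subring K" "P \<in> K"
  obtains A where "diff_operator K (4 * n + 2) A (lame_operator g n P)" "A \<noteq> 0"
proof -
  interpret differential_subring K by fact
  have W: "fls_const (of_nat (lame_const n)) * P\<^sup>2 \<in> K" using assms(2) by auto
  have "coeff (plug P (lame_poly g n)) i \<in> K" for i
    unfolding coeff_plug_lame_poly using assms(2) by auto
  from diff_operator_rank2[OF W this degree_plug_lame_poly]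
  have "diff_operator K (4 * n + 2) (2 * fls_const (coeff (lame_coeff g n 0) n)) (lame_operator g n P)"
    by (simp add: lame_operator_def lead_coeff_plug_lame_poly)
  moreover have "2 * fls_const (coeff (lame_coeff g n 0) n) \<noteq> 0"
    using lame_coeff_degree[of 0 n g] by simp
  ultimately show ?thesis by (rule that)
qed

abbreviation lame_potential :: "nat \<Rightarrow> (complex \<Rightarrow> complex) \<Rightarrow> complex fls" where
  "lame_potential n p \<equiv> fls_const (of_nat (lame_const n)) * (germ p)\<^sup>2"

context
  fixes n :: nat and g2 g3 :: complex and p :: "complex \<Rightarrow> complex"
  assumes n1: "n \<ge> 1" and wp: "weierstrass_p g2 g3 p"
begin

lemma weierstrass_p_meromorphic: "p meromorphic_on UNIV"
  using wp by (simp add: weierstrass_p_def)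

lemma weierstrass_germ_ode: "(fls_deriv (germ p))\<^sup>2 = 4 * (germ p) ^ 3 + fls_const g2 * (germ p) + fls_const g3"
  using wp weierstrass_ode_germ[OF weierstrass_p_meromorphic] by (simp add: weierstrass_p_def)

lemma weierstrass_germ_mem: "germ p \<in> mero_germs"
  by (rule germ_mem[OF weierstrass_p_meromorphic])

text \<open>
Squaring \<open>p = x\<^sup>-\<^sup>2 + h\<^sub>0 x\<^sup>2 + h\<^sub>2 x\<^sup>4 + \<dots>\<close> with \<open>h\<^sub>2 = - g3 / 28\<close>.
\<close>

lemma potential_coeffs:
  "u < -4 \<Longrightarrow> fls_nth (lame_potential n p) u = 0"
  "fls_nth (lame_potential n p) (-4) = of_nat (lame_const n)"
  "fls_nth (lame_potential n p) (-3) = 0" "fls_nth (lame_potential n p) (-2) = 0" "fls_nth (lame_potential n p) (-1) = 0" "fls_nth (lame_potential n p) 1 = 0"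
  "fls_nth (lame_potential n p) 2 = - of_nat (lame_const n) * g3 / 14"
proof -
  obtain h where h: "germ p = fls_X_inv\<^sup>2 + fls_X\<^sup>2 * fps_to_fls h"
    using weierstrass_p_germ[OF wp] by blast
  note hc = weierstrass_series_coeffs[OF h weierstrass_germ_ode]
  define q where "q = 2 * h + fps_X ^ 4 * h\<^sup>2"
  have ix: "fls_X_inv * fls_X = (1 :: complex fls)" by (simp flip: fls_inverse_X)
  have "(germ p)\<^sup>2 = fls_X_inv ^ 4 + fps_to_fls q"
  proof -
    have "fps_to_fls q = 2 * fps_to_fls h + fls_X ^ 4 * (fps_to_fls h)\<^sup>2"
      by (simp add: q_def fls_times_fps_to_fls fps_to_fls_power)
    then show ?thesis unfolding h using ix by algebra
  qed
  then have nth: "fls_nth (lame_potential n p) u = of_nat (lame_const n) * ((if u = -4 then 1 else 0) + (if u < 0 then 0 else fps_nth q (nat u)))" for u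
    by simp
  show "u < -4 \<Longrightarrow> fls_nth (lame_potential n p) u = 0"
    "fls_nth (lame_potential n p) (-4) = of_nat (lame_const n)"
    "fls_nth (lame_potential n p) (-3) = 0" "fls_nth (lame_potential n p) (-2) = 0" "fls_nth (lame_potential n p) (-1) = 0"
    unfolding nth by auto
  have n: "fps_nth (2 * a) i = 2 * fps_nth a i" for i and a :: "complex fps"
    by (simp add: numeral_fps_const)
  have "fps_nth q 1 = 2 * fps_nth h 1" "fps_nth q 2 = 2 * fps_nth h 2"
    unfolding q_def fps_add_nth n by (simp_all only: fps_X_power_mult_nth) simp_all
  then show "fls_nth (lame_potential n p) 1 = 0" "fls_nth (lame_potential n p) 2 = - of_nat (lame_const n) * g3 / 14"
    unfolding nth using hc(1,2) by simp_all
qed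

lemma lame_euler_potential: "euler_potential n (lame_potential n p)"
  by unfold_locales (use n1 potential_coeffs in auto)

lemma commutes_germ:
  assumes "represents M T"
  shows "opers_commute (L4 n p) M \<longleftrightarrow> (\<forall>F\<in>mero_germs. quartic_op (lame_potential n p) (T F) = T (quartic_op (lame_potential n p) F))"
  unfolding opers_commute_def
  using oper_eq_iff[OF represents_comp[OF represents_L4[OF weierstrass_p_meromorphic] assms] represents_comp[OF assms represents_L4[OF weierstrass_p_meromorphic]]]
  by simp

lemma commutes_powers:
  assumes "represents M T" "opers_commute (L4 n p) M"
  shows "euler_potential.commutes (lame_potential n p) T"
  unfolding euler_potential.commutes_def[OF lame_euler_potential]
proof
  fix k
  have "fls_X ^ k \<in> mero_germs"
    using germ_mem[of "\<lambda>x. x ^ k"] by (simp add: germ_monomial meromorphic_intros)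
  then show "T (quartic_op (lame_potential n p) (fls_X ^ k)) = quartic_op (lame_potential n p) (T (fls_X ^ k))"
    using commutes_germ[OF assms(1)] assms(2) by auto
qed

lemma g3_zero_if_commuting:
  assumes "diff_op_of_order (4 * n + 2) M" "opers_commute (L4 n p) M"
  shows "g3 = 0"
proof -
  obtain A T where T: "represents M T" "diff_operator mero_germs (4 * n + 2) A T" "A \<noteq> 0"
    using diff_op_of_order_germ[OF assms(1)] by metis
  have "fls_nth (lame_potential n p) 2 = 0"
    by (rule euler_potential.commuting_order_obstruction[OF lame_euler_potential T(2,3) commutes_powers[OF T(1) assms(2)]])
      (rule potential_coeffs)+
  moreover have "lame_const n > 0" using n1 by (simp add: lame_const_def)
  ultimately show ?thesis unfolding potential_coeffs(7) by simp
qed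

lemma weierstrass_ode_iff: "weierstrass_ode g2 0 p \<longleftrightarrow> g3 = 0"
  unfolding weierstrass_ode_germ[OF weierstrass_p_meromorphic] weierstrass_germ_ode by simp

context
  assumes g3: "g3 = 0"
begin

lemma lame_operator_ode: "rank2_ode (lame_potential n p) (plug (germ p) (lame_poly g2 n)) = 0"
proof -
  obtain h where h: "germ p = fls_X_inv\<^sup>2 + fls_X\<^sup>2 * fps_to_fls h"
    using weierstrass_p_germ[OF wp] by blast
  have "(fls_deriv (germ p))\<^sup>2 = 4 * (germ p) ^ 3 + fls_const g2 * (germ p)" using weierstrass_germ_ode g3 by simp
  from rank2_ode_plug[OF this weierstrass_deriv2[OF h weierstrass_germ_ode]]
  show ?thesis by (simp add: lame_poly_wp_ode)
qed

lemma lame_operator_commute: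
  "quartic_op (lame_potential n p) (lame_operator g2 n (germ p) F) = lame_operator g2 n (germ p) (quartic_op (lame_potential n p) F)"
  unfolding lame_operator_def by (rule rank2_op_commute[OF lame_operator_ode])

lemma lame_operator_square:
  "lame_operator g2 n (germ p) (lame_operator g2 n (germ p) F) = jet (lame_potential n p) 0 (const_poly (lame_curve g2 n)) F"
proof -
  obtain h where h: "germ p = fls_X_inv\<^sup>2 + fls_X\<^sup>2 * fps_to_fls h"
    using weierstrass_p_germ[OF wp] by blast
  have "(fls_deriv (germ p))\<^sup>2 = 4 * (germ p) ^ 3 + fls_const g2 * (germ p)" using weierstrass_germ_ode g3 by simp
  from rank2_square_plug[OF this weierstrass_deriv2[OF h weierstrass_germ_ode], of "of_nat (lame_const n)" "lame_poly g2 n"]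
  have "rank2_square (lame_potential n p) (plug (germ p) (lame_poly g2 n)) = const_poly (lame_curve g2 n)"
    by (simp add: lame_poly_wp_square plug_pCons)
  then show ?thesis
    unfolding lame_operator_def rank2_op_square[OF lame_operator_ode] by simp
qed

lemma commuting_operator_exists:
  "\<exists>M. diff_op_of_order (4 * n + 2) M \<and> opers_commute (L4 n p) M"
proof -
  obtain A where A: "diff_operator mero_germs (4 * n + 2) A (lame_operator g2 n (germ p))" "A \<noteq> 0"
    using lame_operator_diff_operator[OF mero.differential_subring_axioms weierstrass_germ_mem] by blast
  then obtain M where "diff_op_of_order (4 * n + 2) M" "represents M (lame_operator g2 n (germ p))"
    using diff_op_of_order_from_germ by blast
  then show ?thesis using commutes_germ lame_operator_commute by auto
qed

text \<open>
A polynomial in two variables is reduced modulo the monic quadratic one to the form \<open>c + d w\<close>, to which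
\<open>no_linear_relation\<close> applies.
\<close>

lemma spectral_curve:
  assumes M: "diff_op_of_order (4 * n + 2) M" "opers_commute (L4 n p) M"
  obtains b a where "b \<noteq> 0"
    "spectral_polynomial (L4 n p) M [:a\<^sup>2 - smult (b\<^sup>2) (lame_curve g2 n), - smult 2 a, 1:]"
proof -
  define S where "S = lame_operator g2 n (germ p)"
  have sub: "diff_operator UNIV m A T" if "diff_operator K m A T" for K m A T
    using that unfolding diff_operator_def by auto
  obtain A T where T: "represents M T" "diff_operator UNIV (4 * n + 2) A T" "A \<noteq> 0"
    using diff_op_of_order_germ[OF M(1)] sub by metis
  have U: "differential_subring UNIV" by unfold_locales auto
  obtain B where B: "diff_operator UNIV (4 * n + 2) B S" "B \<noteq> 0"
    using lame_operator_diff_operator[OF U UNIV_I] unfolding S_def by metis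
  interpret E: euler_potential n "lame_potential n p" by (rule lame_euler_potential)
  have cT: "E.commutes T" by (rule commutes_powers[OF T(1) M(2)])
  have cS: "E.commutes S" by (simp add: E.commutes_def S_def lame_operator_commute)
  obtain b a where b: "b \<noteq> 0" and T_eq: "T = (\<lambda>F. fls_const b * S F + jet (lame_potential n p) 0 (const_poly a) F)"
    using E.commutant_order[OF T(2,3) cT B cS] by blast
  define R where "R = [:a\<^sup>2 - smult (b\<^sup>2) (lame_curve g2 n), - smult 2 a, 1:]"
  define J where "J c F = jet (lame_potential n p) 0 (const_poly c) F" for c F
  have J_rules: "J (c + d) F = J c F + J d F" "J (c * d) F = J c (J d F)"
    "J c (F + G) = J c F + J c G" "J c (fls_const x * F) = fls_const x * J c F"
    "J (smult x c) F = fls_const x * J c F" "J (- c) F = - J c F" "J (c - d) F = J c F - J d F"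
    for c d F G x
  proof -
    show "J (c + d) F = J c F + J d F" by (simp add: J_def jet_const_poly_add)
    show "J (c * d) F = J c (J d F)" by (simp add: J_def jet_const_poly_mult)
    show "J c (F + G) = J c F + J c G" by (simp add: J_def jet_const_poly_add_arg)
    show "J c (fls_const x * F) = fls_const x * J c F" by (simp add: J_def jet_const_poly_const_arg)
    show sm: "J (smult x c) F = fls_const x * J c F" for x c by (simp add: J_def const_poly_smult jet_smult)
    show m: "J (- c) F = - J c F" for c using sm[of "-1" c] by (simp add: fls_const_uminus)
    show "J (c - d) F = J c F - J d F"
      using jet_const_poly_add[of "lame_potential n p" c "- d" F] m[of d] by (simp add: J_def)
  qed
  have S_add: "S (F + G) = S F + S G" and S_const: "S (fls_const x * F) = fls_const x * S F"
    and S_J: "S (J c F) = J c (S F)" for F G x c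
  proof -
    obtain s m where s: "S = (\<lambda>F. \<Sum>i\<le>(m::nat). s i * (fls_deriv ^^ i) F)"
      using B(1) unfolding diff_operator_def by blast
    have d: "(fls_deriv ^^ i) (F + G) = (fls_deriv ^^ i) F + (fls_deriv ^^ i) G"
      "(fls_deriv ^^ i) (fls_const x * F) = fls_const x * (fls_deriv ^^ i) F" for i F G x
      by (induction i) simp_all
    have add: "S (F + G) = S F + S G" for F G by (simp add: s d sum.distrib algebra_simps)
    have const: "S (fls_const x * F) = fls_const x * S F" for F x
      unfolding s d sum_distrib_left by (intro sum.cong refl mult.left_commute)
    have "S (quartic_op (lame_potential n p) F) = quartic_op (lame_potential n p) (S F)" for F
      by (simp only: S_def lame_operator_commute)
    then have pow: "S ((quartic_op (lame_potential n p) ^^ i) F) = (quartic_op (lame_potential n p) ^^ i) (S F)" for i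
      by (induction i) simp_all
    have zero: "S 0 = 0" using const[of 0 0] by simp
    have "S (\<Sum>i\<in>I. f i) = (\<Sum>i\<in>I. S (f i))" for I :: "nat set" and f
      by (induction I rule: infinite_finite_induct) (simp_all add: zero add)
    then show "S (J c F) = J c (S F)"
      by (simp add: J_def jet_const_poly_bound[OF order_refl] const pow)
    show "S (F + G) = S F + S G" "S (fls_const x * F) = fls_const x * S F"
      by (fact add const)+
  qed
  have SS: "S (S F) = J (lame_curve g2 n) F" for F
    by (simp add: S_def J_def lame_operator_square)
  have T': "T F = fls_const b * S F + J a F" for F by (simp add: T_eq J_def)
  have J1: "J 1 F = F" for F
    unfolding J_def by (subst jet_const_poly_bound[of 1 0]) simp_all
  have R0: "oper_poly_germ (lame_potential n p) T R F = 0" for F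
  proof -
    have "oper_poly_germ (lame_potential n p) T R F = J (a\<^sup>2 - smult (b\<^sup>2) (lame_curve g2 n)) F
        + (J (- smult 2 a) (T F) + J 1 (T (T F)))"
      by (simp only: R_def oper_poly_germ_pCons oper_poly_germ_0 add_0_right J_def)
    also have "J (a\<^sup>2 - smult (b\<^sup>2) (lame_curve g2 n)) F =
        J a (J a F) - fls_const b * (fls_const b * J (lame_curve g2 n) F)"
    proof -
      have "fls_const (b * b) = fls_const b * fls_const b" by (simp add: fls_const_mult_const)
      then show ?thesis by (simp only: J_rules power2_eq_square mult.assoc)
    qed
    also have "J (- smult 2 a) (T F) = - (2 * (fls_const b * J a (S F) + J a (J a F)))"
      unfolding J_rules T' fls_const_numeral by (simp add: algebra_simps)
    also have "T (T F) = fls_const b * (fls_const b * J (lame_curve g2 n) F + J a (S F))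
        + (fls_const b * J a (S F) + J a (J a F))"
      by (simp only: T' S_add S_const S_J SS J_rules)
    also have "J a (J a F) - fls_const b * (fls_const b * J (lame_curve g2 n) F)
        + (- (2 * (fls_const b * J a (S F) + J a (J a F)))
          + J 1 (fls_const b * (fls_const b * J (lame_curve g2 n) F + J a (S F))
            + (fls_const b * J a (S F) + J a (J a F)))) = 0"
      unfolding J1 by (simp add: algebra_simps)
    finally show ?thesis .
  qed
  note rep = represents_oper_poly_germ[OF represents_L4[OF weierstrass_p_meromorphic, of n] T(1)]
  have zero: "represents (\<lambda>f x. 0) (\<lambda>F. 0)"
    by (simp add: represents_def germ_const meromorphic_intros)
  have ann: "annihilates Q (L4 n p) M \<longleftrightarrow> (\<forall>F\<in>mero_germs. oper_poly_germ (lame_potential n p) T Q F = 0)" for Q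
    unfolding annihilates_def by (rule oper_eq_iff[OF rep zero])
  have "spectral_polynomial (L4 n p) M R"
    unfolding spectral_polynomial_def
  proof (intro conjI allI impI)
    show "R \<noteq> 0" by (simp add: R_def)
    show "annihilates R (L4 n p) M" by (simp add: ann R0)
    fix Q assume Q: "annihilates Q (L4 n p) M"
    obtain q r where qr: "pseudo_divmod Q R = (q, r)" by fastforce
    have "smult (coeff R (degree R) ^ (Suc (degree Q) - degree R)) Q = R * q + r"
      "r = 0 \<or> degree r < degree R"
      using pseudo_divmod[OF \<open>R \<noteq> 0\<close> qr] by auto
    then have Q_eq: "Q = q * R + r" and deg: "degree r < 2"
      by (auto simp: R_def mult.commute)
    define c d where "c = coeff r 0" and "d = coeff r 1"
    have r: "r = [:c, d:]"
    proof (rule poly_eqI)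
      fix i show "coeff r i = coeff [:c, d:] i"
        using deg by (cases "i < 2") (auto simp: c_def d_def coeff_eq_0 less_2_cases_iff coeff_pCons split: nat.splits)
    qed
    have "jet (lame_potential n p) 0 (const_poly c) (fls_X ^ k) + jet (lame_potential n p) 0 (const_poly d) (T (fls_X ^ k)) = 0" for k
    proof -
      have "fls_X ^ k \<in> mero_germs"
        using germ_mem[of "\<lambda>x. x ^ k"] by (simp add: germ_monomial meromorphic_intros)
      then have "oper_poly_germ (lame_potential n p) T Q (fls_X ^ k) = 0" using Q ann by blast
      then have "oper_poly_germ (lame_potential n p) T r (fls_X ^ k) = 0"
        by (simp add: Q_eq oper_poly_germ_add oper_poly_germ_multiple[OF R0])
      then show ?thesis by (simp add: r oper_poly_germ_pCons)
    qed
    then have "c = 0 \<and> d = 0" by (rule E.no_linear_relation[OF T(2,3) cT])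
    then show "R dvd Q" by (simp add: Q_eq r)
  qed
  then show ?thesis using that b unfolding R_def by blast
qed

text \<open>
At a singular point the derivative in \<open>w\<close> gives \<open>w = a(z)\<close>. Then \<open>z\<close> is a zero of \<open>F\<close> and of its derivative.
\<close>

lemma spectral_curve_nonsingular:
  assumes M: "diff_op_of_order (4 * n + 2) M" "opers_commute (L4 n p) M"
    and "n < 8" "g2 \<noteq> 0"
  shows "nonsingular_spectral_curve (L4 n p) M"
proof -
  define C where "C = lame_curve g2 n"
  obtain b a where b: "b \<noteq> 0"
    and sp: "spectral_polynomial (L4 n p) M [:a\<^sup>2 - smult (b\<^sup>2) C, - smult 2 a, 1:]"
    using spectral_curve[OF M] unfolding C_def by blast
  have simple: "simple_roots C"
    unfolding C_def by (rule lame_curve_simple_roots_scaled) (use n1 assms in auto)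
  have "nonsingular_curve [:a\<^sup>2 - smult (b\<^sup>2) C, - smult 2 a, 1:]"
    unfolding nonsingular_curve_def
  proof (intro allI impI)
    fix z w
    assume R: "eval2 [:a\<^sup>2 - smult (b\<^sup>2) C, - smult 2 a, 1:] z w = 0"
    show "eval2 (map_poly pderiv [:a\<^sup>2 - smult (b\<^sup>2) C, - smult 2 a, 1:]) z w \<noteq> 0 \<or>
       eval2 (pderiv [:a\<^sup>2 - smult (b\<^sup>2) C, - smult 2 a, 1:]) z w \<noteq> 0"
    proof (rule ccontr)
      assume "\<not> ?thesis"
      then have dz: "eval2 (map_poly pderiv [:a\<^sup>2 - smult (b\<^sup>2) C, - smult 2 a, 1:]) z w = 0"
        and dw: "eval2 (pderiv [:a\<^sup>2 - smult (b\<^sup>2) C, - smult 2 a, 1:]) z w = 0" by auto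
      have w: "w = poly a z" using dw by (simp add: eval2_def pderiv_pCons)
      then have "poly C z = 0"
        using R b by (simp add: eval2_def power2_eq_square algebra_simps)
      then have "poly (pderiv C) z \<noteq> 0" using simple by (simp add: simple_roots_def)
      moreover have "poly (pderiv C) z = 0"
        using dz w b by (simp add: eval2_def map_poly_pCons pderiv_diff pderiv_smult pderiv_minus
            power2_eq_square pderiv_mult algebra_simps)
      ultimately show False by simp
    qed
  qed
  with sp show ?thesis unfolding nonsingular_spectral_curve_def by blast
qed

end

lemma rational_case:
  assumes "g2 = 0" "g3 = 0"
  shows "\<forall>\<^sub>\<approx>x. p x = 1 / x\<^sup>2"
proof -
  obtain h where h: "germ p = fls_X_inv\<^sup>2 + fls_X\<^sup>2 * fps_to_fls h"
    using weierstrass_p_germ[OF wp] by blast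
  have "germ p = germ (\<lambda>x. 1 / x\<^sup>2)"
    using h weierstrass_series_coeffs(3)[OF h weierstrass_germ_ode assms] by (simp add: germ_inverse_square)
  then show ?thesis
    by (subst germ_eq_iff) (auto intro!: meromorphic_intros weierstrass_p_meromorphic)
qed

end

theorem corollary1p3:
  fixes n :: nat
  assumes "n \<ge> 1"
  shows
    "(\<forall>g2 g3 p. weierstrass_p g2 g3 p \<longrightarrow>
        ((\<exists>M. diff_op_of_order (4 * n + 2) M \<and> opers_commute (L4 n p) M)
           \<longleftrightarrow> weierstrass_ode g2 0 p) \<and>
        (weierstrass_ode g2 0 p \<longleftrightarrow> g3 = 0) \<and>
        (g3 = 0 \<and> g2 = 0 \<longrightarrow>
           oper_eq (L4 n p)
             (\<lambda>f x. (deriv ^^ 4) f x +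
                of_nat (n * (4 * n + 1) * (4 * n + 3) * (4 * n + 4)) / x ^ 4 * f x))) \<and>
     (n < 8 \<longrightarrow>
        (\<forall>\<^sub>\<infinity>g2. \<forall>p M. weierstrass_p g2 0 p \<and>
           diff_op_of_order (4 * n + 2) M \<and> opers_commute (L4 n p) M \<longrightarrow>
           nonsingular_spectral_curve (L4 n p) M))"
proof (intro conjI allI impI)
  fix g2 g3 p assume wp: "weierstrass_p g2 g3 p"
  show ode: "weierstrass_ode g2 0 p \<longleftrightarrow> g3 = 0"
    by (rule weierstrass_ode_iff[OF assms wp])
  show "(\<exists>M. diff_op_of_order (4 * n + 2) M \<and> opers_commute (L4 n p) M) \<longleftrightarrow> weierstrass_ode g2 0 p"
    unfolding ode using g3_zero_if_commuting[OF assms wp] commuting_operator_exists[OF assms wp] by blast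
  assume "g3 = 0 \<and> g2 = 0"
  then have "\<forall>\<^sub>\<approx>x. p x = 1 / x\<^sup>2" using rational_case[OF assms wp] by simp
  then have "\<forall>\<^sub>\<approx>x. L4 n p f x = (deriv ^^ 4) f x +
                of_nat (n * (4 * n + 1) * (4 * n + 3) * (4 * n + 4)) / x ^ 4 * f x" for f
    by eventually_elim (simp add: L4_def power_divide flip: power_mult)
  then show "oper_eq (L4 n p) (\<lambda>f x. (deriv ^^ 4) f x +
                of_nat (n * (4 * n + 1) * (4 * n + 3) * (4 * n + 4)) / x ^ 4 * f x)"
    unfolding oper_eq_def by blast
next
  assume "n < 8"
  have "\<forall>p M. weierstrass_p g2 0 p \<and> diff_op_of_order (4 * n + 2) M \<and> opers_commute (L4 n p) M \<longrightarrow>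
           nonsingular_spectral_curve (L4 n p) M" if "g2 \<noteq> 0" for g2
    using spectral_curve_nonsingular[OF assms _ refl _ _ \<open>n < 8\<close> that] by blast
  then have "{g2. \<not> (\<forall>p M. weierstrass_p g2 0 p \<and> diff_op_of_order (4 * n + 2) M \<and> opers_commute (L4 n p) M \<longrightarrow>
           nonsingular_spectral_curve (L4 n p) M)} \<subseteq> {0}" by blast
  then show "\<forall>\<^sub>\<infinity>g2. \<forall>p M. weierstrass_p g2 0 p \<and> diff_op_of_order (4 * n + 2) M \<and> opers_commute (L4 n p) M \<longrightarrow>
           nonsingular_spectral_curve (L4 n p) M"
    unfolding eventually_cofinite by (rule finite_subset) simp
qed

end
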